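(* Let $(P_1,\dots,P_d)\sim\text{Vec-NIFPP}(q_M,H,P_0)$, with $P_h=\mu_h/\mu_h(\Theta)$, and let $(\boldsymbol\theta_1,\dots,\boldsymbol\theta_d)$, $\boldsymbol\theta_h=(\theta_{h,1},\dots,\theta_{h,n_h})$, be a sample from it: given $(P_1,\dots,P_d)$, the variables $\theta_{h,1},\theta_{h,2},\dots$ are i.i.d. from $P_h$ within each group $h$, and independent across groups. Consider a realization of the sample with $K$ distinct values $\theta^{**}_1,\dots,\theta^{**}_K$ and counts $n_{h,k}=\#\{i\le n_h:\theta_{h,i}=\theta^{**}_k\}$, so that $\sum_{h=1}^d n_{h,k}>0$ for every $k$ and $\sum_{k=1}^K n_{h,k}=n_h$ for every $h$. Let $\boldsymbol U_n=(U_1,\dots,U_d)$ be the vector of auxiliary variables of the sample, with $U_h\mid T_h\sim\text{Gamma}(n_h,T_h)$ independently for $h=1,\dots,d$, where $T_h=\mu_h(\Theta)$. Then, working conditionally on $\boldsymbol U_n=\boldsymbol u=(u_1,\dots,u_d)$, for each group $j\in\{1,\dots,d\}$, $$\mathbb P(\theta_{j,n_j+1}\in\cdot\mid\boldsymbol\theta_1,\dots,\boldsymbol\theta_d,\boldsymbol u)\ \propto\ \sum_{k=1}^K\frac{\kappa_j(u_j,n_{j,k}+1)}{\kappa_j(u_j,n_{j,k})}\,\delta_{\theta^{**}_k}(\cdot)+\kappa_j(u_j,1)\Big(\prod_{h\ne j}\kappa_h(u_h,0)\Big)\frac{\Psi(K+1,\boldsymbol u)}{\Psi(K,\boldsymbol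 u)}\,P_0(\cdot),$$ where $\kappa_h(u,r)=\int_0^\infty e^{-us}s^{r}H_h(\mathrm ds)$, $\psi_h(u)=\int_0^\infty e^{-us}H_h(\mathrm ds)$ and $$\Psi(k,\boldsymbol u)=\sum_{m=0}^\infty q_M(m+k)\frac{(m+k)!}{m!}\prod_{h=1}^d(\psi_h(u_h))^m.$$
   Context: $d\ge1$ is an integer (the number of groups), $\Theta\subset\mathbb R^s$ is the parameter space, $P_0$ is a diffuse probability measure on $\Theta$, $q_M$ is a probability distribution on $\{1,2,3,\dots\}$, and $H=H_1\times\dots\times H_d$, where $H_j(\mathrm ds)=h(s\mid\gamma_j)\,\mathrm ds$ are probability distributions on $\mathbb R^+$ with densities from a common parametric family, with group-specific parameters $\gamma_j>0$. Let $M\sim q_M$; conditionally on $M$, let $S_{j,m}$ ($1\le j\le d$, $1\le m\le M$) be independent with $S_{j,m}\sim H_j$, and let $\tau_1,\dots,\tau_M$ be i.i.d. from $P_0$, independent of the $S_{j,m}$. Put $\mu_j=\sum_{m=1}^M S_{j,m}\delta_{\tau_m}$ and $P_j=\mu_j/\mu_j(\Theta)$. The law of $(P_1,\dots,P_d)$ is denoted $\text{Vec-NIFPP}(q_M,H,P_0)$. The auxiliary vector $\boldsymbol U_n$ is introduced by augmentation: the joint conditional law of the sample and $\boldsymbol U_n$ given $(\mu_1,\dots,\mu_d)$ is $\prod_{h=1}^d\frac{u_h^{n_h-1}}{\Gamma(n_h)}e^{-u_hT_h}\,\mathrm du_h\prod_{i=1}^{n_h}\mu_h(\mathrm d\theta_{h,i})$.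 The Gamma distribution is in the shape-rate parametrization. $\delta_x$ is the Dirac mass at $x$.
   Formalization: The auxiliary variable U_j of the predicted group is taken with law Gamma(n_j+1, T_j), counting the observation being predicted, instead of Gamma(n_j, T_j); with Gamma(n_j, T_j) the displayed formula is false in general (e.g. d=1, n_1=1, q_M uniform on {1,2}, H=Exp(1)). *)

theory Defs
  imports "HOL-Probability.Probability"
begin

text \<open>
  Conventions: groups are numbered by \<open>{1..d}\<close>, atoms by \<open>{1..M}\<close>, and the observations of
  group \<open>k\<close> by \<open>{1..n k}\<close>.  A weight array is a function \<open>S\<close> with \<open>S (k, m)\<close> the jump of
  component \<open>k\<close> at atom \<open>\<tau> m\<close>; a sample is a function \<open>x\<close> with \<open>x (k, i)\<close> the \<open>i\<close>-th
  observation of group \<open>k\<close>.  The measurable space \<open>\<Theta>\<close> is carried by \<open>P0\<close>.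
\<close>

definition jump_law :: "(real \<Rightarrow> real \<Rightarrow> real) \<Rightarrow> real \<Rightarrow> real measure" where
  "jump_law h g = density lborel (\<lambda>s. ennreal (h g s) * indicator {0<..} s)"

text \<open>The law of \<open>(S, \<tau>)\<close> given the number \<open>M\<close> of atoms.\<close>

definition atoms_law ::
  "nat \<Rightarrow> (nat \<Rightarrow> real measure) \<Rightarrow> 'a measure \<Rightarrow> nat
    \<Rightarrow> ((nat \<times> nat \<Rightarrow> real) \<times> (nat \<Rightarrow> 'a)) measure" where
  "atoms_law d H P0 M =
     (\<Pi>\<^sub>M (k, m) \<in> {1..d} \<times> {1..M}. H k) \<Otimes>\<^sub>M (\<Pi>\<^sub>M m \<in> {1..M}. P0)"

text \<open>\<open>\<mu>\<^sub>k = (\<Sum>m = 1..M. S (k, m) \<delta>\<^bsub>\<tau> m\<^esub>)\<close>, as the image under \<open>\<tau>\<close> of the measure on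
  \<open>{1..M}\<close> with point masses \<open>S (k, m)\<close>.\<close>

definition random_mu ::
  "'a measure \<Rightarrow> nat \<Rightarrow> (nat \<times> nat \<Rightarrow> real) \<Rightarrow> (nat \<Rightarrow> 'a) \<Rightarrow> nat \<Rightarrow> 'a measure" where
  "random_mu P0 M S \<tau> k =
     distr (density (count_space {1..M}) (\<lambda>m. ennreal (S (k, m)))) P0 \<tau>"

definition total_mass ::
  "'a measure \<Rightarrow> nat \<Rightarrow> (nat \<times> nat \<Rightarrow> real) \<Rightarrow> (nat \<Rightarrow> 'a) \<Rightarrow> nat \<Rightarrow> real" where
  "total_mass P0 M S \<tau> k = measure (random_mu P0 M S \<tau> k) (space P0)"

definition random_P ::
  "'a measure \<Rightarrow> nat \<Rightarrow> (nat \<times> nat \<Rightarrow> real) \<Rightarrow> (nat \<Rightarrow> 'a) \<Rightarrow> nat \<Rightarrow> 'a measure" where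
  "random_P P0 M S \<tau> k =
     scale_measure (inverse (emeasure (random_mu P0 M S \<tau> k) (space P0)))
       (random_mu P0 M S \<tau> k)"

definition obs_index :: "nat \<Rightarrow> (nat \<Rightarrow> nat) \<Rightarrow> (nat \<times> nat) set" where
  "obs_index d n = (SIGMA k:{1..d}. {1..n k})"

definition obs_space ::
  "nat \<Rightarrow> 'a measure \<Rightarrow> (nat \<Rightarrow> nat) \<Rightarrow> ((nat \<times> nat \<Rightarrow> 'a) \<times> (nat \<Rightarrow> real)) measure" where
  "obs_space d P0 n =
     (\<Pi>\<^sub>M ki \<in> obs_index d n. P0) \<Otimes>\<^sub>M (\<Pi>\<^sub>M k \<in> {1..d}. (borel :: real measure))"

text \<open>Joint law of a sample of sizes \<open>n\<close> from Vec-NIFPP\<open>(qM, H, P0)\<close> and of the auxiliary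
  variables of that sample: given \<open>\<mu>\<close>, the \<open>x (k, i)\<close> are i.i.d. from \<open>P\<^sub>k = \<mu>\<^sub>k / T\<^sub>k\<close> and
  \<open>U\<^sub>k\<close> is Gamma with shape \<open>n k\<close> and rate \<open>T\<^sub>k\<close>, all independent.  A Gamma law of integer
  shape \<open>n k \<ge> 1\<close> is the Erlang law, whose library density has shape \<open>Suc (n k - 1)\<close>.
  As \<open>P\<^sub>k(dx\<^sub>1) \<cdots> P\<^sub>k(dx\<^sub>n)\<close> equals \<open>T\<^sub>k\<^sup>-\<^sup>n \<mu>\<^sub>k(dx\<^sub>1) \<cdots> \<mu>\<^sub>k(dx\<^sub>n)\<close>, the factor for group \<open>k\<close>
  of the conditional law given \<open>\<mu>\<close> is
  \<open>u\<^sup>n\<^sup>-\<^sup>1 / \<Gamma>(n) \<cdot> exp (- u T\<^sub>k) du \<mu>\<^sub>k(dx\<^sub>1) \<cdots> \<mu>\<^sub>k(dx\<^sub>n)\<close>.\<close>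

definition augmented_law ::
  "nat \<Rightarrow> nat pmf \<Rightarrow> (nat \<Rightarrow> real measure) \<Rightarrow> 'a measure \<Rightarrow> (nat \<Rightarrow> nat)
    \<Rightarrow> ((nat \<times> nat \<Rightarrow> 'a) \<times> (nat \<Rightarrow> real)) measure" where
  "augmented_law d qM H P0 n =
     measure_pmf qM \<bind> (\<lambda>M. atoms_law d H P0 M \<bind> (\<lambda>(S, \<tau>).
       (\<Pi>\<^sub>M (k, i) \<in> obs_index d n. random_P P0 M S \<tau> k) \<Otimes>\<^sub>M
       (\<Pi>\<^sub>M k \<in> {1..d}. density lborel (\<lambda>u. ennreal (erlang_density (n k - 1) (total_mass P0 M S \<tau> k) u)))))"

definition kappa :: "real measure \<Rightarrow> real \<Rightarrow> nat \<Rightarrow> real" where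
  "kappa Hk u r = (\<integral>s. exp (- u * s) * s ^ r \<partial>Hk)"

definition laplace :: "real measure \<Rightarrow> real \<Rightarrow> real" where
  "laplace Hk u = (\<integral>s. exp (- u * s) \<partial>Hk)"

definition Psi ::
  "nat \<Rightarrow> nat pmf \<Rightarrow> (nat \<Rightarrow> real measure) \<Rightarrow> nat \<Rightarrow> (nat \<Rightarrow> real) \<Rightarrow> real" where
  "Psi d qM H c u =
     (\<Sum>m. pmf qM (m + c) * (fact (m + c) / fact m) * (\<Prod>k = 1..d. laplace (H k) (u k) ^ m))"

definition distinct_values :: "nat \<Rightarrow> (nat \<Rightarrow> nat) \<Rightarrow> (nat \<times> nat \<Rightarrow> 'a) \<Rightarrow> 'a set" where
  "distinct_values d n x = x ` obs_index d n"

definition group_count :: "(nat \<Rightarrow> nat) \<Rightarrow> (nat \<times> nat \<Rightarrow> 'a) \<Rightarrow> nat \<Rightarrow> 'a \<Rightarrow> nat" where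
  "group_count n x k y = card {i \<in> {1..n k}. x (k, i) = y}"

text \<open>The unnormalised predictive measure of group \<open>j\<close>, evaluated at \<open>A\<close>; the sum over the set of
  distinct values replaces a labelling of them.  The counts \<open>n\<close> are those of the observed sample,
  while \<open>u\<close> has to be read as the auxiliary vector of the sample that includes the observation
  being predicted: the joint law in the augmentation is
  \<open>\<Prod>\<^sub>k u\<^sub>k ^ (n k - 1) exp (- u\<^sub>k T\<^sub>k) \<Prod>\<^sub>i \<mu>\<^sub>k(dx (k, i))\<close> up to constants, so one more observation in group \<open>j\<close> contributes
  the factor \<open>u\<^sub>j \<mu>\<^sub>j(dx)\<close>.  If the shape of \<open>U\<^sub>j\<close> did not count it, that factor would
  be \<open>\<mu>\<^sub>j(dx) / T\<^sub>j\<close>, and the predictive law given \<open>u\<close> would not be of this form when the number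
  of atoms is random.\<close>

definition predictive_weight ::
  "nat \<Rightarrow> nat pmf \<Rightarrow> (nat \<Rightarrow> real measure) \<Rightarrow> 'a measure \<Rightarrow> (nat \<Rightarrow> nat) \<Rightarrow> nat
    \<Rightarrow> (nat \<times> nat \<Rightarrow> 'a) \<Rightarrow> (nat \<Rightarrow> real) \<Rightarrow> 'a set \<Rightarrow> real" where
  "predictive_weight d qM H P0 n j x u A =
     (let K = card (distinct_values d n x) in
       (\<Sum>y \<in> distinct_values d n x.
          kappa (H j) (u j) (group_count n x j y + 1) / kappa (H j) (u j) (group_count n x j y)
            * indicator A y)
       + kappa (H j) (u j) 1 * (\<Prod>k \<in> {1..d} - {j}. kappa (H k) (u k) 0)
          * (Psi d qM H (K + 1) u / Psi d qM H K u) * measure P0 A)"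

end

theory Submission
  imports Defs
begin

text \<open>
  Given the jumps and the \<open>M\<close> atoms, the joint law of the sample and the auxiliary vector is a finite
  sum over allocations \<open>c\<close> of the observations to the atoms; the powers of \<open>T\<^sub>k\<close> in the Gamma densities
  cancel those in \<open>P\<^sub>k = \<mu>\<^sub>k / T\<^sub>k\<close>, so integrating out the jumps turns the weight of \<open>c\<close> into
  \<open>\<Prod>\<^sub>k \<Prod>\<^sub>m \<kappa>\<^sub>k(u\<^sub>k, n\<^sub>k\<^sub>,\<^sub>m)\<close>, empty atoms contributing \<open>\<psi>\<^sub>k(u\<^sub>k)\<close>.  Allocations are then grouped by the
  partition they induce: there are \<open>M! / (M - K)!\<close> of them for each partition into \<open>K\<close> blocks, all
  with the same weight, and summing over \<open>M\<close> produces \<open>\<Psi>(K, u)\<close>.  One further observation in group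
  \<open>j\<close> either joins an occupied atom, which multiplies the weight by
  \<open>\<kappa>\<^sub>j(u\<^sub>j, n\<^sub>j\<^sub>,\<^sub>m + 1) / \<kappa>\<^sub>j(u\<^sub>j, n\<^sub>j\<^sub>,\<^sub>m)\<close>, or occupies one of the \<open>M - K\<close> empty atoms, which
  turns \<open>\<Psi>(K, u)\<close> into \<open>\<Psi>(K + 1, u) \<kappa>\<^sub>j(u\<^sub>j, 1) \<Prod>\<^sub>k\<^sub>\<noteq>\<^sub>j \<kappa>\<^sub>k(u\<^sub>k, 0)\<close> and draws a value from \<open>P0\<close>.
  Diffuseness of \<open>P0\<close> makes the partition readable from the observed values almost surely.
\<close>

text \<open>The conditional law is not obtained by dividing by the law of the observed data, which
  is never put in closed form. Instead, the integral of a test function of the sample and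
  \<open>u\<close>, times the indicator that the new observation lies in \<open>A\<close>, is
  written so that \<open>A\<close> enters only through \<open>predictive_weight\<close>. This form
  is used twice: with \<open>A\<close>, and with the whole space after multiplying the test function
  by the quotient of the two weights. The results agree, which is the defining identity of the
  conditional expectation. The quotient is legitimate because group \<open>j\<close> already has an
  observation, so the total weight is positive. The auxiliary vector belongs to the sample of sizes
  \<open>n'\<close>: the Gamma shape of group \<open>j\<close> counts the predicted observation, so
  no power of a total mass survives and the jumps separate over the atoms. Nonnegative extended real
  integrals are kept until the last lemma, so that sums and integrals commute freely;
  \<open>kappa\<close> and \<open>Psi\<close> are meaningful reals for \<open>u > 0\<close>, and an
  indicator removes all other \<open>u\<close>.\<close>

declare One_nat_def [simp del]

section \<open>Finite products of measures\<close>

lemma product_sigma_finite_const: "prob_space P \<Longrightarrow> product_sigma_finite (\<lambda>_. P)"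
  by (simp add: product_sigma_finite_def prob_space_imp_sigma_finite)

text \<open>The product measure is the image, under evaluation of \<open>\<tau>\<close>, of the
  weighted counting measure on allocations \<open>c\<close>. This is checked on boxes, where
  expanding a product of finite sums produces the sum over allocations. The points
  \<open>\<tau> m\<close> may coincide.\<close>

lemma nn_integral_PiM_finite_image:
  fixes w :: "'i \<Rightarrow> 'm \<Rightarrow> ennreal"
  assumes fin: "finite I" "finite B"
    and \<tau>: "\<And>m. m \<in> B \<Longrightarrow> \<tau> m \<in> space P"
    and Q: "product_sigma_finite Q" "\<And>i. sets (Q i) = sets P"
    and w: "\<And>i A. i \<in> I \<Longrightarrow> A \<in> sets P \<Longrightarrow> emeasure (Q i) A = (\<Sum>m\<in>B. w i m * indicator A (\<tau> m))"
    and F: "F \<in> borel_measurable (PiM I (\<lambda>_. P))"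
  shows "(\<integral>\<^sup>+x. F x \<partial>PiM I Q) = (\<Sum>c\<in>PiE I (\<lambda>_. B). (\<Prod>i\<in>I. w i (c i)) * F (\<lambda>i\<in>I. \<tau> (c i)))"
proof -
  interpret product_sigma_finite Q by fact
  let ?f = "\<lambda>c. \<lambda>i\<in>I. \<tau> (c i)"
  let ?D = "density (count_space (PiE I (\<lambda>_. B))) (\<lambda>c. \<Prod>i\<in>I. w i (c i))"
  have finP: "finite (PiE I (\<lambda>_. B))" using fin by (intro finite_PiE) auto
  have setsQ: "sets (PiM I Q) = sets (PiM I (\<lambda>_. P))" by (intro sets_PiM_cong) (simp_all add: Q)
  have m: "?f \<in> measurable ?D (PiM I Q)"
    using \<tau> by (auto simp: measurable_def space_PiM PiE_iff sets_eq_imp_space_eq[OF Q(2)])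
  have "distr ?D (PiM I Q) ?f = PiM I Q"
  proof (rule PiM_eqI[OF fin(1)])
    fix A assume A: "\<And>i. i \<in> I \<Longrightarrow> A i \<in> sets (Q i)"
    then have "PiE I A \<in> sets (PiM I Q)" using fin by (intro sets_PiM_I_finite) auto
    then have "emeasure (distr ?D (PiM I Q) ?f) (PiE I A) = (\<integral>\<^sup>+c. indicator (PiE I A) (?f c) \<partial>?D)"
      by (simp add: nn_integral_distr[OF m] flip: nn_integral_indicator)
    also have "\<dots> = (\<Sum>c\<in>PiE I (\<lambda>_. B). (\<Prod>i\<in>I. w i (c i)) * indicator (PiE I A) (?f c))"
      by (simp add: nn_integral_density nn_integral_count_space_finite[OF finP])
    also have "\<dots> = (\<Sum>c\<in>PiE I (\<lambda>_. B). \<Prod>i\<in>I. w i (c i) * indicator (A i) (\<tau> (c i)))"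
      using fin(1) by (intro sum.cong refl)
        (auto simp: prod.distrib indicator_def PiE_iff prod_zero_iff if_distrib cong: if_cong)
    also have "\<dots> = (\<Prod>i\<in>I. \<Sum>m\<in>B. w i m * indicator (A i) (\<tau> m))"
      using fin by (subst prod_sum_PiE) auto
    also have "\<dots> = (\<Prod>i\<in>I. emeasure (Q i) (A i))"
      using A by (intro prod.cong refl w[symmetric]) (auto simp: Q)
    finally show "emeasure (distr ?D (PiM I Q) ?f) (PiE I A) = (\<Prod>i\<in>I. emeasure (Q i) (A i))" .
  qed simp
  then have "(\<integral>\<^sup>+x. F x \<partial>PiM I Q) = (\<integral>\<^sup>+x. F x \<partial>distr ?D (PiM I Q) ?f)" by simp
  also have "\<dots> = (\<integral>\<^sup>+c. F (?f c) \<partial>?D)"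
    using F by (intro nn_integral_distr m) (simp cong: measurable_cong_sets add: setsQ)
  also have "\<dots> = (\<Sum>c\<in>PiE I (\<lambda>_. B). (\<Prod>i\<in>I. w i (c i)) * F (?f c))"
    by (simp add: nn_integral_density nn_integral_count_space_finite[OF finP])
  finally show ?thesis .
qed

text \<open>Both measures agree on boxes, where the integral of the product factors over the
  coordinates.\<close>

lemma (in product_sigma_finite) PiM_density:
  assumes fin: "finite I" and f: "\<And>i. f i \<in> borel_measurable (M i)"
    and D: "product_sigma_finite (\<lambda>i. density (M i) (f i))"
  shows "PiM I (\<lambda>i. density (M i) (f i)) = density (PiM I M) (\<lambda>x. \<Prod>i\<in>I. f i (x i))"
proof (rule product_sigma_finite.PiM_eqI[OF D fin, symmetric])
  show "sets (density (PiM I M) (\<lambda>x. \<Prod>i\<in>I. f i (x i))) = sets (PiM I (\<lambda>i. density (M i) (f i)))"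
    by (simp cong: sets_PiM_cong)
  fix A assume A: "\<And>i. i \<in> I \<Longrightarrow> A i \<in> sets (density (M i) (f i))"
  note f[measurable]
  have AM[measurable]: "\<And>i. i \<in> I \<Longrightarrow> A i \<in> sets (M i)" using A by simp
  have "PiE I A \<in> sets (PiM I M)" using AM fin by (intro sets_PiM_I_finite) auto
  then have "emeasure (density (PiM I M) (\<lambda>x. \<Prod>i\<in>I. f i (x i))) (PiE I A)
      = (\<integral>\<^sup>+x. (\<Prod>i\<in>I. f i (x i)) * indicator (PiE I A) x \<partial>PiM I M)"
    using fin by (subst emeasure_density) measurable
  also have "\<dots> = (\<integral>\<^sup>+x. (\<Prod>i\<in>I. f i (x i) * indicator (A i) (x i)) \<partial>PiM I M)"
    using fin by (intro nn_integral_cong)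
        (auto simp: prod.distrib indicator_def PiE_iff prod_zero_iff space_PiM if_distrib cong: if_cong)
  also have "\<dots> = (\<Prod>i\<in>I. \<integral>\<^sup>+x. f i x * indicator (A i) x \<partial>M i)"
    using fin by (intro product_nn_integral_prod) auto
  also have "\<dots> = (\<Prod>i\<in>I. emeasure (density (M i) (f i)) (A i))"
    by (intro prod.cong refl) (simp add: emeasure_density)
  finally show "emeasure (density (PiM I M) (\<lambda>x. \<Prod>i\<in>I. f i (x i))) (PiE I A)
    = (\<Prod>i\<in>I. emeasure (density (M i) (f i)) (A i))" .
qed

text \<open>Selecting coordinates of an i.i.d. family along an injection gives an i.i.d. family
  again. This integrates out the locations of unoccupied atoms and renames occupied atoms by block
  representatives.\<close>

lemma nn_integral_PiM_reindex:
  assumes P: "prob_space P" and \<phi>: "inj_on \<phi> I" "\<phi> \<in> I \<rightarrow> J"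
    and G: "G \<in> borel_measurable (PiM I (\<lambda>_. P))"
  shows "(\<integral>\<^sup>+\<tau>. G (\<lambda>i\<in>I. \<tau> (\<phi> i)) \<partial>PiM J (\<lambda>_. P)) = (\<integral>\<^sup>+\<sigma>. G \<sigma> \<partial>PiM I (\<lambda>_. P))"
proof -
  have [measurable]: "(\<lambda>\<tau>. \<lambda>i\<in>I. \<tau> (\<phi> i)) \<in> measurable (PiM J (\<lambda>_. P)) (PiM I (\<lambda>_. P))"
    using \<phi> by (intro measurable_restrict measurable_component_singleton) auto
  have "distr (PiM J (\<lambda>_. P)) (PiM I (\<lambda>_. P)) (\<lambda>\<tau>. \<lambda>i\<in>I. \<tau> (\<phi> i)) = PiM I (\<lambda>_. P)"
    using distr_PiM_reindex[of J "\<lambda>_. P" \<phi> I] P \<phi> by simp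
  then show ?thesis
    using G nn_integral_distr[of "\<lambda>\<tau>. \<lambda>i\<in>I. \<tau> (\<phi> i)" "PiM J (\<lambda>_. P)" "PiM I (\<lambda>_. P)" G] by simp
qed

text \<open>For two fixed coordinates, integrate one of them first with the other held fixed: it
  would have to hit a single point, which has mass 0. Finitely many pairs remain.\<close>

lemma AE_PiM_inj_on:
  assumes P: "prob_space P" and fin: "finite I"
    and diag: "{z \<in> space (P \<Otimes>\<^sub>M P). fst z = snd z} \<in> sets (P \<Otimes>\<^sub>M P)"
    and diffuse: "\<And>x. x \<in> space P \<Longrightarrow> emeasure P {x} = 0"
  shows "AE \<sigma> in PiM I (\<lambda>_. P). inj_on \<sigma> I"
proof -
  interpret product_sigma_finite "\<lambda>_. P" using P by (rule product_sigma_finite_const)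
  have "AE \<sigma> in PiM I (\<lambda>_. P). \<sigma> a \<noteq> \<sigma> b" if ab: "a \<in> I" "b \<in> I" "a \<noteq> b" for a b
  proof (rule AE_I')
    let ?N = "{\<sigma> \<in> space (PiM I (\<lambda>_. P)). \<sigma> a = \<sigma> b}"
    have "?N = (\<lambda>\<sigma>. (\<sigma> a, \<sigma> b)) -` {z \<in> space (P \<Otimes>\<^sub>M P). fst z = snd z} \<inter> space (PiM I (\<lambda>_. P))"
      using ab by (auto simp: space_PiM space_pair_measure)
    also have "\<dots> \<in> sets (PiM I (\<lambda>_. P))"
      using ab by (intro measurable_sets[OF _ diag]) simp
    finally have N: "?N \<in> sets (PiM I (\<lambda>_. P))" .
    have I: "I = insert a (I - {a})" using ab by auto
    have "emeasure (PiM I (\<lambda>_. P)) ?N = (\<integral>\<^sup>+\<sigma>. indicator ?N \<sigma> \<partial>PiM (insert a (I - {a})) (\<lambda>_. P))"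
      using N I by simp
    also have "\<dots> = (\<integral>\<^sup>+\<sigma>. \<integral>\<^sup>+x. indicator ?N (\<sigma>(a := x)) \<partial>P \<partial>PiM (I - {a}) (\<lambda>_. P))"
      using fin N I by (intro product_nn_integral_insert) auto
    also have "\<dots> = (\<integral>\<^sup>+\<sigma>. \<integral>\<^sup>+x. indicator {\<sigma> b} x \<partial>P \<partial>PiM (I - {a}) (\<lambda>_. P))"
      using ab by (intro nn_integral_cong) 
        (auto simp: indicator_def space_PiM PiE_iff extensional_def)
    also have "\<dots> = (\<integral>\<^sup>+\<sigma>. 0 \<partial>PiM (I - {a}) (\<lambda>_. P))"
    proof (intro nn_integral_cong)
      fix \<sigma> assume "\<sigma> \<in> space (PiM (I - {a}) (\<lambda>_. P))"
      then have b: "\<sigma> b \<in> space P" using ab by (auto simp: space_PiM)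
      \<comment> \<open>Singletons are measurable as sections of the measurable diagonal.\<close>
      have "{\<sigma> b} \<in> sets P"
      proof -
        have "{\<sigma> b} = Pair (\<sigma> b) -` {z \<in> space (P \<Otimes>\<^sub>M P). fst z = snd z}"
          using b by (auto simp: space_pair_measure)
        then show ?thesis using sets_Pair1[OF diag] by simp
      qed
      then show "(\<integral>\<^sup>+x. indicator {\<sigma> b} x \<partial>P) = 0" using diffuse[OF b] by simp
    qed
    finally show "?N \<in> null_sets (PiM I (\<lambda>_. P))" using N by auto
  qed auto
  then have "AE \<sigma> in PiM I (\<lambda>_. P). \<forall>a\<in>I. \<forall>b\<in>I. a \<noteq> b \<longrightarrow> \<sigma> a \<noteq> \<sigma> b"
    using fin by (auto simp: AE_finite_all)
  then show ?thesis by eventually_elim (auto simp: inj_on_def)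
qed

lemma card_injections:
  assumes "finite A" "finite B"
  shows "real (card {f \<in> PiE A (\<lambda>_. B). inj_on f A})
    = (if card A \<le> card B then fact (card B) / fact (card B - card A) else 0)"
  using assms(1)
proof (induction A rule: finite_induct)
  case empty
  then show ?case by (simp add: PiE_empty_domain)
next
  case (insert a A)
  let ?J = "\<lambda>A. {f \<in> PiE A (\<lambda>_. B). inj_on f A}"
  have finJ: "finite (?J A)" using insert assms by (auto intro!: finite_PiE)
  let ?S = "SIGMA f:?J A. B - f ` A"
  have 1: "f = g \<and> b = c"
    if *: "f \<in> PiE A (\<lambda>_. B)" "g \<in> PiE A (\<lambda>_. B)" "f(a := b) = g(a := c)" for f g b c
  proof -
    have "f x = g x" for x
      using fun_cong[OF *(3), of x] PiE_arb[OF *(1) insert.hyps(2)] PiE_arb[OF *(2) insert.hyps(2)]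
      by (cases "x = a") auto
    then show ?thesis using fun_cong[OF *(3), of a] by auto
  qed
  have 2: "f(a := b) \<in> ?J (insert a A)" if *: "f \<in> ?J A" "b \<in> B - f ` A" for f b
  proof -
    have "(f(a := b)) ` A = f ` A" using insert.hyps by auto
    moreover have "inj_on (f(a := b)) A" using * by (intro inj_on_fun_updI) auto
    ultimately show ?thesis
      using * insert.hyps by (auto simp: inj_on_insert PiE_iff extensional_def split: if_splits)
  qed
  have 3: "g \<in> (\<lambda>(f, b). f(a := b)) ` ?S" if *: "g \<in> ?J (insert a A)" for g
  proof -
    \<comment> \<open>Resetting the value at \<open>a\<close> to \<open>undefined\<close> makes the
      function extensional on \<open>A\<close>.\<close>
    let ?f = "g(a := undefined)"
    have im: "?f ` A = g ` A" using insert.hyps by auto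
    have "inj_on ?f A \<longleftrightarrow> inj_on g A" using insert.hyps by (intro inj_on_cong) auto
    then have "(?f, g a) \<in> ?S"
      using * insert.hyps im by (auto simp: PiE_iff extensional_def inj_on_insert)
    then show ?thesis by (rule rev_image_eqI) simp
  qed
  have "bij_betw (\<lambda>(f, b). f(a := b)) ?S (?J (insert a A))"
    unfolding bij_betw_def
  proof (intro conjI equalityI subsetI)
    show "inj_on (\<lambda>(f, b). f(a := b)) ?S" using 1 by (auto intro!: inj_onI)
    show "g \<in> ?J (insert a A)" if "g \<in> (\<lambda>(f, b). f(a := b)) ` ?S" for g
      using that 2 by auto
    show "g \<in> (\<lambda>(f, b). f(a := b)) ` ?S" if "g \<in> ?J (insert a A)" for g
      using that by (rule 3)
  qed
  then have "card (?J (insert a A)) = card (SIGMA f:?J A. B - f ` A)"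
    by (simp add: bij_betw_same_card)
  also have "\<dots> = (\<Sum>f\<in>?J A. card (B - f ` A))"
    using finJ assms by (intro card_SigmaI) auto
  also have "\<dots> = (\<Sum>f\<in>?J A. card B - card A)"
    using insert assms by (intro sum.cong refl, subst card_Diff_subset) (auto simp: PiE_iff card_image)
  also have "\<dots> = card (?J A) * (card B - card A)" by simp
  finally have "real (card (?J (insert a A))) = real (card (?J A)) * real (card B - card A)"
    by simp
  also have "\<dots> = (if card (insert a A) \<le> card B
      then fact (card B) / fact (card B - card (insert a A)) else 0)"
  \<comment> \<open>Otherwise the truncated difference \<open>card B - card A\<close> is 0, which
    agrees with the value 0 on the right.\<close>
  proof (cases "card A < card B")
    case True
    then obtain k where "card B = Suc (card A + k)" by (metis less_iff_Suc_add)
    moreover have "x / fact (Suc k) * real (Suc k) = x / fact k" for x :: real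
      by (simp del: of_nat_Suc)
    ultimately show ?thesis using insert by (simp del: fact_Suc of_nat_Suc)
  qed (use insert in auto)
  finally show ?case .
qed

section \<open>Allocations and the partitions they induce\<close>

text \<open>The partition induced by \<open>c\<close> is encoded by the map sending each index to a representative of
  its block.  The choice depends on the block only, so allocations with the same partition have the
  same representative map.\<close>

definition canon :: "'e set \<Rightarrow> ('e \<Rightarrow> 'b) \<Rightarrow> 'e \<Rightarrow> 'e" where
  "canon I c = (\<lambda>e\<in>I. SOME e'. e' \<in> I \<and> c e' = c e)"

text \<open>The fixed points of \<open>canon\<close>: exactly one map for each set partition of
  \<open>I\<close>, so this set serves as the index set for partitions.\<close>

definition canons :: "'e set \<Rightarrow> ('e \<Rightarrow> 'e) set" where
  "canons I = {r \<in> PiE I (\<lambda>_. I). canon I r = r}"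

lemma canon_in:
  assumes "e \<in> I" shows "canon I c e \<in> I" "c (canon I c e) = c e"
proof -
  have "(SOME e'. e' \<in> I \<and> c e' = c e) \<in> I \<and> c (SOME e'. e' \<in> I \<and> c e' = c e) = c e"
    by (rule someI_ex) (use assms in blast)
  then show "canon I c e \<in> I" "c (canon I c e) = c e" using assms by (simp_all only: canon_def restrict_apply' simp_thms)
qed

lemma canon_eq_iff:
  assumes "e \<in> I" "e' \<in> I" shows "canon I c e = canon I c e' \<longleftrightarrow> c e = c e'"
proof
  assume "canon I c e = canon I c e'"
  then show "c e = c e'" using canon_in(2)[OF assms(1), of c] canon_in(2)[OF assms(2), of c] by metis
next
  assume "c e = c e'"
  then show "canon I c e = canon I c e'" using assms by (simp only: canon_def restrict_apply')
qed

text \<open>Injective relabelling does not change which indices share a value. It is applied with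
  \<open>f\<close> assigning atom labels to blocks, and with \<open>f\<close> assigning observed
  values to blocks.\<close>

lemma canon_comp:
  assumes "\<And>e. e \<in> I \<Longrightarrow> c' e = f (c e)" "inj_on f (c ` I)"
  shows "canon I c' = canon I c"
proof -
  have "e' \<in> I \<and> c' e' = c' e \<longleftrightarrow> e' \<in> I \<and> c e' = c e" if "e \<in> I" for e e'
    using assms that by (auto simp: inj_on_def)
  then show ?thesis unfolding canon_def by (intro restrict_ext) simp
qed

lemma canon_canons: "canon I c \<in> canons I"
proof -
  have "canon I (canon I c) = canon I c"
  proof -
    have "e' \<in> I \<and> canon I c e' = canon I c e \<longleftrightarrow> e' \<in> I \<and> c e' = c e" if "e \<in> I" for e e'
      using canon_eq_iff[of e' I e c] that by blast
    then have "(\<lambda>e\<in>I. SOME e'. e' \<in> I \<and> canon I c e' = canon I c e) = (\<lambda>e\<in>I. SOME e'. e' \<in> I \<and> c e' = c e)"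
      by (intro restrict_ext) simp
    then show ?thesis by (simp only: canon_def[symmetric])
  qed
  moreover have "canon I c \<in> PiE I (\<lambda>_. I)"
    using canon_in(1)[of _ I c] by (auto simp: PiE_iff) (simp add: canon_def)
  ultimately show ?thesis by (simp add: canons_def)
qed

lemma canons_idem: "r \<in> canons I \<Longrightarrow> e \<in> I \<Longrightarrow> r (r e) = r e"
  using canon_in(2)[of e I r] by (simp add: canons_def)

lemma finite_canons: "finite I \<Longrightarrow> finite (canons I)"
  unfolding canons_def by (auto intro!: finite_PiE)

lemma canons_image: "r \<in> canons I \<Longrightarrow> r ` I \<subseteq> I"
  by (auto simp: canons_def)

text \<open>An allocation is the same thing as a partition together with an injective labelling of
  its blocks, the blocks being named by their representatives.\<close>

lemma sum_labellings_by_canon: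
  assumes I: "finite I" and B: "finite B"
  shows "(\<Sum>c\<in>PiE I (\<lambda>_. B). g c) =
    (\<Sum>r\<in>canons I. \<Sum>\<phi>\<in>{\<phi> \<in> PiE (r ` I) (\<lambda>_. B). inj_on \<phi> (r ` I)}. g (\<lambda>e\<in>I. \<phi> (r e)))"
proof -
  let ?J = "\<lambda>r. {\<phi> \<in> PiE (r ` I) (\<lambda>_. B). inj_on \<phi> (r ` I)}"
  have fin: "finite (?J r)" for r
    by (rule finite_subset[of _ "PiE (r ` I) (\<lambda>_. B)"]) (use I B in \<open>auto intro!: finite_PiE\<close>)
  have "(\<Sum>c\<in>PiE I (\<lambda>_. B). g c) = (\<Sum>(r, \<phi>)\<in>(SIGMA r:canons I. ?J r). g (\<lambda>e\<in>I. \<phi> (r e)))"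
  \<comment> \<open>The forward map keeps only the labels of the representatives. No information is
    lost, since \<open>c\<close> takes the same value at an index and at its representative.\<close>
  proof (rule sum.reindex_bij_witness[where i = "\<lambda>(r, \<phi>). \<lambda>e\<in>I. \<phi> (r e)"
        and j = "\<lambda>c. (canon I c, restrict c (canon I c ` I))"])
    fix c assume c: "c \<in> PiE I (\<lambda>_. B)"
    show 1: "(case (canon I c, restrict c (canon I c ` I)) of (r, \<phi>) \<Rightarrow> \<lambda>e\<in>I. \<phi> (r e)) = c"
      using c canon_in(2)[of _ I c] by (auto simp: fun_eq_iff PiE_iff extensional_def)
    have "inj_on c (canon I c ` I)"
      using canon_in[of _ I c] canon_eq_iff[of _ I _ c] by (auto simp: inj_on_def)
    then show "(canon I c, restrict c (canon I c ` I)) \<in> (SIGMA r:canons I. ?J r)"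
      using c canon_canons[of I c] canon_in(1)[of _ I c]
      by (auto simp: PiE_iff inj_on_def)
    show "(case (canon I c, restrict c (canon I c ` I)) of (r, \<phi>) \<Rightarrow> g (\<lambda>e\<in>I. \<phi> (r e))) = g c"
      using 1 by simp
  next
    fix p assume "p \<in> (SIGMA r:canons I. ?J r)"
    then obtain r \<phi> where p: "p = (r, \<phi>)" "r \<in> canons I" "\<phi> \<in> PiE (r ` I) (\<lambda>_. B)" "inj_on \<phi> (r ` I)"
      by auto
    let ?c = "\<lambda>e\<in>I. \<phi> (r e)"
    have c: "canon I ?c = r"
      using p by (subst canon_comp[where c = r and f = \<phi>]) (auto simp: canons_def)
    have "restrict ?c (r ` I) = \<phi>"
      using p canons_image[OF p(2)] canons_idem[OF p(2)]
      by (auto simp: fun_eq_iff restrict_def PiE_iff extensional_def)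
    then show "(canon I (case p of (r, \<phi>) \<Rightarrow> \<lambda>e\<in>I. \<phi> (r e)),
        restrict (case p of (r, \<phi>) \<Rightarrow> \<lambda>e\<in>I. \<phi> (r e)) (canon I (case p of (r, \<phi>) \<Rightarrow> \<lambda>e\<in>I. \<phi> (r e)) ` I)) = p"
      using c p by simp
    show "(case p of (r, \<phi>) \<Rightarrow> \<lambda>e\<in>I. \<phi> (r e)) \<in> PiE I (\<lambda>_. B)"
      using p by (auto simp: PiE_iff)
  qed
  also have "\<dots> = (\<Sum>r\<in>canons I. \<Sum>\<phi>\<in>?J r. g (\<lambda>e\<in>I. \<phi> (r e)))"
    using fin by (intro sum.Sigma[symmetric] ballI finite_canons[OF I])
  finally show ?thesis .
qed

lemma sum_PiE_insert:
  assumes "e \<notin> I"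
  shows "(\<Sum>c\<in>PiE (insert e I) (\<lambda>_. B). g c) = (\<Sum>c\<in>PiE I (\<lambda>_. B). \<Sum>m\<in>B. g (c(e := m)))"
    (is "?l = ?r")
proof -
  have "?l = (\<Sum>(c, m)\<in>PiE I (\<lambda>_. B) \<times> B. g (c(e := m)))"
    by (rule sum.reindex_bij_witness[where i = "\<lambda>(c, m). c(e := m)" and j = "\<lambda>c. (c(e := undefined), c e)"])
      (use assms in \<open>auto simp: PiE_iff extensional_def fun_eq_iff split: if_splits\<close>)
  then show ?thesis by (simp add: sum.cartesian_product)
qed

lemma group_count_insert:
  assumes "n' = n(j := n j + 1)"
  shows "group_count n' (c((j, n j + 1) := m)) k y = group_count n c k y + (if k = j \<and> y = m then 1 else 0)"
proof (cases "k = j")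
  case True
  have "{i \<in> {1..n j + 1}. (c((j, n j + 1) := m)) (j, i) = y}
    = {i \<in> {1..n j}. c (j, i) = y} \<union> (if y = m then {n j + 1} else {})"
    by (auto simp: le_Suc_eq)
  then show ?thesis using True by (simp add: group_count_def assms)
qed (simp add: group_count_def assms)

text \<open>A representative map is itself treated as a sample whose values are indices, so
  \<open>group_count n r k y\<close> is the number of group \<open>k\<close> observations in the
  block represented by \<open>y\<close>.\<close>

lemma group_count_comp:
  assumes "k \<in> {1..d}" "inj_on \<phi> (r ` obs_index d n)"
  shows "y \<in> r ` obs_index d n \<Longrightarrow>
      group_count n (\<lambda>e\<in>obs_index d n. \<phi> (r e)) k (\<phi> y) = group_count n r k y"
    and "m \<notin> \<phi> ` r ` obs_index d n \<Longrightarrow> group_count n (\<lambda>e\<in>obs_index d n. \<phi> (r e)) k m = 0"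
proof -
  have ind: "(k, i) \<in> obs_index d n" if "i \<in> {1..n k}" for i
    using assms(1) that by (auto simp: obs_index_def)
  show "group_count n (\<lambda>e\<in>obs_index d n. \<phi> (r e)) k (\<phi> y) = group_count n r k y"
    if "y \<in> r ` obs_index d n"
    unfolding group_count_def using assms(2) that ind
    by (intro arg_cong[where f = card]) (auto simp: inj_on_eq_iff)
  show "group_count n (\<lambda>e\<in>obs_index d n. \<phi> (r e)) k m = 0" if "m \<notin> \<phi> ` r ` obs_index d n"
  proof -
    have "{i \<in> {1..n k}. (\<lambda>e\<in>obs_index d n. \<phi> (r e)) (k, i) = m} = {}"
      using that ind by auto
    then show ?thesis unfolding group_count_def by simp
  qed
qed

text \<open>Up to the geometric series being differentiated \<open>c\<close> times, this is a power
  series of radius 1; each induction step is one termwise differentiation.\<close>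

lemma summable_fact_shift:
  fixes x :: real
  assumes "\<bar>x\<bar> < 1" shows "summable (\<lambda>m. fact (m + c) / fact m * x ^ m)"
  using assms
proof (induction c arbitrary: x)
  case 0
  then show ?case by (simp add: summable_geometric)
next
  case (Suc c)
  have "summable (\<lambda>m. diffs (\<lambda>m. fact (m + c) / fact m :: real) m * x ^ m)"
    using Suc by (intro termdiff_converges[where K = 1]) auto
  moreover have "diffs (\<lambda>m. fact (m + c) / fact m :: real) = (\<lambda>m. fact (m + Suc c) / fact m)"
    by (intro ext) (simp add: diffs_def field_simps del: of_nat_Suc)
  ultimately show ?case by simp
qed

section \<open>The conditional law of the observations given the jumps and atoms\<close>

lemma prod_obs_index:
  fixes g :: "nat \<Rightarrow> 'b \<Rightarrow> 'c :: comm_monoid_mult"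
  assumes B: "finite B" and c: "\<And>k i. (k, i) \<in> obs_index d n \<Longrightarrow> c (k, i) \<in> B"
  shows "(\<Prod>(k, i)\<in>obs_index d n. g k (c (k, i))) = (\<Prod>k=1..d. \<Prod>m\<in>B. g k m ^ group_count n c k m)"
proof -
  have "(\<Prod>(k, i)\<in>obs_index d n. g k (c (k, i))) = (\<Prod>k=1..d. \<Prod>i=1..n k. g k (c (k, i)))"
    unfolding obs_index_def by (simp add: prod.Sigma)
  also have "\<dots> = (\<Prod>k=1..d. \<Prod>m\<in>B. \<Prod>i\<in>{i\<in>{1..n k}. c (k, i) = m}. g k (c (k, i)))"
    using B c by (intro prod.cong refl prod.group[symmetric]) (auto simp: obs_index_def)
  also have "\<dots> = (\<Prod>k=1..d. \<Prod>m\<in>B. g k m ^ group_count n c k m)"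
  proof (intro prod.cong refl)
    fix k m
    have "(\<Prod>i\<in>{i\<in>{1..n k}. c (k, i) = m}. g k (c (k, i))) = (\<Prod>i\<in>{i\<in>{1..n k}. c (k, i) = m}. g k m)"
      by (intro prod.cong) auto
    then show "(\<Prod>i\<in>{i\<in>{1..n k}. c (k, i) = m}. g k (c (k, i))) = g k m ^ group_count n c k m"
      by (simp add: group_count_def)
  qed
  finally show ?thesis .
qed

lemma sum_group_count:
  assumes "finite B" "\<And>i. i \<in> {1..n k} \<Longrightarrow> c (k, i) \<in> B"
  shows "(\<Sum>m\<in>B. group_count n c k m) = n k"
proof -
  have "(\<Sum>m\<in>B. group_count n c k m) = (\<Sum>m\<in>B. \<Sum>i\<in>{i\<in>{1..n k}. c (k, i) = m}. 1)"
    by (simp add: group_count_def)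
  also have "\<dots> = (\<Sum>i\<in>{1..n k}. 1)"
    using assms by (intro sum.group) auto
  finally show ?thesis by simp
qed

lemma finite_obs_index[simp]: "finite (obs_index d n)"
  by (simp add: obs_index_def)

text \<open>The exponents \<open>r m\<close> sum to exactly the Gamma shape \<open>N\<close>, hence
  the power of the total mass in the density cancels the one in the normalised weights. A surviving
  power would couple the atoms; what remains is a product over \<open>m\<close>, because the
  exponential of a sum factors.\<close>

lemma erlang_density_times_weights:
  assumes B: "finite B" "B \<noteq> {}" and s: "\<And>m. m \<in> B \<Longrightarrow> 0 < s m"
    and u: "0 < u" and N: "1 \<le> N" "(\<Sum>m\<in>B. r m) = N"
  shows "erlang_density (N - 1) (\<Sum>m\<in>B. s m) u * (\<Prod>m\<in>B. (s m / (\<Sum>m\<in>B. s m)) ^ r m)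
    = u ^ (N - 1) / fact (N - 1) * (\<Prod>m\<in>B. exp (- u * s m) * s m ^ r m)"
proof -
  let ?T = "\<Sum>m\<in>B. s m"
  have T: "0 < ?T" using B s by (intro sum_pos) auto
  have "(\<Prod>m\<in>B. (s m / ?T) ^ r m) = (\<Prod>m\<in>B. s m ^ r m) / ?T ^ N"
    by (simp add: power_divide prod_dividef power_sum flip: N(2))
  moreover have "exp (- ?T * u) = (\<Prod>m\<in>B. exp (- u * s m))"
    using B by (simp add: exp_sum[symmetric] sum_distrib_left sum_negf mult.commute)
  moreover have "Suc (N - 1) = N" using N by simp
  ultimately show ?thesis
    using T u by (simp add: erlang_density_def prod.distrib)
qed

text \<open>The conditions on \<open>H\<close> range over all indices because
  \<open>product_sigma_finite\<close> does. Measurability of the diagonal makes coincidences between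
  observations events on a general space.\<close>

locale atom_model =
  fixes d :: nat and qM :: "nat pmf" and H :: "nat \<Rightarrow> real measure" and P0 :: "'a measure"
  assumes P0: "prob_space P0"
    and diag: "{z \<in> space (P0 \<Otimes>\<^sub>M P0). fst z = snd z} \<in> sets (P0 \<Otimes>\<^sub>M P0)"
    and diffuse: "\<And>x. x \<in> space P0 \<Longrightarrow> emeasure P0 {x} = 0"
    and prob_H: "\<And>k. prob_space (H k)"
    and sets_H[measurable_cong]: "\<And>k. sets (H k) = sets borel"
    and H_pos: "\<And>k. AE s in H k. 0 < s"
    and qM: "0 \<notin> set_pmf qM"
begin

lemma emeasure_random_mu:
  assumes "\<tau> \<in> {1..M} \<rightarrow> space P0" "A \<in> sets P0"
  shows "emeasure (random_mu P0 M S \<tau> k) A = (\<Sum>m=1..M. ennreal (S (k, m)) * indicator A (\<tau> m))"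
proof -
  let ?D = "density (count_space {1..M}) (\<lambda>m. ennreal (S (k, m)))"
  have \<tau>: "\<tau> \<in> measurable ?D P0" using assms(1) by (auto simp: measurable_def)
  have "emeasure (random_mu P0 M S \<tau> k) A = (\<integral>\<^sup>+x. indicator A x \<partial>distr ?D P0 \<tau>)"
    unfolding random_mu_def using assms(2) by simp
  also have "\<dots> = (\<integral>\<^sup>+m. indicator A (\<tau> m) \<partial>?D)"
    using assms(2) by (intro nn_integral_distr[OF \<tau>]) simp
  also have "\<dots> = (\<Sum>m=1..M. ennreal (S (k, m)) * indicator A (\<tau> m))"
    by (simp add: nn_integral_density nn_integral_count_space_finite)
  finally show ?thesis .
qed

definition mass :: "nat \<Rightarrow> (nat \<times> nat \<Rightarrow> real) \<Rightarrow> nat \<Rightarrow> ennreal" where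
  "mass M S k = (\<Sum>m=1..M. ennreal (S (k, m)))"

definition weight :: "nat \<Rightarrow> (nat \<times> nat \<Rightarrow> real) \<Rightarrow> nat \<Rightarrow> nat \<Rightarrow> ennreal" where
  "weight M S k m = inverse (mass M S k) * ennreal (S (k, m))"

text \<open>Equality fails when all jumps of the group are nonpositive: the mass is then 0 and every
  weight is \<open>\<top> * 0 = 0\<close>. The bound has to hold at every point of the space, also
  on such null sets.\<close>

lemma sum_weight_le_1: "(\<Sum>m=1..M. weight M S k m) \<le> 1"
proof -
  have "(\<Sum>m=1..M. weight M S k m) = inverse (mass M S k) * mass M S k"
    by (simp add: weight_def mass_def sum_distrib_left)
  also have "\<dots> \<le> 1"
  proof (cases "mass M S k = 0")
    case False
    moreover have "mass M S k \<noteq> \<top>" by (simp add: mass_def)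
    ultimately show ?thesis
      using ennreal_divide_self[of "mass M S k"] by (simp add: divide_ennreal_def mult.commute less_top)
  qed simp
  finally show ?thesis .
qed

lemma emeasure_random_mu_space:
  assumes "\<tau> \<in> {1..M} \<rightarrow> space P0"
  shows "emeasure (random_mu P0 M S \<tau> k) (space P0) = mass M S k"
  using assms by (auto simp: emeasure_random_mu mass_def indicator_def Pi_iff intro!: sum.cong)

lemma total_mass_eq:
  assumes "\<tau> \<in> {1..M} \<rightarrow> space P0"
  shows "total_mass P0 M S \<tau> k = enn2real (mass M S k)"
  using assms by (simp add: total_mass_def measure_def emeasure_random_mu_space)

lemma sets_random_P[simp]: "sets (random_P P0 M S \<tau> k) = sets P0"
  by (simp add: random_P_def random_mu_def)

lemma emeasure_random_P:
  assumes "\<tau> \<in> {1..M} \<rightarrow> space P0" "A \<in> sets P0"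
  shows "emeasure (random_P P0 M S \<tau> k) A = (\<Sum>m=1..M. weight M S k m * indicator A (\<tau> m))"
proof -
  have "emeasure (random_P P0 M S \<tau> k) A
      = inverse (mass M S k) * (\<Sum>m=1..M. ennreal (S (k, m)) * indicator A (\<tau> m))"
    unfolding random_P_def emeasure_scale_measure
    by (simp only: emeasure_random_mu_space[OF assms(1)] emeasure_random_mu[OF assms])
  also have "\<dots> = (\<Sum>m=1..M. weight M S k m * indicator A (\<tau> m))"
    by (simp only: weight_def sum_distrib_left mult.assoc)
  finally show ?thesis .
qed

lemma random_P_le_1:
  assumes "\<tau> \<in> {1..M} \<rightarrow> space P0"
  shows "emeasure (random_P P0 M S \<tau> k) (space P0) \<le> 1"
proof -
  have "emeasure (random_P P0 M S \<tau> k) (space P0) = (\<Sum>m=1..M. weight M S k m)"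
    unfolding emeasure_random_P[OF assms sets.top] using assms by (intro sum.cong) (auto simp: Pi_iff)
  then show ?thesis using sum_weight_le_1 by simp
qed

lemma product_sigma_finite_random_P:
  assumes "\<tau> \<in> {1..M} \<rightarrow> space P0"
  shows "product_sigma_finite (\<lambda>(k, i). random_P P0 M S \<tau> k)"
  unfolding product_sigma_finite_def
proof (clarify)
  fix k :: nat and i :: 'b
  have sp: "space (random_P P0 M S \<tau> k) = space P0" by (rule sets_eq_imp_space_eq) simp
  show "sigma_finite_measure (random_P P0 M S \<tau> k)"
  proof (rule finite_measure.axioms(1), rule finite_measureI)
    show "emeasure (random_P P0 M S \<tau> k) (space (random_P P0 M S \<tau> k)) \<noteq> \<infinity>"
      using random_P_le_1[OF assms, where S = S and k = k] unfolding sp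
      by (metis ennreal_one_neq_top infinity_ennreal_def top.extremum_uniqueI)
  qed
qed

definition gamma_weight :: "(nat \<Rightarrow> nat) \<Rightarrow> nat \<Rightarrow> (nat \<times> nat \<Rightarrow> real) \<Rightarrow> nat \<Rightarrow> real \<Rightarrow> ennreal" where
  "gamma_weight n M S k u = ennreal (erlang_density (n k - 1) (enn2real (mass M S k)) u) * indicator {0<..} u"

text \<open>The point \<open>u = 0\<close> is dropped because \<open>\<kappa>\<^sub>k(0, r)\<close> may be infinite.\<close>

lemma density_gamma_weight:
  "density lborel (\<lambda>u. ennreal (erlang_density (n k - 1) (enn2real (mass M S k)) u))
    = density lborel (gamma_weight n M S k)"
proof (rule density_cong)
  have "AE u in lborel. u \<noteq> (0::real)" by (rule AE_lborel_singleton)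
  then show "AE u in lborel. ennreal (erlang_density (n k - 1) (enn2real (mass M S k)) u)
      = gamma_weight n M S k u"
    by eventually_elim (auto simp: gamma_weight_def indicator_def erlang_density_def)
qed (auto simp: gamma_weight_def[abs_def])

lemma gamma_weight_le_1: "(\<integral>\<^sup>+u. gamma_weight n M S k u \<partial>lborel) \<le> 1"
proof -
  have "(\<integral>\<^sup>+u. gamma_weight n M S k u \<partial>lborel)
    \<le> (\<integral>\<^sup>+u. ennreal (erlang_density (n k - 1) (enn2real (mass M S k)) u) \<partial>lborel)"
    by (intro nn_integral_mono) (simp add: gamma_weight_def indicator_def)
  also have "\<dots> \<le> 1"
  proof (cases "enn2real (mass M S k) = 0")
    \<comment> \<open>The Erlang density carries a positive power of the rate, so rate 0 yields the
      zero measure instead of a probability measure.\<close>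
    case True
    have "erlang_density (n k - 1) 0 u = 0" for u by (simp add: erlang_density_def)
    then show ?thesis using True by simp
  next
    case False
    then have "0 < enn2real (mass M S k)" using enn2real_nonneg[of "mass M S k"] by linarith
    then have "prob_space (density lborel (\<lambda>u. ennreal (erlang_density (n k - 1) (enn2real (mass M S k)) u)))"
      by (rule prob_space_erlang_density)
    then show ?thesis
      using prob_space.emeasure_space_1 by (fastforce simp: emeasure_density)
  qed
  finally show ?thesis .
qed

lemma gamma_weight_measurable[measurable]: "gamma_weight n M S k \<in> borel_measurable borel"
  unfolding gamma_weight_def[abs_def] by measurable

lemma product_sigma_finite_gamma: "product_sigma_finite (\<lambda>k. density lborel (gamma_weight n M S k))"
  unfolding product_sigma_finite_def
proof
  fix k
  show "sigma_finite_measure (density lborel (gamma_weight n M S k))"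
    using gamma_weight_le_1[of n M S k]
    by (intro finite_measure.axioms(1) finite_measureI) (auto simp: emeasure_density top_unique)
qed

text \<open>The inner kernel of \<open>augmented_law\<close>, isolated so that its measurability in
  the jumps and atoms can be established and the nested binds integrated.\<close>

definition obs_kernel ::
  "(nat \<Rightarrow> nat) \<Rightarrow> nat \<Rightarrow> (nat \<times> nat \<Rightarrow> real) \<times> (nat \<Rightarrow> 'a) \<Rightarrow> ((nat \<times> nat \<Rightarrow> 'a) \<times> (nat \<Rightarrow> real)) measure" where
  "obs_kernel n M = (\<lambda>(S, \<tau>).
       (\<Pi>\<^sub>M (k, i) \<in> obs_index d n. random_P P0 M S \<tau> k) \<Otimes>\<^sub>M
       (\<Pi>\<^sub>M k \<in> {1..d}. density lborel (\<lambda>u. ennreal (erlang_density (n k - 1) (total_mass P0 M S \<tau> k) u))))"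

lemma obs_kernel_eq:
  assumes "\<tau> \<in> {1..M} \<rightarrow> space P0"
  shows "obs_kernel n M (S, \<tau>) = (\<Pi>\<^sub>M (k, i) \<in> obs_index d n. random_P P0 M S \<tau> k) \<Otimes>\<^sub>M
       (\<Pi>\<^sub>M k \<in> {1..d}. density lborel (gamma_weight n M S k))"
  using assms by (simp add: obs_kernel_def total_mass_eq density_gamma_weight)

lemma sets_obs_kernel: "sets (obs_kernel n M p) = sets (obs_space d P0 n)"
  unfolding obs_kernel_def obs_space_def
  by (cases p) (auto intro!: sets_pair_measure_cong sets_PiM_cong)

text \<open>The conditional probability, given the jumps, that the observations are allocated to the
  atoms as in \<open>c\<close>.\<close>

definition atom_weight :: "(nat \<Rightarrow> nat) \<Rightarrow> nat \<Rightarrow> (nat \<times> nat \<Rightarrow> real) \<Rightarrow> (nat \<times> nat \<Rightarrow> nat) \<Rightarrow> ennreal" where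
  "atom_weight n M S c = (\<Prod>(k, i)\<in>obs_index d n. weight M S k (c (k, i)))"

text \<open>The integral over \<open>u\<close> is kept outermost, with Lebesgue measure as
  reference, so that the later arguments can be carried out at a fixed \<open>u\<close>.\<close>

lemma nn_integral_obs_kernel:
  assumes \<tau>: "\<tau> \<in> {1..M} \<rightarrow> space P0"
    and F: "F \<in> borel_measurable (obs_space d P0 n)"
  shows "(\<integral>\<^sup>+z. F z \<partial>obs_kernel n M (S, \<tau>)) =
    (\<integral>\<^sup>+u. (\<Prod>k=1..d. gamma_weight n M S k (u k)) *
      (\<Sum>c\<in>PiE (obs_index d n) (\<lambda>_. {1..M}). atom_weight n M S c * F (\<lambda>e\<in>obs_index d n. \<tau> (c e), u))
     \<partial>PiM {1..d} (\<lambda>_. lborel))"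
proof -
  let ?I = "obs_index d n"
  let ?Q = "\<lambda>(k::nat, i::nat). random_P P0 M S \<tau> k"
  let ?G = "\<lambda>k. density lborel (gamma_weight n M S k)"
  interpret Q: product_sigma_finite ?Q by (rule product_sigma_finite_random_P) (use \<tau> in auto)
  interpret QI: finite_product_sigma_finite ?Q ?I by standard simp
  interpret G: product_sigma_finite ?G by (rule product_sigma_finite_gamma)
  interpret GI: finite_product_sigma_finite ?G "{1..d}" by standard simp
  interpret L: product_sigma_finite "\<lambda>_::nat. lborel :: real measure" by standard
  interpret QG: pair_sigma_finite "PiM ?I ?Q" "PiM {1..d} ?G" ..
  have sQ: "sets (PiM ?I ?Q) = sets (PiM ?I (\<lambda>_. P0))" by (intro sets_PiM_cong) auto
  have s: "sets (PiM ?I ?Q \<Otimes>\<^sub>M PiM {1..d} ?G) = sets (obs_space d P0 n)"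
    unfolding obs_space_def by (auto intro!: sets_pair_measure_cong sets_PiM_cong)
  have F': "F \<in> borel_measurable (PiM ?I ?Q \<Otimes>\<^sub>M PiM {1..d} ?G)"
    using F measurable_cong_sets[OF s refl] by blast
  have F''[measurable]: "F \<in> borel_measurable (PiM ?I (\<lambda>_. P0) \<Otimes>\<^sub>M PiM {1..d} (\<lambda>_. borel))"
    using F by (simp add: obs_space_def)
  have mem[measurable]: "(\<lambda>e\<in>?I. \<tau> (c e)) \<in> space (PiM ?I (\<lambda>_. P0))"
    if "c \<in> PiE ?I (\<lambda>_. {1..M})" for c using that \<tau> by (auto simp: space_PiM PiE_iff)
  have "(\<integral>\<^sup>+z. F z \<partial>obs_kernel n M (S, \<tau>)) = (\<integral>\<^sup>+u. \<integral>\<^sup>+x. F (x, u) \<partial>PiM ?I ?Q \<partial>PiM {1..d} ?G)"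
    using \<tau> by (simp add: obs_kernel_eq QG.nn_integral_snd[OF F', symmetric])
  also have "\<dots> = (\<integral>\<^sup>+u. (\<Sum>c\<in>PiE ?I (\<lambda>_. {1..M}). atom_weight n M S c * F (\<lambda>e\<in>?I. \<tau> (c e), u)) \<partial>PiM {1..d} ?G)"
  proof (intro nn_integral_cong)
    fix u assume "u \<in> space (PiM {1..d} ?G)"
    then have "u \<in> space (PiM {1..d} (\<lambda>_. borel))" by (simp add: space_PiM)
    then have m: "(\<lambda>x. F (x, u)) \<in> borel_measurable (PiM ?I (\<lambda>_. P0))"
      by measurable
    show "(\<integral>\<^sup>+x. F (x, u) \<partial>PiM ?I ?Q)
      = (\<Sum>c\<in>PiE ?I (\<lambda>_. {1..M}). atom_weight n M S c * F (\<lambda>e\<in>?I. \<tau> (c e), u))"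
      unfolding atom_weight_def
      by (subst nn_integral_PiM_finite_image[where B = "{1..M}" and P = P0 and \<tau> = \<tau>
            and w = "\<lambda>(k, i). weight M S k"])
        (use \<tau> m Q.product_sigma_finite_axioms in \<open>auto simp: emeasure_random_P split_beta\<close>)
  qed
  also have "PiM {1..d} ?G = density (PiM {1..d} (\<lambda>_. lborel)) (\<lambda>u. \<Prod>k=1..d. gamma_weight n M S k (u k))"
    by (intro L.PiM_density) (auto intro: product_sigma_finite_gamma)
  also have "(\<integral>\<^sup>+u. (\<Sum>c\<in>PiE ?I (\<lambda>_. {1..M}). atom_weight n M S c * F (\<lambda>e\<in>?I. \<tau> (c e), u)) \<partial>\<dots>)
     = (\<integral>\<^sup>+u. (\<Prod>k=1..d. gamma_weight n M S k (u k)) *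
        (\<Sum>c\<in>PiE ?I (\<lambda>_. {1..M}). atom_weight n M S c * F (\<lambda>e\<in>?I. \<tau> (c e), u)) \<partial>PiM {1..d} (\<lambda>_. lborel))"
  proof (intro nn_integral_density)
    have "(\<lambda>u. F (\<lambda>e\<in>?I. \<tau> (c e), u)) \<in> borel_measurable (PiM {1..d} (\<lambda>_. lborel))"
      if "c \<in> PiE ?I (\<lambda>_. {1..M})" for c
      using mem[OF that] by measurable
    then show "(\<lambda>u. \<Sum>c\<in>PiE ?I (\<lambda>_. {1..M}). atom_weight n M S c * F (\<lambda>e\<in>?I. \<tau> (c e), u))
      \<in> borel_measurable (PiM {1..d} (\<lambda>_. lborel))" by measurable
  qed measurable
  finally show ?thesis .
qed


section \<open>Measurability of the observation kernel in the jumps and atoms\<close>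

lemma prob_atoms: "prob_space (atoms_law d H P0 M)"
  unfolding atoms_law_def using P0 prob_H
  by (intro prob_space_pair prob_space_PiM) auto

lemma space_atoms_law:
  "p \<in> space (atoms_law d H P0 M) \<Longrightarrow> snd p \<in> {1..M} \<rightarrow> space P0"
  by (auto simp: atoms_law_def space_pair_measure space_PiM)

lemma measurable_jump[measurable]:
  assumes "k \<in> {1..d}" "m \<in> {1..M}"
  shows "(\<lambda>p. fst p (k, m)) \<in> borel_measurable (atoms_law d H P0 M)"
proof -
  have "(\<lambda>S. S (k, m)) \<in> measurable (PiM ({1..d} \<times> {1..M}) (\<lambda>(k, m). H k)) (H k)"
    using assms measurable_component_singleton[of "(k, m)" "{1..d} \<times> {1..M}" "\<lambda>(k, m). H k"] by simp
  then have "(\<lambda>S. S (k, m)) \<in> borel_measurable (PiM ({1..d} \<times> {1..M}) (\<lambda>(k, m). H k))"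
    by (simp cong: measurable_cong_sets add: sets_H)
  then show ?thesis unfolding atoms_law_def by (rule measurable_compose[OF measurable_fst])
qed

lemma measurable_labels[measurable]:
  assumes "c \<in> I \<rightarrow> {1..M}"
  shows "(\<lambda>p. \<lambda>e\<in>I. snd p (c e)) \<in> measurable (atoms_law d H P0 M) (PiM I (\<lambda>_. P0))"
proof -
  have "(\<lambda>\<tau>. \<lambda>e\<in>I. \<tau> (c e)) \<in> measurable (PiM {1..M} (\<lambda>_. P0)) (PiM I (\<lambda>_. P0))"
    using assms by (intro measurable_restrict measurable_component_singleton) auto
  then show ?thesis unfolding atoms_law_def by (rule measurable_compose[OF measurable_snd])
qed

text \<open>A product of parameter-dependent measures is not visibly measurable in its parameter.
  The explicit integrand is, being built from finite sums and products of coordinates; integrating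
  it over \<open>u\<close> then gives measurability of the kernel.\<close>

lemma obs_kernel_integrand_measurable:
  assumes F: "F \<in> borel_measurable (obs_space d P0 n)"
  shows "(\<lambda>(p, u). (\<Prod>k=1..d. gamma_weight n M (fst p) k (u k)) *
      (\<Sum>c\<in>PiE (obs_index d n) (\<lambda>_. {1..M}). atom_weight n M (fst p) c * F (\<lambda>e\<in>obs_index d n. snd p (c e), u)))
    \<in> borel_measurable (atoms_law d H P0 M \<Otimes>\<^sub>M PiM {1..d} (\<lambda>_. lborel))"
    (is "_ \<in> borel_measurable (?A \<Otimes>\<^sub>M ?L)")
proof -
  have F'[measurable]: "F \<in> borel_measurable (PiM (obs_index d n) (\<lambda>_. P0) \<Otimes>\<^sub>M PiM {1..d} (\<lambda>_. borel))"
    using F by (simp add: obs_space_def)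
  have mass[measurable]: "(\<lambda>p. mass M (fst p) k) \<in> borel_measurable ?A" if "k \<in> {1..d}" for k
    unfolding mass_def using that by measurable
  have [measurable]: "(\<lambda>z. snd z k) \<in> borel_measurable (?A \<Otimes>\<^sub>M ?L)" if "k \<in> {1..d}" for k
    using that measurable_compose[OF measurable_snd measurable_component_singleton[OF that, of "\<lambda>_. lborel"]]
    by simp
  have [measurable]: "(\<lambda>z. gamma_weight n M (fst (fst z)) k (snd z k)) \<in> borel_measurable (?A \<Otimes>\<^sub>M ?L)"
    if [measurable]: "k \<in> {1..d}" for k
    unfolding gamma_weight_def erlang_density_def by measurable
  have [measurable]: "(\<lambda>p. weight M (fst p) k m) \<in> borel_measurable ?A"
    if [measurable]: "k \<in> {1..d}" "m \<in> {1..M}" for k m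
    unfolding weight_def by measurable
  have [measurable]: "(\<lambda>p. atom_weight n M (fst p) c) \<in> borel_measurable ?A"
    if "c \<in> PiE (obs_index d n) (\<lambda>_. {1..M})" for c
    unfolding atom_weight_def
  proof (intro borel_measurable_prod_ennreal, clarify)
    fix k i assume "(k, i) \<in> obs_index d n"
    then have "k \<in> {1..d}" "c (k, i) \<in> {1..M}" using that by (auto simp: obs_index_def)
    then show "(\<lambda>p. weight M (fst p) k (c (k, i))) \<in> borel_measurable ?A" by measurable
  qed
  have [measurable]: "(\<lambda>z. F (\<lambda>e\<in>obs_index d n. snd (fst z) (c e), snd z)) \<in> borel_measurable (?A \<Otimes>\<^sub>M ?L)"
    if "c \<in> PiE (obs_index d n) (\<lambda>_. {1..M})" for c
  proof -
    have [measurable]: "(\<lambda>p. \<lambda>e\<in>obs_index d n. snd p (c e)) \<in> measurable ?A (PiM (obs_index d n) (\<lambda>_. P0))"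
      using that by (intro measurable_labels) auto
    have [measurable]: "snd \<in> measurable (?A \<Otimes>\<^sub>M ?L) (PiM {1..d} (\<lambda>_. borel))"
      using measurable_snd by (simp cong: sets_PiM_cong measurable_cong_sets)
    show ?thesis by measurable
  qed
  show ?thesis unfolding split_beta by measurable
qed

lemma nn_integral_obs_kernel_measurable:
  assumes F: "F \<in> borel_measurable (obs_space d P0 n)"
  shows "(\<lambda>p. \<integral>\<^sup>+z. F z \<partial>obs_kernel n M p) \<in> borel_measurable (atoms_law d H P0 M)"
proof -
  interpret L: product_sigma_finite "\<lambda>_::nat. lborel :: real measure" by standard
  interpret LI: finite_product_sigma_finite "\<lambda>_::nat. lborel :: real measure" "{1..d}" by standard simp
  have "(\<lambda>p. \<integral>\<^sup>+u. (\<Prod>k=1..d. gamma_weight n M (fst p) k (u k)) *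
      (\<Sum>c\<in>PiE (obs_index d n) (\<lambda>_. {1..M}). atom_weight n M (fst p) c * F (\<lambda>e\<in>obs_index d n. snd p (c e), u))
     \<partial>PiM {1..d} (\<lambda>_. lborel)) \<in> borel_measurable (atoms_law d H P0 M)"
    by (rule LI.borel_measurable_nn_integral[OF obs_kernel_integrand_measurable[OF F]])
  moreover have "(\<integral>\<^sup>+z. F z \<partial>obs_kernel n M p) = (\<integral>\<^sup>+u. (\<Prod>k=1..d. gamma_weight n M (fst p) k (u k)) *
      (\<Sum>c\<in>PiE (obs_index d n) (\<lambda>_. {1..M}). atom_weight n M (fst p) c * F (\<lambda>e\<in>obs_index d n. snd p (c e), u))
     \<partial>PiM {1..d} (\<lambda>_. lborel))" if "p \<in> space (atoms_law d H P0 M)" for p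
    using nn_integral_obs_kernel[OF space_atoms_law[OF that] F, of "fst p"] by simp
  ultimately show ?thesis by (simp cong: measurable_cong)
qed

text \<open>The target is \<open>subprob_algebra\<close> because the kernel may degenerate: for
  \<open>M = 0\<close>, or when all jumps of a group are nonpositive, the normalised measure and the
  Gamma law of that group are zero measures.\<close>

lemma measurable_obs_kernel:
  "obs_kernel n M \<in> measurable (atoms_law d H P0 M) (subprob_algebra (obs_space d P0 n))"
proof (rule measurable_subprob_algebra)
  let ?I = "obs_index d n"
  fix p assume p: "p \<in> space (atoms_law d H P0 M)"
  obtain S \<tau> where p_eq: "p = (S, \<tau>)" by (cases p)
  then have \<tau>: "\<tau> \<in> {1..M} \<rightarrow> space P0" using space_atoms_law[OF p] by simp
  show sets: "sets (obs_kernel n M p) = sets (obs_space d P0 n)" by (rule sets_obs_kernel)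
  let ?Q = "\<lambda>(k::nat, i::nat). random_P P0 M S \<tau> k"
  let ?G = "\<lambda>k. density lborel (gamma_weight n M S k)"
  interpret Q: product_sigma_finite ?Q by (rule product_sigma_finite_random_P) (use \<tau> in auto)
  interpret QI: finite_product_sigma_finite ?Q ?I by standard simp
  interpret G: product_sigma_finite ?G by (rule product_sigma_finite_gamma)
  interpret GI: finite_product_sigma_finite ?G "{1..d}" by standard simp
  have spQ: "space (random_P P0 M S \<tau> k) = space P0" for k by (rule sets_eq_imp_space_eq) simp
  have "emeasure (obs_kernel n M p) (space (obs_kernel n M p))
      = emeasure (PiM ?I ?Q) (space (PiM ?I ?Q)) * emeasure (PiM {1..d} ?G) (space (PiM {1..d} ?G))"
    unfolding p_eq obs_kernel_eq[OF \<tau>] space_pair_measure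
    by (intro GI.emeasure_pair_measure_Times) auto
  also have "\<dots> = (\<Prod>e\<in>?I. emeasure (?Q e) (space (?Q e))) * (\<Prod>k=1..d. emeasure (?G k) (space (?G k)))"
    unfolding space_PiM by (intro arg_cong2[where f = times] QI.measure_times GI.measure_times) auto
  also have "\<dots> \<le> (\<Prod>e\<in>?I. 1) * (\<Prod>k=1..d. 1)"
    using random_P_le_1[OF \<tau>] gamma_weight_le_1
    by (intro mult_mono prod_mono_ennreal) (auto simp: spQ emeasure_density split_beta)
  finally have "emeasure (obs_kernel n M p) (space (obs_kernel n M p)) \<le> 1" by simp
  moreover have "space (obs_kernel n M p) \<noteq> {}"
    unfolding sets_eq_imp_space_eq[OF sets]
    using prob_space.not_empty[OF P0]
    by (auto simp: obs_space_def space_pair_measure space_PiM PiE_eq_empty_iff)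
  ultimately show "subprob_space (obs_kernel n M p)" by (rule subprob_spaceI)
next
  fix A assume A: "A \<in> sets (obs_space d P0 n)"
  have "(\<lambda>p. \<integral>\<^sup>+z. indicator A z \<partial>obs_kernel n M p) \<in> borel_measurable (atoms_law d H P0 M)"
    using A by (intro nn_integral_obs_kernel_measurable) simp
  then show "(\<lambda>p. emeasure (obs_kernel n M p) A) \<in> borel_measurable (atoms_law d H P0 M)"
    using A by (simp add: sets_obs_kernel)
qed

lemma nn_integral_augmented_law_bind:
  assumes F: "F \<in> borel_measurable (obs_space d P0 n)"
  shows "(\<integral>\<^sup>+z. F z \<partial>augmented_law d qM H P0 n) =
    (\<Sum>M. ennreal (pmf qM M) * (\<integral>\<^sup>+p. \<integral>\<^sup>+z. F z \<partial>obs_kernel n M p \<partial>atoms_law d H P0 M))"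
proof -
  have in_sp: "atoms_law d H P0 M \<bind> obs_kernel n M \<in> space (subprob_algebra (obs_space d P0 n))" for M
    by (intro subprob_space.bind_in_space prob_space_imp_subprob_space prob_atoms measurable_obs_kernel)
  have K: "(\<lambda>M. atoms_law d H P0 M \<bind> obs_kernel n M) \<in> measurable (measure_pmf qM) (subprob_algebra (obs_space d P0 n))"
    using in_sp by simp
  have "(\<integral>\<^sup>+z. F z \<partial>augmented_law d qM H P0 n)
    = (\<integral>\<^sup>+M. \<integral>\<^sup>+z. F z \<partial>(atoms_law d H P0 M \<bind> obs_kernel n M) \<partial>measure_pmf qM)"
    using nn_integral_bind[OF F K] unfolding augmented_law_def obs_kernel_def by simp
  also have "\<dots> = (\<integral>\<^sup>+M. \<integral>\<^sup>+p. \<integral>\<^sup>+z. F z \<partial>obs_kernel n M p \<partial>atoms_law d H P0 M \<partial>measure_pmf qM)"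
    by (intro nn_integral_cong nn_integral_bind[OF F] measurable_obs_kernel)
  finally show ?thesis
    by (simp add: nn_integral_measure_pmf nn_integral_count_space_nat)
qed

end

section \<open>Integrating out the jumps\<close>

text \<open>A single term of the exponential series is at most its sum. This yields the dominating
  constant \<open>fact r / u ^ r\<close> for the integrand of \<open>kappa\<close>.\<close>

lemma power_times_exp_le_fact:
  fixes x :: real
  assumes "0 \<le> x" shows "x ^ r * exp (- x) \<le> fact r"
proof -
  have "(\<Sum>i\<in>{r}. x ^ i /\<^sub>R fact i) \<le> (\<Sum>i. x ^ i /\<^sub>R fact i)"
    using assms by (intro sum_le_suminf summable_exp_generic) auto
  then have "x ^ r / fact r \<le> exp x" by (simp add: exp_def divide_inverse mult.commute)
  then have "x ^ r \<le> fact r * exp x" by (simp add: divide_le_eq mult.commute)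
  then show ?thesis by (simp add: exp_minus divide_inverse[symmetric] divide_le_eq)
qed

context atom_model begin

lemma kappa_integrable:
  assumes "0 < u" shows "integrable (H k) (\<lambda>s. exp (- u * s) * s ^ r)"
proof -
  interpret prob_space "H k" by (rule prob_H)
  show ?thesis
  proof (rule integrable_const_bound)
    show "AE s in H k. norm (exp (- u * s) * s ^ r) \<le> fact r / u ^ r"
      using H_pos[of k]
    proof eventually_elim
      case (elim s)
      have "(u * s) ^ r * exp (- (u * s)) \<le> fact r" using assms elim by (intro power_times_exp_le_fact) simp
      then show ?case using assms elim by (simp add: field_simps abs_mult)
    qed
  qed measurable
qed

lemma kappa_nonneg: "0 \<le> kappa (H k) u r"
  unfolding kappa_def using H_pos[of k]
  by (intro Bochner_Integration.integral_nonneg_AE) (auto elim!: eventually_mono)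

text \<open>The integrand is positive almost everywhere, so its integral cannot vanish. The
  quotients in the predictive weight are therefore genuine divisions.\<close>

lemma kappa_pos:
  assumes "0 < u" shows "0 < kappa (H k) u r"
proof -
  interpret prob_space "H k" by (rule prob_H)
  have "kappa (H k) u r \<noteq> 0"
  proof
    assume "kappa (H k) u r = 0"
    then have "AE s in H k. exp (- u * s) * s ^ r = 0"
      unfolding kappa_def using H_pos[of k]
      by (subst (asm) integral_nonneg_eq_0_iff_AE[OF kappa_integrable[OF assms]]) (auto elim!: eventually_mono)
    with H_pos[of k] have "AE s in H k. False" by eventually_elim simp
    then show False by simp
  qed
  with kappa_nonneg[of k u r] show ?thesis by linarith
qed

lemma nn_integral_kappa:
  assumes "0 < u"
  shows "(\<integral>\<^sup>+s. ennreal (exp (- u * s) * s ^ r) \<partial>H k) = ennreal (kappa (H k) u r)"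
  unfolding kappa_def using H_pos[of k]
  by (intro nn_integral_eq_integral kappa_integrable assms) (auto elim!: eventually_mono)

lemma kappa_measurable[measurable]: "(\<lambda>u. kappa (H k) u r) \<in> borel_measurable borel"
proof -
  interpret prob_space "H k" by (rule prob_H)
  show ?thesis unfolding kappa_def by measurable
qed

text \<open>What remains of the Gamma densities once the powers of the total masses have cancelled
  and the exponentials have been handed to the jumps. It depends neither on the allocation nor on
  \<open>M\<close>.\<close>

definition gamma_const :: "(nat \<Rightarrow> nat) \<Rightarrow> (nat \<Rightarrow> real) \<Rightarrow> ennreal" where
  "gamma_const n u = (\<Prod>k=1..d. ennreal (u k ^ (n k - 1) / fact (n k - 1)) * indicator {0<..} (u k))"

lemma gamma_const_measurable[measurable]:
  "gamma_const n \<in> borel_measurable (PiM {1..d} (\<lambda>_. lborel))"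
  unfolding gamma_const_def[abs_def] by measurable

lemma gamma_const_eq_0: "gamma_const n u = 0" if "k \<in> {1..d}" "u k \<le> 0"
  unfolding gamma_const_def using that by (intro prod_zero bexI[of _ k]) auto

lemma gamma_weight_times_atom_weight:
  assumes M: "1 \<le> M" and S: "\<And>k m. k \<in> {1..d} \<Longrightarrow> m \<in> {1..M} \<Longrightarrow> 0 < S (k, m)"
    and n: "\<And>k. k \<in> {1..d} \<Longrightarrow> 1 \<le> n k"
    and c: "c \<in> PiE (obs_index d n) (\<lambda>_. {1..M})"
  shows "(\<Prod>k=1..d. gamma_weight n M S k (u k)) * atom_weight n M S c
    = gamma_const n u * (\<Prod>(k, m)\<in>{1..d} \<times> {1..M}. ennreal (exp (- u k * S (k, m)) * S (k, m) ^ group_count n c k m))"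
proof (cases "\<forall>k\<in>{1..d}. 0 < u k")
  \<comment> \<open>Both sides contain the indicator of \<open>u k > 0\<close>.\<close>
  case False
  then obtain k where "k \<in> {1..d}" "u k \<le> 0" by force
  moreover from this have "(\<Prod>k=1..d. gamma_weight n M S k (u k)) = 0"
    by (intro prod_zero bexI[of _ k]) (auto simp: gamma_weight_def)
  ultimately show ?thesis by (simp add: gamma_const_eq_0)
next
  case True
  have factor: "gamma_weight n M S k (u k) * (\<Prod>m=1..M. weight M S k m ^ group_count n c k m)
    = (ennreal (u k ^ (n k - 1) / fact (n k - 1)) * indicator {0<..} (u k)) *
      (\<Prod>m=1..M. ennreal (exp (- u k * S (k, m)) * S (k, m) ^ group_count n c k m))"
    if k: "k \<in> {1..d}" for k
  proof -
    let ?T = "\<Sum>m=1..M. S (k, m)" and ?r = "group_count n c k"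
    have u: "0 < u k" using True k by simp
    have T: "0 < ?T" using M S[OF k] by (intro sum_pos) auto
    have mass: "mass M S k = ennreal ?T"
      unfolding mass_def using S[OF k] by (intro sum_ennreal) (auto intro: less_imp_le)
    have w: "weight M S k m = ennreal (S (k, m) / ?T)" if "m \<in> {1..M}" for m
      unfolding weight_def mass using T S[OF k that]
      by (simp add: inverse_ennreal divide_inverse mult.commute flip: ennreal_mult)
    have Spos: "0 \<le> S (k, m) / ?T" if "m \<in> {1..M}" for m using T S[OF k that] by simp
    \<comment> \<open>Each observation of the group sits at exactly one atom, so the exponents add
      up to the Gamma shape.\<close>
    have r: "(\<Sum>m=1..M. ?r m) = n k"
      using c k by (intro sum_group_count) (auto simp: PiE_iff obs_index_def)
    have "gamma_weight n M S k (u k) * (\<Prod>m=1..M. weight M S k m ^ ?r m)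
      = ennreal (erlang_density (n k - 1) ?T (u k)) * (\<Prod>m=1..M. ennreal ((S (k, m) / ?T) ^ ?r m))"
    proof (intro arg_cong2[where f = times] prod.cong refl)
      show "gamma_weight n M S k (u k) = ennreal (erlang_density (n k - 1) ?T (u k))"
        using u T by (simp add: gamma_weight_def mass)
      show "weight M S k m ^ ?r m = ennreal ((S (k, m) / ?T) ^ ?r m)" if "m \<in> {1..M}" for m
        using Spos[OF that] by (simp only: w[OF that] ennreal_power)
    qed
    also have "\<dots> = ennreal (erlang_density (n k - 1) ?T (u k) * (\<Prod>m=1..M. (S (k, m) / ?T) ^ ?r m))"
      using Spos T by (subst prod_ennreal) (auto intro!: ennreal_mult[symmetric] prod_nonneg)
    also have "\<dots> = ennreal (u k ^ (n k - 1) / fact (n k - 1) * (\<Prod>m=1..M. exp (- u k * S (k, m)) * S (k, m) ^ ?r m))"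
      using M S[OF k] u n[OF k] r by (subst erlang_density_times_weights) auto
    also have "\<dots> = ennreal (u k ^ (n k - 1) / fact (n k - 1)) *
      ennreal (\<Prod>m=1..M. exp (- u k * S (k, m)) * S (k, m) ^ ?r m)"
      using u S[OF k] by (intro ennreal_mult prod_nonneg) (auto intro: less_imp_le)
    also have "ennreal (\<Prod>m=1..M. exp (- u k * S (k, m)) * S (k, m) ^ ?r m)
      = (\<Prod>m=1..M. ennreal (exp (- u k * S (k, m)) * S (k, m) ^ ?r m))"
      using S[OF k] by (intro prod_ennreal[symmetric]) (auto intro: less_imp_le)
    also have "ennreal (u k ^ (n k - 1) / fact (n k - 1))
      = ennreal (u k ^ (n k - 1) / fact (n k - 1)) * indicator {0<..} (u k)"
      using u by simp
    finally show ?thesis .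
  qed
  have "atom_weight n M S c = (\<Prod>k=1..d. \<Prod>m=1..M. weight M S k m ^ group_count n c k m)"
    unfolding atom_weight_def using c by (intro prod_obs_index) auto
  then have "(\<Prod>k=1..d. gamma_weight n M S k (u k)) * atom_weight n M S c
    = (\<Prod>k=1..d. gamma_weight n M S k (u k) * (\<Prod>m=1..M. weight M S k m ^ group_count n c k m))"
    by (simp add: prod.distrib)
  also have "\<dots> = (\<Prod>k=1..d. (ennreal (u k ^ (n k - 1) / fact (n k - 1)) * indicator {0<..} (u k)) *
      (\<Prod>m=1..M. ennreal (exp (- u k * S (k, m)) * S (k, m) ^ group_count n c k m)))"
    by (intro prod.cong refl factor)
  also have "\<dots> = gamma_const n u * (\<Prod>k=1..d. \<Prod>m=1..M. ennreal (exp (- u k * S (k, m)) * S (k, m) ^ group_count n c k m))"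
    by (simp add: prod.distrib gamma_const_def)
  finally show ?thesis by (simp add: prod.cartesian_product)
qed

definition label_weight :: "(nat \<Rightarrow> nat) \<Rightarrow> nat \<Rightarrow> (nat \<Rightarrow> real) \<Rightarrow> (nat \<times> nat \<Rightarrow> nat) \<Rightarrow> real" where
  "label_weight n M u c = (\<Prod>k=1..d. \<Prod>m=1..M. kappa (H k) (u k) (group_count n c k m))"

lemma nn_integral_jumps:
  assumes "\<And>k. k \<in> {1..d} \<Longrightarrow> 0 < u k"
  shows "(\<integral>\<^sup>+S. (\<Prod>(k, m)\<in>{1..d} \<times> {1..M}. ennreal (exp (- u k * S (k, m)) * S (k, m) ^ group_count n c k m))
      \<partial>PiM ({1..d} \<times> {1..M}) (\<lambda>(k, m). H k)) = ennreal (label_weight n M u c)"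
proof -
  interpret product_sigma_finite "\<lambda>(k, m::nat). H k"
    unfolding product_sigma_finite_def using prob_H by (auto intro: prob_space_imp_sigma_finite)
  have "(\<integral>\<^sup>+S. (\<Prod>(k, m)\<in>{1..d} \<times> {1..M}. ennreal (exp (- u k * S (k, m)) * S (k, m) ^ group_count n c k m))
      \<partial>PiM ({1..d} \<times> {1..M}) (\<lambda>(k, m). H k))
    = (\<integral>\<^sup>+S. (\<Prod>e\<in>{1..d} \<times> {1..M}. (\<lambda>(k, m) s. ennreal (exp (- u k * s) * s ^ group_count n c k m)) e (S e))
      \<partial>PiM ({1..d} \<times> {1..M}) (\<lambda>(k, m). H k))"
    by (simp add: split_beta)
  also have "\<dots> = (\<Prod>e\<in>{1..d} \<times> {1..M}. integral\<^sup>N ((\<lambda>(k, m). H k) e)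
      ((\<lambda>(k, m) s. ennreal (exp (- u k * s) * s ^ group_count n c k m)) e))"
    by (rule product_nn_integral_prod) (auto simp: split_beta)
  also have "\<dots> = (\<Prod>(k, m)\<in>{1..d} \<times> {1..M}. ennreal (kappa (H k) (u k) (group_count n c k m)))"
  proof (intro prod.cong refl, clarify)
    fix k m assume "k \<in> {1..d}"
    then show "integral\<^sup>N (H k) (\<lambda>s. ennreal (exp (- u k * s) * s ^ group_count n c k m))
      = ennreal (kappa (H k) (u k) (group_count n c k m))"
      by (intro nn_integral_kappa assms)
  qed
  also have "\<dots> = ennreal (label_weight n M u c)"
    unfolding label_weight_def prod.cartesian_product split_beta by (intro prod_ennreal kappa_nonneg)
  finally show ?thesis .
qed

lemma AE_jumps_pos:
  fixes M :: nat
  shows "AE S in PiM ({1..d} \<times> {1..M}) (\<lambda>(k, m). H k). \<forall>k\<in>{1..d}. \<forall>m\<in>{1..M}. 0 < S (k, m)"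
proof -
  have "AE S in PiM ({1..d} \<times> {1..M}) (\<lambda>(k, m). H k). 0 < S (k, m)"
    if "k \<in> {1..d}" "m \<in> {1..M}" for k m
    using AE_PiM_component[of "{1..d} \<times> {1..M}" "\<lambda>(k, m). H k" "(k, m)" "\<lambda>s. 0 < s"] that prob_H H_pos[of k]
    by auto
  then show ?thesis by (intro AE_finite_allI) auto
qed

text \<open>At fixed \<open>u\<close>, jumps and locations are independent. Each allocation
  therefore contributes a jump integral, which is its \<open>label_weight\<close>, times an integral
  over i.i.d. locations.\<close>

lemma nn_integral_kernel_atoms:
  assumes F: "F \<in> borel_measurable (obs_space d P0 n)" and M: "1 \<le> M"
    and n: "\<And>k. k \<in> {1..d} \<Longrightarrow> 1 \<le> n k"
  shows "(\<integral>\<^sup>+p. \<integral>\<^sup>+z. F z \<partial>obs_kernel n M p \<partial>atoms_law d H P0 M) =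
    (\<integral>\<^sup>+u. gamma_const n u * (\<Sum>c\<in>PiE (obs_index d n) (\<lambda>_. {1..M}). ennreal (label_weight n M u c) *
        (\<integral>\<^sup>+\<tau>. F (\<lambda>e\<in>obs_index d n. \<tau> (c e), u) \<partial>PiM {1..M} (\<lambda>_. P0))) \<partial>PiM {1..d} (\<lambda>_. lborel))"
proof -
  let ?I = "obs_index d n" and ?C = "PiE (obs_index d n) (\<lambda>_. {1..M})"
  let ?A = "atoms_law d H P0 M" and ?L = "PiM {1..d} (\<lambda>_. lborel :: real measure)"
  let ?J = "PiM ({1..d} \<times> {1..M}) (\<lambda>(k, m). H k)" and ?T = "PiM {1..M} (\<lambda>_. P0)"
  let ?Z = "\<lambda>p u. (\<Prod>k=1..d. gamma_weight n M (fst p) k (u k)) *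
      (\<Sum>c\<in>?C. atom_weight n M (fst p) c * F (\<lambda>e\<in>?I. snd p (c e), u))"
  let ?g = "\<lambda>S u c. (\<Prod>(k, m)\<in>{1..d} \<times> {1..M}. ennreal (exp (- u k * S (k, m)) * S (k, m) ^ group_count n c k m))"
  interpret L: product_sigma_finite "\<lambda>_::nat. lborel :: real measure" by standard
  interpret LI: finite_product_sigma_finite "\<lambda>_::nat. lborel :: real measure" "{1..d}" by standard simp
  interpret A: prob_space ?A by (rule prob_atoms)
  interpret J: prob_space ?J using prob_H by (intro prob_space_PiM) auto
  interpret T: prob_space ?T using P0 by (intro prob_space_PiM) auto
  interpret AL: pair_sigma_finite ?A ?L ..
  have F'[measurable]: "F \<in> borel_measurable (PiM ?I (\<lambda>_. P0) \<Otimes>\<^sub>M PiM {1..d} (\<lambda>_. borel))"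
    using F by (simp add: obs_space_def)
  have "(\<integral>\<^sup>+p. \<integral>\<^sup>+z. F z \<partial>obs_kernel n M p \<partial>?A) = (\<integral>\<^sup>+p. \<integral>\<^sup>+u. ?Z p u \<partial>?L \<partial>?A)"
  proof (intro nn_integral_cong)
    fix p assume "p \<in> space ?A"
    from nn_integral_obs_kernel[OF space_atoms_law[OF this] F, of "fst p"]
    show "(\<integral>\<^sup>+z. F z \<partial>obs_kernel n M p) = (\<integral>\<^sup>+u. ?Z p u \<partial>?L)" by simp
  qed
  also have "\<dots> = (\<integral>\<^sup>+u. \<integral>\<^sup>+p. ?Z p u \<partial>?A \<partial>?L)"
    using obs_kernel_integrand_measurable[OF F] by (intro AL.Fubini'[symmetric]) simp
  also have "\<dots> = (\<integral>\<^sup>+u. gamma_const n u * (\<Sum>c\<in>?C. ennreal (label_weight n M u c) *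
        (\<integral>\<^sup>+\<tau>. F (\<lambda>e\<in>?I. \<tau> (c e), u) \<partial>?T)) \<partial>?L)"
  proof (intro nn_integral_cong)
    fix u assume "u \<in> space ?L"
    then have u[measurable]: "u \<in> space (PiM {1..d} (\<lambda>_. borel))" by (simp add: space_PiM)
    have Fc[measurable]: "(\<lambda>\<tau>. F (\<lambda>e\<in>?I. \<tau> (c e), u)) \<in> borel_measurable ?T" if "c \<in> ?C" for c
    proof -
      have [measurable]: "(\<lambda>\<tau>. \<lambda>e\<in>?I. \<tau> (c e)) \<in> measurable ?T (PiM ?I (\<lambda>_. P0))"
        using that by (intro measurable_restrict measurable_component_singleton) auto
      show ?thesis by measurable
    qed
    have gm[measurable]: "(\<lambda>S. ?g S u c) \<in> borel_measurable ?J" for c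
    proof (intro borel_measurable_prod_ennreal, clarify)
      fix k m assume "k \<in> {1..d}" "m \<in> {1..M}"
      then have "(\<lambda>S. S (k, m)) \<in> measurable ?J (H k)"
        using measurable_component_singleton[of "(k, m)" "{1..d} \<times> {1..M}" "\<lambda>(k, m). H k"] by simp
      then have [measurable]: "(\<lambda>S. S (k, m)) \<in> borel_measurable ?J"
        by (simp cong: measurable_cong_sets add: sets_H)
      show "(\<lambda>S. ennreal (exp (- u k * S (k, m)) * S (k, m) ^ group_count n c k m)) \<in> borel_measurable ?J"
        by measurable
    qed
    \<comment> \<open>The cancellation of total masses requires positive jumps, which holds only
      almost surely; the property is pulled back along the first projection, whose law is the
      product of the jump laws.\<close>
    have "AE p in ?A. \<forall>k\<in>{1..d}. \<forall>m\<in>{1..M}. 0 < fst p (k, m)"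
    proof -
      have fst: "distr ?A ?J fst = ?J" unfolding atoms_law_def by (rule T.distr_pair_fst)
      show ?thesis
      proof (rule AE_distrD[of fst ?A ?J "\<lambda>S. \<forall>k\<in>{1..d}. \<forall>m\<in>{1..M}. 0 < S (k, m)"])
        show "fst \<in> measurable ?A ?J" by (simp add: atoms_law_def)
        show "AE S in distr ?A ?J fst. \<forall>k\<in>{1..d}. \<forall>m\<in>{1..M}. 0 < S (k, m)"
          unfolding fst by (rule AE_jumps_pos)
      qed
    qed
    then have "(\<integral>\<^sup>+p. ?Z p u \<partial>?A) = (\<integral>\<^sup>+p. gamma_const n u * (\<Sum>c\<in>?C. ?g (fst p) u c * F (\<lambda>e\<in>?I. snd p (c e), u)) \<partial>?A)"
    proof (intro nn_integral_cong_AE, eventually_elim)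
      case (elim p)
      have "(\<Prod>k=1..d. gamma_weight n M (fst p) k (u k)) * atom_weight n M (fst p) c
        = gamma_const n u * ?g (fst p) u c" if "c \<in> ?C" for c
        using elim by (intro gamma_weight_times_atom_weight[OF M _ n that]) auto
      then show ?case by (simp add: sum_distrib_left mult.assoc[symmetric])
    qed
    also have "\<dots> = gamma_const n u * (\<Sum>c\<in>?C. \<integral>\<^sup>+p. ?g (fst p) u c * F (\<lambda>e\<in>?I. snd p (c e), u) \<partial>?A)"
      unfolding atoms_law_def by (subst nn_integral_cmult, measurable, subst nn_integral_sum) measurable
    also have "\<dots> = gamma_const n u * (\<Sum>c\<in>?C. ennreal (label_weight n M u c) *
        (\<integral>\<^sup>+\<tau>. F (\<lambda>e\<in>?I. \<tau> (c e), u) \<partial>?T))"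
    proof (cases "\<forall>k\<in>{1..d}. 0 < u k")
      \<comment> \<open>Here \<open>gamma_const\<close> is 0, so no value of the jump integrals is
        needed; they may be infinite at \<open>u k = 0\<close>.\<close>
      case False
      then show ?thesis using gamma_const_eq_0[of _ u n] by force
    next
      case True
      have "(\<integral>\<^sup>+p. ?g (fst p) u c * F (\<lambda>e\<in>?I. snd p (c e), u) \<partial>?A)
         = ennreal (label_weight n M u c) * (\<integral>\<^sup>+\<tau>. F (\<lambda>e\<in>?I. \<tau> (c e), u) \<partial>?T)" if c[measurable]: "c \<in> ?C" for c
      proof -
        have "(\<integral>\<^sup>+p. ?g (fst p) u c * F (\<lambda>e\<in>?I. snd p (c e), u) \<partial>?A)
          = (\<integral>\<^sup>+S. \<integral>\<^sup>+\<tau>. ?g S u c * F (\<lambda>e\<in>?I. \<tau> (c e), u) \<partial>?T \<partial>?J)"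
          unfolding atoms_law_def
          using T.nn_integral_fst[OF borel_measurable_times_ennreal[OF
              measurable_compose[OF measurable_fst gm[of c]] measurable_compose[OF measurable_snd Fc[OF c]]]]
          by simp
        also have "\<dots> = (\<integral>\<^sup>+S. ?g S u c \<partial>?J) * (\<integral>\<^sup>+\<tau>. F (\<lambda>e\<in>?I. \<tau> (c e), u) \<partial>?T)"
          by (simp only: nn_integral_cmult[OF Fc[OF c]] nn_integral_multc[OF gm])
        also have "(\<integral>\<^sup>+S. ?g S u c \<partial>?J) = ennreal (label_weight n M u c)"
          using True by (intro nn_integral_jumps) auto
        finally show ?thesis .
      qed
      then show ?thesis by simp
    qed
    finally show "(\<integral>\<^sup>+p. ?Z p u \<partial>?A) = gamma_const n u * (\<Sum>c\<in>?C. ennreal (label_weight n M u c) *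
        (\<integral>\<^sup>+\<tau>. F (\<lambda>e\<in>?I. \<tau> (c e), u) \<partial>?T))" .
  qed
  finally show ?thesis .
qed


lemma measurable_label_integral:
  assumes F: "F \<in> borel_measurable (obs_space d P0 n)"
    and c: "c \<in> obs_index d n \<rightarrow> J"
  shows "(\<lambda>u. \<integral>\<^sup>+\<tau>. F (\<lambda>e\<in>obs_index d n. \<tau> (c e), u) \<partial>PiM J (\<lambda>_. P0))
    \<in> borel_measurable (PiM {1..d} (\<lambda>_. lborel))"
proof -
  interpret T: prob_space "PiM J (\<lambda>_. P0)" using P0 by (intro prob_space_PiM) auto
  have [measurable]: "F \<in> borel_measurable (PiM (obs_index d n) (\<lambda>_. P0) \<Otimes>\<^sub>M PiM {1..d} (\<lambda>_. borel))"
    using F by (simp add: obs_space_def)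
  have [measurable]: "(\<lambda>\<tau>. \<lambda>e\<in>obs_index d n. \<tau> (c e)) \<in> measurable (PiM J (\<lambda>_. P0)) (PiM (obs_index d n) (\<lambda>_. P0))"
    using c by (intro measurable_restrict measurable_component_singleton) auto
  show ?thesis by measurable
qed

lemma nn_integral_augmented_law:
  assumes F: "F \<in> borel_measurable (obs_space d P0 n)"
    and n: "\<And>k. k \<in> {1..d} \<Longrightarrow> 1 \<le> n k"
  shows "(\<integral>\<^sup>+z. F z \<partial>augmented_law d qM H P0 n) =
    (\<integral>\<^sup>+u. gamma_const n u * (\<Sum>M. ennreal (pmf qM M) *
        (\<Sum>c\<in>PiE (obs_index d n) (\<lambda>_. {1..M}). ennreal (label_weight n M u c) *
          (\<integral>\<^sup>+\<tau>. F (\<lambda>e\<in>obs_index d n. \<tau> (c e), u) \<partial>PiM {1..M} (\<lambda>_. P0)))) \<partial>PiM {1..d} (\<lambda>_. lborel))"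
    (is "_ = (\<integral>\<^sup>+u. gamma_const n u * (\<Sum>M. ennreal (pmf qM M) * ?X M u) \<partial>?L)")
proof -
  have X[measurable]: "?X M \<in> borel_measurable ?L" for M
  proof -
    have [measurable]: "(\<lambda>u. \<integral>\<^sup>+\<tau>. F (\<lambda>e\<in>obs_index d n. \<tau> (c e), u) \<partial>PiM {1..M} (\<lambda>_. P0))
      \<in> borel_measurable ?L" if "c \<in> PiE (obs_index d n) (\<lambda>_. {1..M})" for c
      using that by (intro measurable_label_integral[OF F]) auto
    show ?thesis unfolding label_weight_def by measurable
  qed
  have "(\<integral>\<^sup>+z. F z \<partial>augmented_law d qM H P0 n) =
    (\<Sum>M. ennreal (pmf qM M) * (\<integral>\<^sup>+p. \<integral>\<^sup>+z. F z \<partial>obs_kernel n M p \<partial>atoms_law d H P0 M))"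
    by (rule nn_integral_augmented_law_bind[OF F])
  also have "\<dots> = (\<Sum>M. ennreal (pmf qM M) * (\<integral>\<^sup>+u. gamma_const n u * ?X M u \<partial>?L))"
  proof (intro suminf_cong)
    fix M
    show "ennreal (pmf qM M) * (\<integral>\<^sup>+p. \<integral>\<^sup>+z. F z \<partial>obs_kernel n M p \<partial>atoms_law d H P0 M)
      = ennreal (pmf qM M) * (\<integral>\<^sup>+u. gamma_const n u * ?X M u \<partial>?L)"
    \<comment> \<open>With no atoms the total mass is 0 and nothing cancels; this case has
      probability 0.\<close>
    proof (cases "M = 0")
      case True
      then show ?thesis using qM by (simp add: set_pmf_eq)
    next
      case False
      then show ?thesis using nn_integral_kernel_atoms[OF F _ n, of M] by simp
    qed
  qed
  also have "\<dots> = (\<Sum>M. \<integral>\<^sup>+u. gamma_const n u * (ennreal (pmf qM M) * ?X M u) \<partial>?L)"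
    by (simp add: nn_integral_cmult[symmetric] mult.left_commute)
  also have "\<dots> = (\<integral>\<^sup>+u. gamma_const n u * (\<Sum>M. ennreal (pmf qM M) * ?X M u) \<partial>?L)"
    by (subst nn_integral_suminf[symmetric]) auto
  finally show ?thesis .
qed

end

section \<open>Summing over the number of atoms\<close>

context atom_model begin

text \<open>The factor contributed by one empty atom, and the variable of the power series
  \<open>Psi\<close>.\<close>

definition rho :: "(nat \<Rightarrow> real) \<Rightarrow> real" where
  "rho u = (\<Prod>k=1..d. kappa (H k) (u k) 0)"

lemma laplace_eq_kappa: "laplace (H k) u = kappa (H k) u 0"
  by (simp add: laplace_def kappa_def)

lemma kappa_0_less_1:
  assumes "0 < u" shows "kappa (H k) u 0 < 1"
proof -
  interpret prob_space "H k" by (rule prob_H)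
  have "kappa (H k) u 0 < (\<integral>s. 1 \<partial>H k)"
    unfolding kappa_def
  proof (rule integral_less_AE_space)
    show "AE s in H k. exp (- u * s) * s ^ 0 < 1"
      using H_pos[of k] by eventually_elim (use assms in simp)
    show "integrable (H k) (\<lambda>s. exp (- u * s) * s ^ 0)" using assms by (rule kappa_integrable)
  qed (simp_all add: emeasure_space_1)
  then show ?thesis by (simp add: prob_space)
qed

lemma rho_pos:
  assumes "\<forall>k\<in>{1..d}. 0 < u k" shows "0 < rho u"
  unfolding rho_def using assms by (intro prod_pos kappa_pos) auto

text \<open>One factor strictly below 1 suffices, and \<open>1 \<le> d\<close> supplies it. The
  strict bound gives convergence of \<open>Psi\<close> by comparison with derivatives of the
  geometric series.\<close>

lemma rho_less_1:
  assumes "\<forall>k\<in>{1..d}. 0 < u k" "1 \<le> d" shows "rho u < 1"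
proof -
  have "rho u = kappa (H 1) (u 1) 0 * (\<Prod>k\<in>{1..d}-{1}. kappa (H k) (u k) 0)"
    unfolding rho_def using assms by (intro prod.remove) auto
  also have "\<dots> \<le> kappa (H 1) (u 1) 0 * 1"
    using assms kappa_0_less_1 by (intro mult_left_mono prod_le_1 kappa_nonneg) (auto intro: kappa_nonneg less_imp_le)
  also have "\<dots> < 1" using assms kappa_0_less_1 by simp
  finally show ?thesis .
qed

text \<open>The falling factorial of \<open>M\<close>, which counts injective labellings of
  \<open>K\<close> blocks by \<open>M\<close> atoms. The explicit 0 for \<open>K > M\<close> lets
  the series over \<open>M\<close> start at 0.\<close>

definition injections :: "nat \<Rightarrow> nat \<Rightarrow> real" where
  "injections K M = (if K \<le> M then fact M / fact (M - K) else 0)"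

lemma injections_nonneg: "0 \<le> injections K M"
  by (simp add: injections_def)

text \<open>Probabilities are at most 1, so the series is dominated by
  \<open>summable_fact_shift\<close> at \<open>rho u\<close>. Summability has to be shown because
  \<open>Psi\<close> is a real infinite sum.\<close>

lemma Psi_summand_sums:
  assumes "\<forall>k\<in>{1..d}. 0 < u k" "1 \<le> d"
  shows "(\<lambda>m. pmf qM (m + K) * (fact (m + K) / fact m) * rho u ^ m) sums Psi d qM H K u"
proof -
  have r: "0 \<le> rho u" "\<bar>rho u\<bar> < 1" using rho_pos[OF assms(1)] rho_less_1[OF assms] by auto
  have "summable (\<lambda>m. pmf qM (m + K) * (fact (m + K) / fact m) * rho u ^ m)"
  proof (rule summable_comparison_test'[OF summable_fact_shift[OF r(2), of K]])
    fix m
    have "pmf qM (m + K) * (fact (m + K) / fact m * rho u ^ m) \<le> 1 * (fact (m + K) / fact m * rho u ^ m)"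
      using r by (intro mult_right_mono pmf_le_1) simp
    then show "norm (pmf qM (m + K) * (fact (m + K) / fact m) * rho u ^ m) \<le> fact (m + K) / fact m * rho u ^ m"
      using r by (simp add: abs_mult mult.assoc)
  qed
  then show ?thesis
    by (simp add: Psi_def laplace_eq_kappa rho_def prod_power_distrib summable_sums)
qed

lemma Psi_nonneg:
  assumes "\<forall>k\<in>{1..d}. 0 < u k" "1 \<le> d" shows "0 \<le> Psi d qM H K u"
  using rho_pos[OF assms(1)] by (intro sums_le[OF _ sums_zero Psi_summand_sums[OF assms]]) simp

text \<open>Needed because the quotient \<open>\<Psi>(K + 1, u) / \<Psi>(K, u)\<close> takes the junk value \<open>0\<close> when
  \<open>\<Psi>(K, u) = 0\<close>.\<close>

lemma Psi_Suc_eq_0: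
  assumes u: "\<forall>k\<in>{1..d}. 0 < u k" "1 \<le> d" and "Psi d qM H K u = 0"
  shows "Psi d qM H (K + 1) u = 0"
proof -
  let ?f = "\<lambda>m. pmf qM (m + K) * (fact (m + K) / fact m) * rho u ^ m"
  have "(\<forall>m. ?f m = 0)"
    using Psi_summand_sums[OF u, of K] rho_pos[OF u(1)] assms(3)
    by (subst suminf_eq_zero_iff[symmetric]) (auto simp: sums_iff)
  then have "pmf qM (m + K) = 0" for m using rho_pos[OF u(1)] by (metis fact_nonzero divide_eq_0_iff mult_eq_0_iff power_not_zero less_irrefl)
  then have "pmf qM (m + (K + 1)) = 0" for m by (metis add.assoc add.commute)
  then show ?thesis by (simp add: Psi_def)
qed

lemma Psi_sums:
  assumes "\<forall>k\<in>{1..d}. 0 < u k" "1 \<le> d"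
  shows "(\<lambda>M. pmf qM M * injections K M * rho u ^ (M - K)) sums Psi d qM H K u"
proof (rule sums_zero_iff_shift[where n = K, THEN iffD1])
  show "(\<lambda>M. pmf qM (M + K) * injections K (M + K) * rho u ^ (M + K - K)) sums Psi d qM H K u"
    using Psi_summand_sums[OF assms, of K] by (simp add: injections_def)
qed (simp add: injections_def)

text \<open>The falling factorial of length \<open>K\<close> times \<open>M - K\<close> is the one
  of length \<open>K + 1\<close>. The exponent of \<open>rho u\<close> still counts the new atom as
  empty, hence the extra factor \<open>rho u\<close>. Terms with \<open>M \<le> K\<close> vanish
  through the truncated difference, so the shift is by \<open>K + 1\<close>.\<close>

lemma Psi_Suc_sums:
  assumes "\<forall>k\<in>{1..d}. 0 < u k" "1 \<le> d"
  shows "(\<lambda>M. pmf qM M * injections K M * rho u ^ (M - K) * real (M - K)) sums (rho u * Psi d qM H (K + 1) u)"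
proof (rule sums_zero_iff_shift[where n = "K + 1", THEN iffD1])
  have "pmf qM (m + (K + 1)) * injections K (m + (K + 1)) * rho u ^ (m + (K + 1) - K) * real (m + (K + 1) - K)
    = rho u * (pmf qM (m + (K + 1)) * (fact (m + (K + 1)) / fact m) * rho u ^ m)" for m
  proof -
    have e: "m + (K + 1) - K = Suc m" by simp
    have i: "injections K (m + (K + 1)) = fact (m + (K + 1)) / fact (Suc m)"
      unfolding injections_def e by simp
    have x: "x / fact (Suc m) * real (Suc m) = x / fact m" for x :: real
      by (simp del: of_nat_Suc)
    have "pmf qM (m + (K + 1)) * injections K (m + (K + 1)) * rho u ^ (m + (K + 1) - K) * real (m + (K + 1) - K)
      = pmf qM (m + (K + 1)) * rho u ^ Suc m * (fact (m + (K + 1)) / fact (Suc m) * real (Suc m))"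
      unfolding i e by (simp only: mult_ac)
    then show ?thesis unfolding x by (simp only: power_Suc mult_ac)
  qed
  then show "(\<lambda>m. pmf qM (m + (K + 1)) * injections K (m + (K + 1)) * rho u ^ (m + (K + 1) - K) * real (m + (K + 1) - K)) sums
    (rho u * Psi d qM H (K + 1) u)"
    using sums_mult[OF Psi_summand_sums[OF assms, of "K + 1"], of "rho u"] by simp
qed simp

section \<open>Weights of partitions and the effect of one more observation\<close>

definition block_weight :: "(nat \<Rightarrow> nat) \<Rightarrow> (nat \<times> nat \<Rightarrow> nat \<times> nat) \<Rightarrow> (nat \<Rightarrow> real) \<Rightarrow> real" where
  "block_weight n r u = (\<Prod>k=1..d. \<Prod>y\<in>r ` obs_index d n. kappa (H k) (u k) (group_count n r k y))"

text \<open>Occupied atoms contribute \<open>block_weight\<close>, which depends on the partition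
  alone, and each of the \<open>M - K\<close> remaining atoms contributes \<open>rho u\<close>.
  Hence all labellings of a partition have the same weight.\<close>

lemma label_weight_comp:
  assumes "\<phi> \<in> PiE (r ` obs_index d n) (\<lambda>_. {1..M})" "inj_on \<phi> (r ` obs_index d n)"
  shows "label_weight n M u (\<lambda>e\<in>obs_index d n. \<phi> (r e))
    = block_weight n r u * rho u ^ (M - card (r ` obs_index d n))"
proof -
  let ?Y = "r ` obs_index d n" and ?c = "\<lambda>e\<in>obs_index d n. \<phi> (r e)"
  have sub: "\<phi> ` ?Y \<subseteq> {1..M}" using assms(1) by auto
  have "(\<Prod>m=1..M. kappa (H k) (u k) (group_count n ?c k m))
    = kappa (H k) (u k) 0 ^ (M - card ?Y) * (\<Prod>y\<in>?Y. kappa (H k) (u k) (group_count n r k y))"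
    if k: "k \<in> {1..d}" for k
  proof -
    have "(\<Prod>m=1..M. kappa (H k) (u k) (group_count n ?c k m))
      = (\<Prod>m\<in>{1..M} - \<phi> ` ?Y. kappa (H k) (u k) (group_count n ?c k m))
      * (\<Prod>m\<in>\<phi> ` ?Y. kappa (H k) (u k) (group_count n ?c k m))"
      using sub by (intro prod.subset_diff) auto
    also have "(\<Prod>m\<in>{1..M} - \<phi> ` ?Y. kappa (H k) (u k) (group_count n ?c k m))
      = (\<Prod>m\<in>{1..M} - \<phi> ` ?Y. kappa (H k) (u k) 0)"
      using group_count_comp(2)[OF k assms(2)] by (intro prod.cong refl) simp
    also have "\<dots> = kappa (H k) (u k) 0 ^ (M - card ?Y)"
      using sub assms(2) by (simp add: card_Diff_subset finite_subset card_image)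
    also have "(\<Prod>m\<in>\<phi> ` ?Y. kappa (H k) (u k) (group_count n ?c k m))
      = (\<Prod>y\<in>?Y. kappa (H k) (u k) (group_count n ?c k (\<phi> y)))"
      using assms(2) by (simp add: prod.reindex)
    also have "\<dots> = (\<Prod>y\<in>?Y. kappa (H k) (u k) (group_count n r k y))"
      by (intro prod.cong refl) (simp only: group_count_comp(1)[OF k assms(2)])
    finally show ?thesis .
  qed
  then show ?thesis
    unfolding label_weight_def block_weight_def rho_def
    by (simp add: prod.distrib prod_power_distrib mult.commute)
qed

text \<open>The value type is left general because blocks are named by atom labels for an allocation
  and by indices for a representative map.\<close>

definition ratio :: "(nat \<Rightarrow> nat) \<Rightarrow> (nat \<times> nat \<Rightarrow> 'b) \<Rightarrow> nat \<Rightarrow> (nat \<Rightarrow> real) \<Rightarrow> 'b \<Rightarrow> real" where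
  "ratio n c j u y = kappa (H j) (u j) (group_count n c j y + 1) / kappa (H j) (u j) (group_count n c j y)"

lemma ratio_nonneg: "0 \<le> ratio n c j u y"
  by (simp add: ratio_def kappa_nonneg)

text \<open>Only the factor at group \<open>j\<close> and atom \<open>m\<close> changes. Positivity
  of \<open>kappa\<close> allows the change to be written as a quotient, also when the atom was
  empty.\<close>

lemma label_weight_insert:
  assumes "n' = n(j := n j + 1)" "j \<in> {1..d}" "m \<in> {1..M}" "0 < u j"
  shows "label_weight n' M u (c((j, n j + 1) := m)) = label_weight n M u c * ratio n c j u m"
proof -
  have "kappa (H k) (u k) (group_count n' (c((j, n j + 1) := m)) k m')
    = kappa (H k) (u k) (group_count n c k m') * (if k = j then if m' = m then ratio n c j u m else 1 else 1)" for k m'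
    unfolding group_count_insert[OF assms(1)]
    using kappa_pos[OF assms(4), of j "group_count n c j m"] by (simp add: ratio_def)
  then have "label_weight n' M u (c((j, n j + 1) := m))
    = (\<Prod>k=1..d. \<Prod>m'=1..M. kappa (H k) (u k) (group_count n c k m')
        * (if k = j then if m' = m then ratio n c j u m else 1 else 1))"
    by (simp add: label_weight_def)
  also have "\<dots> = label_weight n M u c *
      (\<Prod>k=1..d. if k = j then \<Prod>m'=1..M. (if m' = m then ratio n c j u m else 1) else 1)"
  proof -
    have "(\<Prod>m'=1..M. if k = j then if m' = m then ratio n c j u m else 1 else 1)
      = (if k = j then \<Prod>m'=1..M. (if m' = m then ratio n c j u m else 1) else 1)" for k
      by simp
    then show ?thesis by (simp only: label_weight_def prod.distrib)
  qed
  also have "\<dots> = label_weight n M u c * ratio n c j u m"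
    using assms by (simp add: prod.delta)
  finally show ?thesis .
qed

text \<open>The labels for the new observation split into the image of \<open>\<phi>\<close>, where
  it repeats the value of a block, and the remaining \<open>M - card Y\<close> labels, which all
  contribute equally. \<open>D\<close> integrates over one independent value per block.\<close>

lemma sum_new_label:
  assumes j: "j \<in> {1..d}" "0 < u j" and n': "n' = n(j := n j + 1)"
    and r: "r ` obs_index d n \<subseteq> obs_index d n"
    and \<phi>: "\<phi> \<in> PiE (r ` obs_index d n) (\<lambda>_. {1..M})" "inj_on \<phi> (r ` obs_index d n)"
    and f: "f \<in> borel_measurable (PiM (obs_index d n) (\<lambda>_. P0))" and A: "A \<in> sets P0"
  defines "Y \<equiv> r ` obs_index d n" and "c \<equiv> \<lambda>e\<in>obs_index d n. \<phi> (r e)"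
  defines "D \<equiv> \<lambda>g. \<integral>\<^sup>+\<sigma>. f (\<lambda>e\<in>obs_index d n. \<sigma> (r e)) * g \<sigma> \<partial>PiM Y (\<lambda>_. P0)"
  shows "(\<Sum>m=1..M. ennreal (label_weight n' M u (c((j, n j + 1) := m))) *
      (\<integral>\<^sup>+\<tau>. f (\<lambda>e\<in>obs_index d n. \<tau> (c e)) * indicator A (\<tau> m) \<partial>PiM {1..M} (\<lambda>_. P0)))
    = ennreal (block_weight n r u * rho u ^ (M - card Y)) *
      ((\<Sum>y\<in>Y. ennreal (ratio n r j u y) * D (\<lambda>\<sigma>. indicator A (\<sigma> y)))
       + ennreal (real (M - card Y) * (kappa (H j) (u j) 1 / kappa (H j) (u j) 0 * measure P0 A)) * D (\<lambda>_. 1))"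
proof -
  let ?I = "obs_index d n" and ?new = "(j, n j + 1)" and ?T = "PiM {1..M} (\<lambda>_. P0)"
  let ?W = "block_weight n r u * rho u ^ (M - card Y)"
  let ?k = "kappa (H j) (u j) 1 / kappa (H j) (u j) 0"
  interpret P: prob_space P0 by (rule P0)
  interpret S: product_sigma_finite "\<lambda>_. P0" using P0 by (rule product_sigma_finite_const)
  have new: "?new \<notin> Y" using r by (auto simp: Y_def obs_index_def)
  have finY: "finite Y" by (simp add: Y_def)
  note f[measurable] A[measurable]
  have W: "0 \<le> ?W" unfolding block_weight_def rho_def by (intro mult_nonneg_nonneg prod_nonneg zero_le_power kappa_nonneg)
  have sub: "\<phi> ` Y \<subseteq> {1..M}" using \<phi> by (auto simp: Y_def)
  have lw: "label_weight n' M u (c(?new := m)) = ?W * ratio n c j u m" if "m \<in> {1..M}" for m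
    using label_weight_insert[where n = n and n' = n' and j = j and m = m and M = M and u = u and c = c, OF n' j(1) that j(2)] label_weight_comp[OF \<phi>, of u] by (simp add: c_def Y_def)
  have elw: "ennreal (label_weight n' M u (c(?new := m))) = ennreal ?W * ennreal (ratio n c j u m)"
    if "m \<in> {1..M}" for m
    by (simp only: lw[OF that] ennreal_mult[OF W ratio_nonneg])
  have old: "ennreal (label_weight n' M u (c(?new := \<phi> y))) *
      (\<integral>\<^sup>+\<tau>. f (\<lambda>e\<in>?I. \<tau> (c e)) * indicator A (\<tau> (\<phi> y)) \<partial>?T)
    = ennreal ?W * (ennreal (ratio n r j u y) * D (\<lambda>\<sigma>. indicator A (\<sigma> y)))" if y: "y \<in> Y" for y
  proof -
    have [measurable]: "(\<lambda>\<sigma>. \<lambda>e\<in>?I. \<sigma> (r e)) \<in> measurable (PiM Y (\<lambda>_. P0)) (PiM ?I (\<lambda>_. P0))"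
      by (intro measurable_restrict measurable_component_singleton) (auto simp: Y_def)
    have "(\<integral>\<^sup>+\<tau>. f (\<lambda>e\<in>?I. \<tau> (c e)) * indicator A (\<tau> (\<phi> y)) \<partial>?T)
      = (\<integral>\<^sup>+\<tau>. (\<lambda>\<sigma>. f (\<lambda>e\<in>?I. \<sigma> (r e)) * indicator A (\<sigma> y)) (\<lambda>i\<in>Y. \<tau> (\<phi> i)) \<partial>?T)"
      using y by (intro nn_integral_cong) (simp add: c_def Y_def cong: restrict_cong)
    also have "\<dots> = D (\<lambda>\<sigma>. indicator A (\<sigma> y))"
      unfolding D_def using y \<phi> sub by (intro nn_integral_PiM_reindex[OF P0]) (auto simp: Y_def[symmetric])
    finally have *: "(\<integral>\<^sup>+\<tau>. f (\<lambda>e\<in>?I. \<tau> (c e)) * indicator A (\<tau> (\<phi> y)) \<partial>?T) = D (\<lambda>\<sigma>. indicator A (\<sigma> y))" .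
    have "\<phi> y \<in> {1..M}" using sub y by auto
    moreover have "ratio n c j u (\<phi> y) = ratio n r j u y"
      using group_count_comp(1)[OF j(1) \<phi>(2)] y by (simp add: ratio_def c_def Y_def)
    ultimately show ?thesis
      by (simp only: elw * mult.assoc)
  qed
  have fresh: "ennreal (label_weight n' M u (c(?new := m))) *
      (\<integral>\<^sup>+\<tau>. f (\<lambda>e\<in>?I. \<tau> (c e)) * indicator A (\<tau> m) \<partial>?T)
    = ennreal ?W * (ennreal (?k * measure P0 A) * D (\<lambda>_. 1))" if m: "m \<in> {1..M} - \<phi> ` Y" for m
  proof -
    \<comment> \<open>The new observation forms a block of its own, represented by its own index.
      Since \<open>m\<close> is unoccupied, the extended labelling stays injective and
      \<open>nn_integral_PiM_reindex\<close> applies to it.\<close>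
    let ?\<phi> = "\<phi>(?new := m)" and ?Y = "insert ?new Y"
    let ?G = "\<lambda>\<sigma>. f (\<lambda>e\<in>?I. \<sigma> (r e)) * indicator A (\<sigma> ?new)"
    have rY: "r e \<in> Y" if "e \<in> ?I" for e using that by (auto simp: Y_def)
    have rnew: "r e \<noteq> ?new" if "e \<in> ?I" for e using rY[OF that] new by auto
    have [measurable]: "(\<lambda>\<sigma>. \<lambda>e\<in>?I. \<sigma> (r e)) \<in> measurable (PiM ?Y (\<lambda>_. P0)) (PiM ?I (\<lambda>_. P0))"
      "(\<lambda>\<sigma>. \<lambda>e\<in>?I. \<sigma> (r e)) \<in> measurable (PiM Y (\<lambda>_. P0)) (PiM ?I (\<lambda>_. P0))"
      by (intro measurable_restrict measurable_component_singleton; use rY in auto)+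
    have [measurable]: "(\<lambda>\<sigma>. \<sigma> ?new) \<in> measurable (PiM ?Y (\<lambda>_. P0)) P0"
      by (intro measurable_component_singleton) simp
    have Gm: "?G \<in> borel_measurable (PiM ?Y (\<lambda>_. P0))" by measurable
    have inj: "inj_on ?\<phi> ?Y"
      using \<phi>(2) m new by (auto simp: Y_def[symmetric] inj_on_def)
    have "(\<integral>\<^sup>+\<tau>. f (\<lambda>e\<in>?I. \<tau> (c e)) * indicator A (\<tau> m) \<partial>?T)
      = (\<integral>\<^sup>+\<tau>. ?G (\<lambda>i\<in>?Y. \<tau> (?\<phi> i)) \<partial>?T)"
    proof (intro nn_integral_cong)
      fix \<tau> :: "nat \<Rightarrow> 'a"
      have "(\<lambda>e\<in>?I. \<tau> (c e)) = (\<lambda>e\<in>?I. (\<lambda>i\<in>?Y. \<tau> (?\<phi> i)) (r e))"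
        using rY rnew by (intro restrict_ext) (simp add: c_def)
      then show "f (\<lambda>e\<in>?I. \<tau> (c e)) * indicator A (\<tau> m) = ?G (\<lambda>i\<in>?Y. \<tau> (?\<phi> i))" by simp
    qed
    also have "\<dots> = (\<integral>\<^sup>+\<sigma>. ?G \<sigma> \<partial>PiM ?Y (\<lambda>_. P0))"
      by (rule nn_integral_PiM_reindex[OF P0 inj _ Gm]) (use sub m in auto)
    also have "\<dots> = (\<integral>\<^sup>+\<sigma>. \<integral>\<^sup>+a. ?G (\<sigma>(?new := a)) \<partial>P0 \<partial>PiM Y (\<lambda>_. P0))"
      by (rule S.product_nn_integral_insert[OF finY new Gm])
    \<comment> \<open>No old observation refers to the new coordinate, so that coordinate integrates
      out to the \<open>P0\<close>-mass of \<open>A\<close>.\<close>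
    also have "\<dots> = (\<integral>\<^sup>+\<sigma>. \<integral>\<^sup>+a. f (\<lambda>e\<in>?I. \<sigma> (r e)) * indicator A a \<partial>P0 \<partial>PiM Y (\<lambda>_. P0))"
      using rnew by (intro nn_integral_cong) (simp cong: restrict_cong)
    also have "\<dots> = (\<integral>\<^sup>+\<sigma>. f (\<lambda>e\<in>?I. \<sigma> (r e)) * 1 * emeasure P0 A \<partial>PiM Y (\<lambda>_. P0))"
      by (simp add: nn_integral_cmult)
    also have "\<dots> = D (\<lambda>_. 1) * emeasure P0 A"
      unfolding D_def by (subst nn_integral_multc) measurable
    finally have *: "(\<integral>\<^sup>+\<tau>. f (\<lambda>e\<in>?I. \<tau> (c e)) * indicator A (\<tau> m) \<partial>?T) = D (\<lambda>_. 1) * ennreal (measure P0 A)"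
      by (simp add: P.emeasure_eq_measure)
    \<comment> \<open>All counts at an unoccupied atom are 0.\<close>
    have "ratio n c j u m = ?k"
      using group_count_comp(2)[OF j(1) \<phi>(2), of m] m by (simp add: ratio_def c_def Y_def)
    moreover have "0 \<le> ?k" by (simp add: kappa_nonneg)
    moreover have "m \<in> {1..M}" using m by simp
    ultimately show ?thesis
      by (simp only: elw * ennreal_mult measure_nonneg) (simp only: mult_ac)
  qed
  let ?t = "\<lambda>m. ennreal (label_weight n' M u (c(?new := m))) * (\<integral>\<^sup>+\<tau>. f (\<lambda>e\<in>?I. \<tau> (c e)) * indicator A (\<tau> m) \<partial>?T)"
  have "(\<Sum>m=1..M. ?t m) = (\<Sum>m\<in>\<phi> ` Y. ?t m) + (\<Sum>m\<in>{1..M} - \<phi> ` Y. ?t m)"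
    using sum.subset_diff[OF sub, of ?t] by (simp only: finite_atLeastAtMost add.commute)
  also have "(\<Sum>m\<in>\<phi> ` Y. ?t m) = (\<Sum>y\<in>Y. ?t (\<phi> y))"
    using \<phi>(2) by (simp add: sum.reindex Y_def)
  also have "\<dots> = (\<Sum>y\<in>Y. ennreal ?W * (ennreal (ratio n r j u y) * D (\<lambda>\<sigma>. indicator A (\<sigma> y))))"
    by (intro sum.cong refl old)
  also have "(\<Sum>m\<in>{1..M} - \<phi> ` Y. ?t m) = (\<Sum>m\<in>{1..M} - \<phi> ` Y. ennreal ?W * (ennreal (?k * measure P0 A) * D (\<lambda>_. 1)))"
    by (intro sum.cong refl fresh)
  also have "\<dots> = ennreal ?W * (ennreal (real (M - card Y) * (?k * measure P0 A)) * D (\<lambda>_. 1))"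
  proof -
    have "card ({1..M} - \<phi> ` Y) = M - card Y"
      using sub finY \<phi>(2) by (simp add: card_Diff_subset card_image Y_def)
    moreover have "ennreal (real (M - card Y) * (?k * measure P0 A)) = ennreal (real (M - card Y)) * ennreal (?k * measure P0 A)"
      by (intro ennreal_mult) (simp_all add: kappa_nonneg)
    ultimately show ?thesis by (simp add: ennreal_of_nat_eq_real_of_nat mult_ac)
  qed
  finally show ?thesis
    by (simp only: distrib_left sum_distrib_left)
qed

text \<open>After grouping allocations by partition, \<open>M\<close> enters only through the number
  of labellings, powers of \<open>rho u\<close> and the number of empty atoms; the two series over
  \<open>M\<close> are those of \<open>Psi_sums\<close> and \<open>Psi_Suc_sums\<close>. Division by
  \<open>Psi\<close> is postponed, since it may vanish.\<close>

lemma sum_over_atoms: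
  assumes j: "j \<in> {1..d}" and u: "\<forall>k\<in>{1..d}. 0 < u k" and n': "n' = n(j := n j + 1)"
    and f: "f \<in> borel_measurable (PiM (obs_index d n) (\<lambda>_. P0))" and A: "A \<in> sets P0"
  defines "D \<equiv> \<lambda>r g. \<integral>\<^sup>+\<sigma>. f (\<lambda>e\<in>obs_index d n. \<sigma> (r e)) * g \<sigma> \<partial>PiM (r ` obs_index d n) (\<lambda>_. P0)"
  shows "(\<Sum>M. ennreal (pmf qM M) * (\<Sum>c\<in>PiE (obs_index d n) (\<lambda>_. {1..M}). \<Sum>m=1..M.
      ennreal (label_weight n' M u (c((j, n j + 1) := m))) *
      (\<integral>\<^sup>+\<tau>. f (\<lambda>e\<in>obs_index d n. \<tau> (c e)) * indicator A (\<tau> m) \<partial>PiM {1..M} (\<lambda>_. P0))))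
    = (\<Sum>r\<in>canons (obs_index d n). ennreal (block_weight n r u) *
        (ennreal (Psi d qM H (card (r ` obs_index d n)) u) *
           (\<Sum>y\<in>r ` obs_index d n. ennreal (ratio n r j u y) * D r (\<lambda>\<sigma>. indicator A (\<sigma> y)))
         + ennreal (kappa (H j) (u j) 1 * (\<Prod>k\<in>{1..d} - {j}. kappa (H k) (u k) 0)
             * Psi d qM H (card (r ` obs_index d n) + 1) u * measure P0 A) * D r (\<lambda>_. 1)))"
proof -
  let ?I = "obs_index d n" and ?R = "canons (obs_index d n)"
  let ?J = "\<lambda>M r. {\<phi> \<in> PiE (r ` ?I) (\<lambda>_. {1..M}). inj_on \<phi> (r ` ?I)}"
  let ?K = "\<lambda>r. card (r ` ?I)"
  let ?k = "kappa (H j) (u j) 1 / kappa (H j) (u j) 0 * measure P0 A"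
  let ?S = "\<lambda>r. \<Sum>y\<in>r ` ?I. ennreal (ratio n r j u y) * D r (\<lambda>\<sigma>. indicator A (\<sigma> y))"
  have d: "1 \<le> d" and uj: "0 < u j" using j u by auto
  have rho: "0 < rho u" by (rule rho_pos[OF u])
  have k0: "0 < kappa (H j) (u j) 0" by (rule kappa_pos[OF uj])
  have knn: "0 \<le> ?k" by (simp add: kappa_nonneg)
  have bw: "0 \<le> block_weight n r u" for r
    unfolding block_weight_def by (intro prod_nonneg kappa_nonneg)
  let ?t = "\<lambda>M c. \<Sum>m=1..M. ennreal (label_weight n' M u (c((j, n j + 1) := m))) *
      (\<integral>\<^sup>+\<tau>. f (\<lambda>e\<in>?I. \<tau> (c e)) * indicator A (\<tau> m) \<partial>PiM {1..M} (\<lambda>_. P0))"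
  have t: "ennreal (pmf qM M) * (\<Sum>c\<in>PiE ?I (\<lambda>_. {1..M}). ?t M c)
    = (\<Sum>r\<in>?R. ennreal (block_weight n r u) *
        (ennreal (pmf qM M * injections (?K r) M * rho u ^ (M - ?K r)) * ?S r
        + ennreal (pmf qM M * injections (?K r) M * rho u ^ (M - ?K r) * real (M - ?K r)) * (ennreal ?k * D r (\<lambda>_. 1))))"
    for M
  proof -
    have "(\<Sum>c\<in>PiE ?I (\<lambda>_. {1..M}). ?t M c) = (\<Sum>r\<in>?R. \<Sum>\<phi>\<in>?J M r. ?t M (\<lambda>e\<in>?I. \<phi> (r e)))"
      by (rule sum_labellings_by_canon) simp_all
    also have "\<dots> = (\<Sum>r\<in>?R. \<Sum>\<phi>\<in>?J M r. ennreal (block_weight n r u * rho u ^ (M - ?K r)) *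
      (?S r + ennreal (real (M - ?K r) * ?k) * D r (\<lambda>_. 1)))"
    proof (intro sum.cong refl)
      fix r \<phi> assume r: "r \<in> ?R" and \<phi>: "\<phi> \<in> ?J M r"
      show "?t M (\<lambda>e\<in>?I. \<phi> (r e)) = ennreal (block_weight n r u * rho u ^ (M - ?K r)) *
        (?S r + ennreal (real (M - ?K r) * ?k) * D r (\<lambda>_. 1))"
        unfolding D_def
        by (rule sum_new_label[where n = n and n' = n' and j = j and r = r and \<phi> = \<phi> and u = u and f = f and A = A and M = M, OF j uj n' canons_image[OF r] _ _ f A]) (use \<phi> in auto)
    qed
    also have "\<dots> = (\<Sum>r\<in>?R. ennreal (injections (?K r) M) * (ennreal (block_weight n r u * rho u ^ (M - ?K r)) *
      (?S r + ennreal (real (M - ?K r) * ?k) * D r (\<lambda>_. 1))))"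
    proof (intro sum.cong refl)
      fix r :: "nat \<times> nat \<Rightarrow> nat \<times> nat"
      \<comment> \<open>The summand no longer depends on \<open>\<phi>\<close>, so the inner sum is
        a count of injections.\<close>
      have "real (card (?J M r)) = injections (?K r) M"
        unfolding injections_def using card_injections[of "r ` ?I" "{1..M}"]
        by (simp only: card_atLeastAtMost add_diff_cancel_right' finite_atLeastAtMost finite_imageI finite_obs_index Suc_eq_plus1 simp_thms)
      then have "of_nat (card (?J M r)) = ennreal (injections (?K r) M)"
        by (simp only: ennreal_of_nat_eq_real_of_nat)
      then show "(\<Sum>\<phi>\<in>?J M r. ennreal (block_weight n r u * rho u ^ (M - ?K r)) *
          (?S r + ennreal (real (M - ?K r) * ?k) * D r (\<lambda>_. 1)))
        = ennreal (injections (?K r) M) * (ennreal (block_weight n r u * rho u ^ (M - ?K r)) *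
          (?S r + ennreal (real (M - ?K r) * ?k) * D r (\<lambda>_. 1)))"
        by (simp only: sum_constant)
    qed
    finally have *: "(\<Sum>c\<in>PiE ?I (\<lambda>_. {1..M}). ?t M c) = \<dots>" .
    have expand: "ennreal p * (ennreal i * (ennreal (b * w) * (S + ennreal (m * k) * D')))
      = ennreal b * (ennreal (p * i * w) * S + ennreal (p * i * w * m) * (ennreal k * D'))"
      if "0 \<le> p" "0 \<le> i" "0 \<le> b" "0 \<le> w" "0 \<le> m" "0 \<le> k" for p i b w m k and S D' :: ennreal
      using that by (simp only: ennreal_mult mult_nonneg_nonneg distrib_left mult_ac)
    show ?thesis
      unfolding * by (subst sum_distrib_left, intro sum.cong refl expand)
        (use rho bw injections_nonneg in \<open>simp_all add: kappa_nonneg\<close>)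
  qed
  have "(\<Sum>M. ennreal (pmf qM M) * (\<Sum>c\<in>PiE ?I (\<lambda>_. {1..M}). ?t M c))
    = (\<Sum>r\<in>?R. \<Sum>M. ennreal (block_weight n r u) *
        (ennreal (pmf qM M * injections (?K r) M * rho u ^ (M - ?K r)) * ?S r
        + ennreal (pmf qM M * injections (?K r) M * rho u ^ (M - ?K r) * real (M - ?K r)) * (ennreal ?k * D r (\<lambda>_. 1))))"
    unfolding t by (rule suminf_sum) simp
  also have "\<dots> = (\<Sum>r\<in>?R. ennreal (block_weight n r u) *
      (ennreal (Psi d qM H (?K r) u) * ?S r
        + ennreal (rho u * Psi d qM H (?K r + 1) u) * (ennreal ?k * D r (\<lambda>_. 1))))"
  proof (intro sum.cong refl)
    fix r :: "nat \<times> nat \<Rightarrow> nat \<times> nat"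
    have 1: "(\<Sum>M. ennreal (pmf qM M * injections (?K r) M * rho u ^ (M - ?K r))) = ennreal (Psi d qM H (?K r) u)"
      using rho by (intro suminf_ennreal_eq Psi_sums[OF u d]) (simp add: injections_nonneg)
    have 2: "(\<Sum>M. ennreal (pmf qM M * injections (?K r) M * rho u ^ (M - ?K r) * real (M - ?K r)))
      = ennreal (rho u * Psi d qM H (?K r + 1) u)"
      using rho by (intro suminf_ennreal_eq Psi_Suc_sums[OF u d]) (simp add: injections_nonneg)
    show "(\<Sum>M. ennreal (block_weight n r u) *
        (ennreal (pmf qM M * injections (?K r) M * rho u ^ (M - ?K r)) * ?S r
        + ennreal (pmf qM M * injections (?K r) M * rho u ^ (M - ?K r) * real (M - ?K r)) * (ennreal ?k * D r (\<lambda>_. 1))))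
      = ennreal (block_weight n r u) *
      (ennreal (Psi d qM H (?K r) u) * ?S r
        + ennreal (rho u * Psi d qM H (?K r + 1) u) * (ennreal ?k * D r (\<lambda>_. 1)))"
      by (simp only: ennreal_suminf_cmult suminf_add[symmetric] summableI ennreal_suminf_multc 1 2)
  qed
  also have "\<dots> = (\<Sum>r\<in>?R. ennreal (block_weight n r u) *
      (ennreal (Psi d qM H (?K r) u) * ?S r
        + ennreal (kappa (H j) (u j) 1 * (\<Prod>k\<in>{1..d} - {j}. kappa (H k) (u k) 0)
             * Psi d qM H (?K r + 1) u * measure P0 A) * D r (\<lambda>_. 1)))"
  proof -
    \<comment> \<open>Occupying an empty atom by the new observation replaces the factor
      \<open>kappa (H j) (u j) 0\<close> of \<open>rho u\<close> by
      \<open>kappa (H j) (u j) 1\<close>; the other groups keep theirs.\<close>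
    have eq: "ennreal (rho u * Psi d qM H (?K r + 1) u) * (ennreal ?k * D r (\<lambda>_. 1))
      = ennreal (kappa (H j) (u j) 1 * (\<Prod>k\<in>{1..d} - {j}. kappa (H k) (u k) 0)
             * Psi d qM H (?K r + 1) u * measure P0 A) * D r (\<lambda>_. 1)" for r
    proof -
      have "rho u = kappa (H j) (u j) 0 * (\<Prod>k\<in>{1..d} - {j}. kappa (H k) (u k) 0)"
        unfolding rho_def using j by (intro prod.remove) auto
      then have X: "rho u * Psi d qM H (?K r + 1) u * ?k = kappa (H j) (u j) 1 * (\<Prod>k\<in>{1..d} - {j}. kappa (H k) (u k) 0)
               * Psi d qM H (?K r + 1) u * measure P0 A"
        using k0 by simp
      have "0 \<le> rho u * Psi d qM H (?K r + 1) u"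
        using rho Psi_nonneg[OF u d] by simp
      then have "ennreal (rho u * Psi d qM H (?K r + 1) u) * (ennreal ?k * D r (\<lambda>_. 1))
        = ennreal (rho u * Psi d qM H (?K r + 1) u * ?k) * D r (\<lambda>_. 1)"
        by (subst ennreal_mult[OF _ knn]) (assumption, rule mult.assoc[symmetric])
      then show ?thesis unfolding X .
    qed
    show ?thesis by (simp only: eq)
  qed
  finally show ?thesis .
qed

text \<open>The predictive weight with the partition frozen at \<open>r\<close>: the counts and the
  number of blocks become constants, and \<open>x\<close> enters only through indicators.\<close>

definition canon_weight ::
  "(nat \<Rightarrow> nat) \<Rightarrow> nat \<Rightarrow> (nat \<times> nat \<Rightarrow> nat \<times> nat) \<Rightarrow> (nat \<Rightarrow> real) \<Rightarrow> (nat \<times> nat \<Rightarrow> 'a) \<Rightarrow> 'a set \<Rightarrow> real" where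
  "canon_weight n j r u x A =
    (\<Sum>y\<in>r ` obs_index d n. ratio n r j u y * indicator A (x y))
    + kappa (H j) (u j) 1 * (\<Prod>k \<in> {1..d} - {j}. kappa (H k) (u k) 0)
      * (Psi d qM H (card (r ` obs_index d n) + 1) u / Psi d qM H (card (r ` obs_index d n)) u) * measure P0 A"

lemma predictive_weight_canon:
  assumes j: "j \<in> {1..d}"
  shows "predictive_weight d qM H P0 n j x u A = canon_weight n j (canon (obs_index d n) x) u x A"
proof -
  let ?I = "obs_index d n"
  let ?r = "canon ?I x"
  have inj: "inj_on x (?r ` ?I)"
    using canon_in[of _ ?I x] canon_eq_iff[of _ ?I _ x] by (auto simp: inj_on_def)
  have im: "distinct_values d n x = x ` ?r ` ?I"
  proof -
    have "x (?r e) = x e" if "e \<in> ?I" for e by (rule canon_in(2)[OF that])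
    then show ?thesis unfolding distinct_values_def image_image by (intro image_cong) auto
  qed
  have gc: "group_count n x j (x y) = group_count n ?r j y" if y: "y \<in> ?r ` ?I" for y
  proof -
    obtain e where e: "e \<in> ?I" "y = ?r e" using y by auto
    have "(j, i) \<in> ?I" if "i \<in> {1..n j}" for i using j that by (simp add: obs_index_def)
    then have "{i \<in> {1..n j}. x (j, i) = x y} = {i \<in> {1..n j}. ?r (j, i) = y}"
      using e canon_in(2)[OF e(1), of x] canon_eq_iff[OF _ e(1), of _ x] by auto
    then show ?thesis by (simp add: group_count_def)
  qed
  have "(\<Sum>y\<in>distinct_values d n x. kappa (H j) (u j) (group_count n x j y + 1) / kappa (H j) (u j) (group_count n x j y) * indicator A y)
    = (\<Sum>y\<in>?r ` ?I. ratio n ?r j u y * indicator A (x y))"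
    unfolding im sum.reindex[OF inj] ratio_def by (intro sum.cong refl) (simp add: gc)
  moreover have "card (distinct_values d n x) = card (?r ` ?I)"
    unfolding im by (rule card_image[OF inj])
  ultimately show ?thesis
    unfolding predictive_weight_def canon_weight_def by (simp add: Let_def)
qed

text \<open>The sum over partitions is known in terms of \<open>r\<close>, whereas
  \<open>predictive_weight\<close> reads its partition off the observed values. For almost every
  \<open>\<sigma>\<close> the block values are distinct, so the two partitions agree.\<close>

lemma predictive_disintegration_fixed_u:
  assumes j: "j \<in> {1..d}" and u: "\<forall>k\<in>{1..d}. 0 < u k" and n': "n' = n(j := n j + 1)"
    and f: "f \<in> borel_measurable (PiM (obs_index d n) (\<lambda>_. P0))" and A: "A \<in> sets P0"
  shows "(\<Sum>M. ennreal (pmf qM M) * (\<Sum>c\<in>PiE (obs_index d n) (\<lambda>_. {1..M}). \<Sum>m=1..M.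
      ennreal (label_weight n' M u (c((j, n j + 1) := m))) *
      (\<integral>\<^sup>+\<tau>. f (\<lambda>e\<in>obs_index d n. \<tau> (c e)) * indicator A (\<tau> m) \<partial>PiM {1..M} (\<lambda>_. P0))))
    = (\<Sum>r\<in>canons (obs_index d n). ennreal (block_weight n r u * Psi d qM H (card (r ` obs_index d n)) u) *
        (\<integral>\<^sup>+\<sigma>. f (\<lambda>e\<in>obs_index d n. \<sigma> (r e)) *
          ennreal (predictive_weight d qM H P0 n j (\<lambda>e\<in>obs_index d n. \<sigma> (r e)) u A)
         \<partial>PiM (r ` obs_index d n) (\<lambda>_. P0)))"
proof -
  let ?I = "obs_index d n"
  let ?X = "\<lambda>r \<sigma>. \<lambda>e\<in>?I. \<sigma> (r e)"
  let ?k = "kappa (H j) (u j) 1 * (\<Prod>k\<in>{1..d} - {j}. kappa (H k) (u k) 0)"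
  have d: "1 \<le> d" using j by auto
  note f[measurable] A[measurable]
  have k: "0 \<le> ?k" by (intro mult_nonneg_nonneg prod_nonneg kappa_nonneg)
  have bw: "0 \<le> block_weight n r u" for r
    unfolding block_weight_def by (intro prod_nonneg kappa_nonneg)
  have "ennreal (block_weight n r u) *
        (ennreal (Psi d qM H (card (r ` ?I)) u) *
           (\<Sum>y\<in>r ` ?I. ennreal (ratio n r j u y) *
              (\<integral>\<^sup>+\<sigma>. f (?X r \<sigma>) * indicator A (\<sigma> y) \<partial>PiM (r ` ?I) (\<lambda>_. P0)))
         + ennreal (?k * Psi d qM H (card (r ` ?I) + 1) u * measure P0 A)
           * (\<integral>\<^sup>+\<sigma>. f (?X r \<sigma>) * 1 \<partial>PiM (r ` ?I) (\<lambda>_. P0)))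
    = ennreal (block_weight n r u * Psi d qM H (card (r ` ?I)) u) *
        (\<integral>\<^sup>+\<sigma>. f (?X r \<sigma>) * ennreal (predictive_weight d qM H P0 n j (?X r \<sigma>) u A)
         \<partial>PiM (r ` ?I) (\<lambda>_. P0))" if r: "r \<in> canons ?I" for r
  proof -
    let ?Y = "r ` ?I" and ?L = "PiM (r ` ?I) (\<lambda>_. P0)"
    let ?P = "Psi d qM H (card (r ` ?I)) u" and ?P1 = "Psi d qM H (card (r ` ?I) + 1) u"
    have P: "0 \<le> ?P" "0 \<le> ?P1" using Psi_nonneg[OF u d] by auto
    have [measurable]: "?X r \<in> measurable ?L (PiM ?I (\<lambda>_. P0))"
      by (intro measurable_restrict measurable_component_singleton) auto
    have [measurable]: "(\<lambda>\<sigma>. \<sigma> y) \<in> measurable ?L P0" if "y \<in> ?Y" for y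
      using that by (rule measurable_component_singleton)
    have pw: "AE \<sigma> in ?L. predictive_weight d qM H P0 n j (?X r \<sigma>) u A
      = (\<Sum>y\<in>?Y. ratio n r j u y * indicator A (\<sigma> y)) + ?k * (?P1 / ?P) * measure P0 A"
    proof -
      have "AE \<sigma> in ?L. inj_on \<sigma> ?Y"
        by (intro AE_PiM_inj_on P0 diag diffuse) simp
      then show ?thesis
      proof eventually_elim
        fix \<sigma> :: "nat \<times> nat \<Rightarrow> 'a" assume inj: "inj_on \<sigma> ?Y"
        have "canon ?I (?X r \<sigma>) = canon ?I r"
          using inj by (intro canon_comp[where f = \<sigma>]) auto
        also have "\<dots> = r" using r by (simp add: canons_def)
        finally have c: "canon ?I (?X r \<sigma>) = r" .
        have "?X r \<sigma> y = \<sigma> y" if "y \<in> ?Y" for y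
          using that canons_idem[OF r] canons_image[OF r] by auto
        then show "predictive_weight d qM H P0 n j (?X r \<sigma>) u A
          = (\<Sum>y\<in>?Y. ratio n r j u y * indicator A (\<sigma> y)) + ?k * (?P1 / ?P) * measure P0 A"
          unfolding predictive_weight_canon[OF j] c canon_weight_def by simp
      qed
    qed
    have "(\<integral>\<^sup>+\<sigma>. f (?X r \<sigma>) * ennreal (predictive_weight d qM H P0 n j (?X r \<sigma>) u A) \<partial>?L)
      = (\<integral>\<^sup>+\<sigma>. (\<Sum>y\<in>?Y. ennreal (ratio n r j u y) * (f (?X r \<sigma>) * indicator A (\<sigma> y)))
          + ennreal (?k * (?P1 / ?P) * measure P0 A) * (f (?X r \<sigma>) * 1) \<partial>?L)"
    proof (rule nn_integral_cong_AE, use pw in eventually_elim)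
      case (elim \<sigma>)
      have "ennreal (predictive_weight d qM H P0 n j (?X r \<sigma>) u A)
        = (\<Sum>y\<in>?Y. ennreal (ratio n r j u y) * indicator A (\<sigma> y)) + ennreal (?k * (?P1 / ?P) * measure P0 A)"
      proof -
        have "(\<Sum>y\<in>?Y. ennreal (ratio n r j u y) * indicator A (\<sigma> y))
          = ennreal (\<Sum>y\<in>?Y. ratio n r j u y * indicator A (\<sigma> y))"
          by (subst sum_ennreal[symmetric]) (auto simp: ratio_nonneg indicator_def intro!: sum.cong)
        moreover have "ennreal ((\<Sum>y\<in>?Y. ratio n r j u y * indicator A (\<sigma> y)) + ?k * (?P1 / ?P) * measure P0 A)
          = ennreal (\<Sum>y\<in>?Y. ratio n r j u y * indicator A (\<sigma> y)) + ennreal (?k * (?P1 / ?P) * measure P0 A)"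
          by (intro ennreal_plus sum_nonneg mult_nonneg_nonneg divide_nonneg_nonneg P ratio_nonneg k measure_nonneg) simp_all
        ultimately show ?thesis unfolding elim by simp
      qed
      then show ?case
        by (simp add: distrib_left sum_distrib_left mult_ac)
    qed
    also have "\<dots> = (\<Sum>y\<in>?Y. ennreal (ratio n r j u y) * (\<integral>\<^sup>+\<sigma>. f (?X r \<sigma>) * indicator A (\<sigma> y) \<partial>?L))
      + ennreal (?k * (?P1 / ?P) * measure P0 A) * (\<integral>\<^sup>+\<sigma>. f (?X r \<sigma>) * 1 \<partial>?L)"
      by (simp add: nn_integral_add nn_integral_sum nn_integral_cmult)
    finally have *: "(\<integral>\<^sup>+\<sigma>. f (?X r \<sigma>) * ennreal (predictive_weight d qM H P0 n j (?X r \<sigma>) u A) \<partial>?L) = \<dots>" .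
    have "?k * ?P1 * measure P0 A = ?P * (?k * (?P1 / ?P) * measure P0 A)"
      using Psi_Suc_eq_0[OF u d, of "card (r ` ?I)"] by (cases "?P = 0") auto
    then have "ennreal (?k * ?P1 * measure P0 A) = ennreal ?P * ennreal (?k * (?P1 / ?P) * measure P0 A)"
      using ennreal_mult[OF P(1), of "?k * (?P1 / ?P) * measure P0 A"] P k
      by (simp only: mult_nonneg_nonneg divide_nonneg_nonneg measure_nonneg)
    then show ?thesis
      unfolding * using P bw[of r] by (simp only: ennreal_mult distrib_left mult.assoc)
  qed
  then show ?thesis
    unfolding sum_over_atoms[where n = n and n' = n' and j = j and u = u and f = f and A = A, OF j u n' f A] by (intro sum.cong refl)
qed

end

section \<open>The predictive law\<close>

lemma obs_index_insert:
  assumes "j \<in> {1..d}" shows "obs_index d (n(j := n j + 1)) = insert (j, n j + 1) (obs_index d n)"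
  using assms by (auto simp: obs_index_def le_Suc_eq split: if_splits)

text \<open>Although \<open>canon\<close> involves a choice, the event that it equals
  \<open>r\<close> is a finite Boolean combination of coincidences between observations, hence
  measurable.\<close>

lemma canon_eq_canons_iff:
  assumes "r \<in> canons I"
  shows "canon I x = r \<longleftrightarrow> (\<forall>e\<in>I. \<forall>e'\<in>I. x e = x e' \<longleftrightarrow> r e = r e')"
proof
  assume "canon I x = r"
  then show "\<forall>e\<in>I. \<forall>e'\<in>I. x e = x e' \<longleftrightarrow> r e = r e'" using canon_eq_iff[of _ I _ x] by blast
next
  assume *: "\<forall>e\<in>I. \<forall>e'\<in>I. x e = x e' \<longleftrightarrow> r e = r e'"
  have "(e' \<in> I \<and> x e' = x e) = (e' \<in> I \<and> r e' = r e)" if "e \<in> I" for e e'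
    using * that by blast
  then have "canon I x = canon I r" unfolding canon_def by (intro restrict_ext) simp
  then show "canon I x = r" using assms by (simp add: canons_def)
qed

context atom_model begin

lemma measurable_obs_coordinates[measurable]:
  "e \<in> obs_index d n \<Longrightarrow> (\<lambda>z. fst z e) \<in> measurable (obs_space d P0 n) P0"
  "k \<in> {1..d} \<Longrightarrow> (\<lambda>z. snd z k) \<in> borel_measurable (obs_space d P0 n)"
  unfolding obs_space_def by measurable

lemma Psi_measurable[measurable]:
  "(\<lambda>z. Psi d qM H K (snd z)) \<in> borel_measurable (obs_space d P0 n)"
  unfolding Psi_def laplace_eq_kappa by measurable

lemma canon_weight_measurable:
  assumes "j \<in> {1..d}" "A \<in> sets P0" "r \<in> canons (obs_index d n)"
  shows "(\<lambda>z. canon_weight n j r (snd z) (fst z) A) \<in> borel_measurable (obs_space d P0 n)"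
proof -
  note assms(1,2)[measurable]
  have "y \<in> obs_index d n" if "y \<in> r ` obs_index d n" for y
    using canons_image[OF assms(3)] that by auto
  then have [measurable]: "(\<lambda>z. fst z y) \<in> measurable (obs_space d P0 n) P0" if "y \<in> r ` obs_index d n" for y
    using that by measurable
  show ?thesis unfolding canon_weight_def ratio_def by measurable
qed

lemma canon_event_measurable:
  assumes "r \<in> canons (obs_index d n)"
  shows "{z \<in> space (obs_space d P0 n). canon (obs_index d n) (fst z) = r} \<in> sets (obs_space d P0 n)"
proof -
  let ?I = "obs_index d n" and ?N = "obs_space d P0 n"
  have eq: "{z \<in> space ?N. fst z e = fst z e'} \<in> sets ?N" if e: "e \<in> ?I" "e' \<in> ?I" for e e'
  proof -
    have m: "(\<lambda>z. (fst z e, fst z e')) \<in> measurable ?N (P0 \<Otimes>\<^sub>M P0)" using e by measurable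
    have "{z \<in> space ?N. fst z e = fst z e'}
      = (\<lambda>z. (fst z e, fst z e')) -` {z \<in> space (P0 \<Otimes>\<^sub>M P0). fst z = snd z} \<inter> space ?N"
      using measurable_space[OF m] by auto
    then show ?thesis using measurable_sets[OF m diag] by simp
  qed
  have "{z \<in> space ?N. \<forall>e\<in>?I. \<forall>e'\<in>?I. fst z e = fst z e' \<longleftrightarrow> r e = r e'} \<in> sets ?N"
  proof (intro sets.sets_Collect_finite_All finite_obs_index)
    fix e e' assume e: "e \<in> ?I" "e' \<in> ?I"
    show "{z \<in> space ?N. (fst z e = fst z e') = (r e = r e')} \<in> sets ?N"
      using eq[OF e] sets.sets_Collect_neg[OF eq[OF e]] by (cases "r e = r e'") auto
  qed
  then show ?thesis by (simp add: canon_eq_canons_iff[OF assms])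
qed

text \<open>The sample space splits into finitely many measurable events, one per partition, and on
  each of them the weight is a measurable \<open>canon_weight\<close>.\<close>

lemma predictive_weight_measurable:
  assumes "j \<in> {1..d}" "A \<in> sets P0"
  shows "(\<lambda>z. predictive_weight d qM H P0 n j (fst z) (snd z) A) \<in> borel_measurable (obs_space d P0 n)"
proof -
  let ?I = "obs_index d n" and ?N = "obs_space d P0 n"
  let ?E = "\<lambda>r. {z \<in> space ?N. canon ?I (fst z) = r}"
  have "predictive_weight d qM H P0 n j (fst z) (snd z) A
    = (\<Sum>r\<in>canons ?I. indicator (?E r) z * canon_weight n j r (snd z) (fst z) A)" if "z \<in> space ?N" for z
  proof -
    have "(\<Sum>r\<in>canons ?I. indicator (?E r) z * canon_weight n j r (snd z) (fst z) A)
      = (\<Sum>r\<in>canons ?I. if r = canon ?I (fst z) then canon_weight n j r (snd z) (fst z) A else 0)"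
      using that by (intro sum.cong) (auto simp: indicator_def)
    also have "\<dots> = canon_weight n j (canon ?I (fst z)) (snd z) (fst z) A"
      using canon_canons[of ?I "fst z"] by (simp add: finite_canons)
    finally show ?thesis by (simp only: predictive_weight_canon[OF assms(1)])
  qed
  moreover have "(\<lambda>z. \<Sum>r\<in>canons ?I. indicator (?E r) z * canon_weight n j r (snd z) (fst z) A) \<in> borel_measurable ?N"
    using canon_weight_measurable[OF assms] canon_event_measurable
    by (intro borel_measurable_sum borel_measurable_times borel_measurable_indicator) auto
  ultimately show ?thesis by (simp cong: measurable_cong)
qed

lemma predictive_weight_bounds:
  assumes j: "j \<in> {1..d}" and u: "\<forall>k\<in>{1..d}. 0 < u k"
  shows "0 \<le> predictive_weight d qM H P0 n j x u A"
    and "A \<in> sets P0 \<Longrightarrow> x \<in> space (PiM (obs_index d n) (\<lambda>_. P0)) \<Longrightarrow>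
      predictive_weight d qM H P0 n j x u A \<le> predictive_weight d qM H P0 n j x u (space P0)"
    and "1 \<le> n j \<Longrightarrow> x \<in> space (PiM (obs_index d n) (\<lambda>_. P0)) \<Longrightarrow>
      0 < predictive_weight d qM H P0 n j x u (space P0)"
proof -
  let ?r = "canon (obs_index d n) x"
  let ?K = "card (?r ` obs_index d n)"
  let ?c = "kappa (H j) (u j) 1 * (\<Prod>k \<in> {1..d} - {j}. kappa (H k) (u k) 0)
      * (Psi d qM H (?K + 1) u / Psi d qM H ?K u)"
  interpret P: prob_space P0 by (rule P0)
  have d: "1 \<le> d" and uj: "0 < u j" using j u by auto
  have c: "0 \<le> ?c"
    using Psi_nonneg[OF u d]
    by (intro mult_nonneg_nonneg divide_nonneg_nonneg prod_nonneg kappa_nonneg) auto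
  have pw: "predictive_weight d qM H P0 n j x u B
    = (\<Sum>y\<in>?r ` obs_index d n. ratio n ?r j u y * indicator B (x y)) + ?c * measure P0 B" for B
    unfolding predictive_weight_canon[OF j] canon_weight_def ..
  show "0 \<le> predictive_weight d qM H P0 n j x u A"
    unfolding pw
    by (intro add_nonneg_nonneg sum_nonneg mult_nonneg_nonneg[OF ratio_nonneg]
        mult_nonneg_nonneg[OF c] measure_nonneg indicator_pos_le)
  have x: "x y \<in> space P0"
    if "x \<in> space (PiM (obs_index d n) (\<lambda>_. P0))" "y \<in> ?r ` obs_index d n" for y
    using that canon_in(1)[of _ "obs_index d n" x] by (auto simp: space_PiM PiE_iff)
  show "predictive_weight d qM H P0 n j x u A \<le> predictive_weight d qM H P0 n j x u (space P0)"
    if "A \<in> sets P0" "x \<in> space (PiM (obs_index d n) (\<lambda>_. P0))"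
  proof -
    have "measure P0 A \<le> measure P0 (space P0)"
      using sets.sets_into_space[OF that(1)] by (intro P.finite_measure_mono) auto
    then have "?c * measure P0 A \<le> ?c * measure P0 (space P0)"
      using c by (rule mult_left_mono)
    moreover have "ratio n ?r j u y * indicator A (x y) \<le> ratio n ?r j u y * indicator (space P0) (x y)"
      if "y \<in> ?r ` obs_index d n" for y
      using x[OF \<open>x \<in> _\<close> that] by (intro mult_left_mono ratio_nonneg) (auto simp: indicator_def)
    ultimately show ?thesis unfolding pw by (intro add_mono sum_mono)
  qed
  show "0 < predictive_weight d qM H P0 n j x u (space P0)"
    if "1 \<le> n j" "x \<in> space (PiM (obs_index d n) (\<lambda>_. P0))"
  proof -
    \<comment> \<open>An observed value makes the sum nonempty. Positivity must come from there,
      since the \<open>P0\<close> part is 0 when \<open>qM\<close> charges no \<open>M\<close> above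
      the number of distinct values.\<close>
    have "(j, 1) \<in> obs_index d n" using that j by (auto simp: obs_index_def)
    moreover have "0 < ratio n ?r j u y" for y
      unfolding ratio_def by (intro divide_pos_pos kappa_pos uj)
    ultimately have "0 < (\<Sum>y\<in>?r ` obs_index d n. ratio n ?r j u y * indicator (space P0) (x y))"
      using x[OF that(2)] by (intro sum_pos) auto
    then show ?thesis unfolding pw
      by (intro add_pos_nonneg mult_nonneg_nonneg[OF c] measure_nonneg)
  qed
qed

text \<open>Allocations of the sample of sizes \<open>n'\<close> are allocations of the old sample
  plus a label for the new index. The sizes \<open>n'\<close> survive only in
  \<open>gamma_const n'\<close>, a factor independent of \<open>A\<close> and of the
  partition.\<close>

lemma predictive_disintegration:
  assumes j: "j \<in> {1..d}" and n: "\<And>k. k \<in> {1..d} \<Longrightarrow> 1 \<le> n k" and n': "n' = n(j := n j + 1)"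
    and F: "F \<in> borel_measurable (obs_space d P0 n)" and A: "A \<in> sets P0"
  shows "(\<integral>\<^sup>+z. F (restrict (fst z) (obs_index d n), snd z) * indicator A (fst z (j, n j + 1))
      \<partial>augmented_law d qM H P0 n') =
    (\<integral>\<^sup>+u. gamma_const n' u * (\<Sum>r\<in>canons (obs_index d n).
        ennreal (block_weight n r u * Psi d qM H (card (r ` obs_index d n)) u) *
        (\<integral>\<^sup>+\<sigma>. F (\<lambda>e\<in>obs_index d n. \<sigma> (r e), u) *
          ennreal (predictive_weight d qM H P0 n j (\<lambda>e\<in>obs_index d n. \<sigma> (r e)) u A)
         \<partial>PiM (r ` obs_index d n) (\<lambda>_. P0))) \<partial>PiM {1..d} (\<lambda>_. lborel))"
proof -
  let ?I = "obs_index d n" and ?I' = "obs_index d n'" and ?new = "(j, n j + 1)"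
  let ?F = "\<lambda>z. F (restrict (fst z) ?I, snd z) * indicator A (fst z ?new)"
  note F[measurable] A[measurable]
  have I': "?I' = insert ?new ?I" unfolding n' by (rule obs_index_insert[OF j])
  have new: "?new \<notin> ?I" by (simp add: obs_index_def)
  have F0: "F \<in> borel_measurable (PiM ?I (\<lambda>_. P0) \<Otimes>\<^sub>M PiM {1..d} (\<lambda>_. borel))"
    using F by (simp add: obs_space_def)
  have F': "?F \<in> borel_measurable (obs_space d P0 n')"
  proof -
    have [measurable]: "(\<lambda>z. (restrict (fst z) ?I, snd z)) \<in> measurable (obs_space d P0 n') (obs_space d P0 n)"
      unfolding obs_space_def I'
      by (intro measurable_Pair measurable_snd measurable_compose[OF measurable_fst] measurable_restrict_subset) auto
    have [measurable]: "(\<lambda>z. fst z ?new) \<in> measurable (obs_space d P0 n') P0"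
      by (rule measurable_obs_coordinates) (simp add: I')
    show ?thesis by measurable
  qed
  have n1: "1 \<le> n' k" if "k \<in> {1..d}" for k using n[OF that] by (simp add: n')
  show ?thesis
  proof (subst nn_integral_augmented_law[where F = ?F and n = n', OF F'], erule n1, intro nn_integral_cong)
    fix u assume "u \<in> space (PiM {1..d} (\<lambda>_. lborel :: real measure))"
    then have us: "u \<in> space (PiM {1..d} (\<lambda>_. borel :: real measure))" by (simp add: space_PiM)
    show "gamma_const n' u * (\<Sum>M. ennreal (pmf qM M) *
        (\<Sum>c\<in>PiE ?I' (\<lambda>_. {1..M}). ennreal (label_weight n' M u c) *
          (\<integral>\<^sup>+\<tau>. ?F (\<lambda>e\<in>?I'. \<tau> (c e), u) \<partial>PiM {1..M} (\<lambda>_. P0))))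
      = gamma_const n' u * (\<Sum>r\<in>canons ?I. ennreal (block_weight n r u * Psi d qM H (card (r ` ?I)) u) *
        (\<integral>\<^sup>+\<sigma>. F (\<lambda>e\<in>?I. \<sigma> (r e), u) *
          ennreal (predictive_weight d qM H P0 n j (\<lambda>e\<in>?I. \<sigma> (r e)) u A) \<partial>PiM (r ` ?I) (\<lambda>_. P0)))"
    proof (cases "\<forall>k\<in>{1..d}. 0 < u k")
      case False
      then obtain k where "k \<in> {1..d}" "u k \<le> 0" by force
      then show ?thesis by (simp add: gamma_const_eq_0)
    next
      case True
      have fm: "(\<lambda>x. F (x, u)) \<in> borel_measurable (PiM ?I (\<lambda>_. P0))"
        using measurable_compose[OF measurable_Pair2'[OF us] F0] by simp
      have "(\<Sum>c\<in>PiE ?I' (\<lambda>_. {1..M}). ennreal (label_weight n' M u c) *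
          (\<integral>\<^sup>+\<tau>. ?F (\<lambda>e\<in>?I'. \<tau> (c e), u) \<partial>PiM {1..M} (\<lambda>_. P0)))
        = (\<Sum>c\<in>PiE ?I (\<lambda>_. {1..M}). \<Sum>m=1..M. ennreal (label_weight n' M u (c(?new := m))) *
          (\<integral>\<^sup>+\<tau>. F (\<lambda>e\<in>?I. \<tau> (c e), u) * indicator A (\<tau> m) \<partial>PiM {1..M} (\<lambda>_. P0)))" for M
      proof -
        have "?F (\<lambda>e\<in>?I'. \<tau> ((c(?new := m)) e), u) = F (\<lambda>e\<in>?I. \<tau> (c e), u) * indicator A (\<tau> m)"
          for \<tau> :: "nat \<Rightarrow> 'a" and c m
        proof -
          have "restrict (\<lambda>e\<in>?I'. \<tau> ((c(?new := m)) e)) ?I = (\<lambda>e\<in>?I. \<tau> (c e))"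
            using new by (auto simp: restrict_def I' fun_eq_iff)
          then show ?thesis by (simp add: I')
        qed
        then show ?thesis unfolding I' sum_PiE_insert[OF new] by simp
      qed
      then show ?thesis
        using predictive_disintegration_fixed_u[where n = n and n' = n' and j = j and u = u
            and f = "\<lambda>x. F (x, u)" and A = A, OF j True n' fm A] by simp
    qed
  qed
qed

lemma augmented_law_U_nonpos:
  assumes n: "\<And>k. k \<in> {1..d} \<Longrightarrow> 1 \<le> n k"
  shows "emeasure (augmented_law d qM H P0 n) {z \<in> space (obs_space d P0 n). \<exists>k\<in>{1..d}. snd z k \<le> 0} = 0"
proof -
  let ?E = "{z \<in> space (obs_space d P0 n). \<exists>k\<in>{1..d}. snd z k \<le> 0}"
  have E: "?E \<in> sets (obs_space d P0 n)" by measurable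
  show ?thesis
  \<comment> \<open>The value of \<open>emeasure\<close> outside the sigma-algebra is 0 by
    convention, so membership of the event need not be decided.\<close>
  proof (cases "?E \<in> sets (augmented_law d qM H P0 n)")
    case True
    then have "emeasure (augmented_law d qM H P0 n) ?E = (\<integral>\<^sup>+z. indicator ?E z \<partial>augmented_law d qM H P0 n)"
      by simp
    also have "\<dots> = (\<integral>\<^sup>+u. 0 \<partial>PiM {1..d} (\<lambda>_. lborel :: real measure))"
    proof (subst nn_integral_augmented_law[OF borel_measurable_indicator[OF E] n], assumption, intro nn_integral_cong)
      fix u :: "nat \<Rightarrow> real"
      show "gamma_const n u * (\<Sum>M. ennreal (pmf qM M) *
        (\<Sum>c\<in>PiE (obs_index d n) (\<lambda>_. {1..M}). ennreal (label_weight n M u c) *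
          (\<integral>\<^sup>+\<tau>. indicator ?E (\<lambda>e\<in>obs_index d n. \<tau> (c e), u) \<partial>PiM {1..M} (\<lambda>_. P0)))) = 0"
      proof (cases "\<exists>k\<in>{1..d}. u k \<le> 0")
        case True
        then show ?thesis by (auto simp: gamma_const_eq_0)
      next
        case False
        then show ?thesis by (simp add: indicator_def)
      qed
    qed
    finally show ?thesis by simp
  qed (simp add: emeasure_notin_sets)
qed

text \<open>Both sides are instances of \<open>predictive_disintegration\<close>: the left with
  \<open>A\<close>, the right with the whole space and the test function multiplied by the quotient
  of weights. The trivial indicator on the right puts it in that shape.\<close>

lemma predictive_ratio_nn_integral:
  assumes j: "j \<in> {1..d}" and n: "\<And>k. k \<in> {1..d} \<Longrightarrow> 1 \<le> n k" and n': "n' = n(j := n j + 1)"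
    and F: "F \<in> borel_measurable (obs_space d P0 n)" and A: "A \<in> sets P0"
  shows "(\<integral>\<^sup>+z. F (restrict (fst z) (obs_index d n), snd z) * indicator A (fst z (j, n j + 1))
      \<partial>augmented_law d qM H P0 n') =
    (\<integral>\<^sup>+z. F (restrict (fst z) (obs_index d n), snd z) *
      ennreal (predictive_weight d qM H P0 n j (restrict (fst z) (obs_index d n)) (snd z) A
        / predictive_weight d qM H P0 n j (restrict (fst z) (obs_index d n)) (snd z) (space P0)) *
      indicator (space P0) (fst z (j, n j + 1)) \<partial>augmented_law d qM H P0 n')"
proof -
  let ?I = "obs_index d n"
  let ?p = "\<lambda>B z. predictive_weight d qM H P0 n j (fst z) (snd z) B"
  let ?G = "\<lambda>z. F z * ennreal (?p A z / ?p (space P0) z)"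
  have G: "?G \<in> borel_measurable (obs_space d P0 n)"
    using F predictive_weight_measurable[OF j A] predictive_weight_measurable[OF j sets.top] by measurable
  \<comment> \<open>Multiplying by the total weight undoes the division, as that weight is positive
    for positive \<open>u\<close>.\<close>
  have eq: "F (\<lambda>e\<in>?I. \<sigma> (r e), u) * ennreal (?p A (\<lambda>e\<in>?I. \<sigma> (r e), u))
    = ?G (\<lambda>e\<in>?I. \<sigma> (r e), u) * ennreal (?p (space P0) (\<lambda>e\<in>?I. \<sigma> (r e), u))"
    if u: "\<forall>k\<in>{1..d}. 0 < u k" and \<sigma>: "\<sigma> \<in> space (PiM (r ` ?I) (\<lambda>_. P0))" for u \<sigma> and r :: "nat \<times> nat \<Rightarrow> nat \<times> nat"
  proof -
    have "(\<lambda>e\<in>?I. \<sigma> (r e)) \<in> space (PiM ?I (\<lambda>_. P0))" using \<sigma> by (auto simp: space_PiM PiE_iff)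
    then have pos: "0 < ?p (space P0) (\<lambda>e\<in>?I. \<sigma> (r e), u)"
      using predictive_weight_bounds(3)[where n = n and j = j and u = u and x = "\<lambda>e\<in>?I. \<sigma> (r e)", OF j u n[OF j]] by simp
    have nn: "0 \<le> ?p A (\<lambda>e\<in>?I. \<sigma> (r e), u)" using predictive_weight_bounds(1)[where n = n and j = j and u = u and x = "\<lambda>e\<in>?I. \<sigma> (r e)" and A = A, OF j u] by simp
    show ?thesis
      using pos nn by (simp add: mult.assoc flip: ennreal_mult)
  qed
  show ?thesis
    using predictive_disintegration[OF j n n' F A] predictive_disintegration[OF j n n' G sets.top]
  proof (simp only: fst_conv snd_conv, intro nn_integral_cong)
    fix u :: "nat \<Rightarrow> real"
    show "gamma_const n' u * (\<Sum>r\<in>canons ?I.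
        ennreal (block_weight n r u * Psi d qM H (card (r ` ?I)) u) *
        (\<integral>\<^sup>+\<sigma>. F (\<lambda>e\<in>?I. \<sigma> (r e), u) *
          ennreal (predictive_weight d qM H P0 n j (\<lambda>e\<in>?I. \<sigma> (r e)) u A) \<partial>PiM (r ` ?I) (\<lambda>_. P0)))
      = gamma_const n' u * (\<Sum>r\<in>canons ?I.
        ennreal (block_weight n r u * Psi d qM H (card (r ` ?I)) u) *
        (\<integral>\<^sup>+\<sigma>. F (\<lambda>e\<in>?I. \<sigma> (r e), u) *
          ennreal (predictive_weight d qM H P0 n j (\<lambda>e\<in>?I. \<sigma> (r e)) u A
            / predictive_weight d qM H P0 n j (\<lambda>e\<in>?I. \<sigma> (r e)) u (space P0)) *
          ennreal (predictive_weight d qM H P0 n j (\<lambda>e\<in>?I. \<sigma> (r e)) u (space P0)) \<partial>PiM (r ` ?I) (\<lambda>_. P0)))"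
    proof (cases "\<forall>k\<in>{1..d}. 0 < u k")
      case True
      show ?thesis
        using eq[OF True] by (simp cong: nn_integral_cong)
    next
      case False
      then obtain k where "k \<in> {1..d}" "u k \<le> 0" by force
      then show ?thesis by (simp add: gamma_const_eq_0)
    qed
  qed
qed

section \<open>From integral identities to conditional expectation\<close>

lemma cond_exp_predictive:
  fixes \<theta> :: "nat \<Rightarrow> nat \<Rightarrow> 'w \<Rightarrow> 'a" and U :: "nat \<Rightarrow> 'w \<Rightarrow> real"
  assumes j: "j \<in> {1..d}" and n: "\<And>k. k \<in> {1..d} \<Longrightarrow> 1 \<le> n k" and n': "n' = n(j := n j + 1)"
    and \<Omega>: "prob_space \<Omega>"
    and \<theta>: "\<And>k i. (k, i) \<in> obs_index d n' \<Longrightarrow> \<theta> k i \<in> measurable \<Omega> P0"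
    and U: "\<And>k. k \<in> {1..d} \<Longrightarrow> U k \<in> borel_measurable \<Omega>"
    and model: "distr \<Omega> (obs_space d P0 n')
        (\<lambda>\<omega>. (\<lambda>(k, i) \<in> obs_index d n'. \<theta> k i \<omega>, \<lambda>k \<in> {1..d}. U k \<omega>))
      = augmented_law d qM H P0 n'"
    and A: "A \<in> sets P0"
  defines "X \<equiv> \<lambda>\<omega>. (\<lambda>(k, i) \<in> obs_index d n. \<theta> k i \<omega>, \<lambda>k \<in> {1..d}. U k \<omega>)"
  shows "AE \<omega> in \<Omega>. real_cond_exp \<Omega> (vimage_algebra (space \<Omega>) X (obs_space d P0 n))
        (indicator {\<omega> \<in> space \<Omega>. \<theta> j (n j + 1) \<omega> \<in> A}) \<omega>
    = predictive_weight d qM H P0 n j (fst (X \<omega>)) (snd (X \<omega>)) A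
      / predictive_weight d qM H P0 n j (fst (X \<omega>)) (snd (X \<omega>)) (space P0)"
proof -
  let ?I = "obs_index d n" and ?I' = "obs_index d n'" and ?N = "obs_space d P0 n" and ?N' = "obs_space d P0 n'"
  let ?new = "(j, n j + 1)"
  let ?L = "augmented_law d qM H P0 n'"
  let ?V = "vimage_algebra (space \<Omega>) X ?N"
  define Z where "Z = (\<lambda>\<omega>. (\<lambda>(k, i) \<in> ?I'. \<theta> k i \<omega>, \<lambda>k \<in> {1..d}. U k \<omega>))"
  define p where "p = (\<lambda>B z. predictive_weight d qM H P0 n j (fst z) (snd z) B)"
  define g where "g = (\<lambda>z. p A z / p (space P0) z)"
  interpret \<Omega>: prob_space \<Omega> by (rule \<Omega>)
  have I': "?I' = insert ?new ?I" unfolding n' by (rule obs_index_insert[OF j])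
  have Z: "Z \<in> measurable \<Omega> ?N'"
    unfolding Z_def obs_space_def
    by (intro measurable_Pair measurable_restrict) (use \<theta> U in \<open>auto simp: split_beta\<close>)
  have X: "X \<in> measurable \<Omega> ?N"
    unfolding X_def obs_space_def
    by (intro measurable_Pair measurable_restrict) (use \<theta> U in \<open>auto simp: split_beta I'\<close>)
  \<comment> \<open>The conditioning data forget the new observation but retain the whole auxiliary
    vector, whose law still has the shapes \<open>n'\<close>.\<close>
  have XZ: "(restrict (fst (Z \<omega>)) ?I, snd (Z \<omega>)) = X \<omega>" for \<omega>
    by (auto simp: X_def Z_def I' restrict_def fun_eq_iff)
  have newZ: "fst (Z \<omega>) ?new = \<theta> j (n j + 1) \<omega>" for \<omega>
    by (simp add: Z_def I')
  have \<theta>new: "\<theta> j (n j + 1) \<in> measurable \<Omega> P0" using \<theta>[of j "n j + 1"] by (simp add: I')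
  have model': "distr \<Omega> ?N' Z = ?L" using model by (simp add: Z_def)
  have p_meas: "p B \<in> borel_measurable ?N" if "B \<in> sets P0" for B
    unfolding p_def by (rule predictive_weight_measurable[OF j that])
  have g_meas[measurable]: "g \<in> borel_measurable ?N"
    unfolding g_def using p_meas[OF A] p_meas[OF sets.top] by measurable
  have transfer: "(\<integral>\<^sup>+z. F (restrict (fst z) ?I, snd z) * indicator B (fst z ?new) \<partial>?L)
    = (\<integral>\<^sup>+\<omega>. F (X \<omega>) * indicator B (\<theta> j (n j + 1) \<omega>) \<partial>\<Omega>)"
    if F[measurable]: "F \<in> borel_measurable ?N" and B[measurable]: "B \<in> sets P0" for F and B :: "'a set"
  proof -
    have [measurable]: "(\<lambda>z. (restrict (fst z) ?I, snd z)) \<in> measurable ?N' ?N"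
      unfolding obs_space_def I'
      by (intro measurable_Pair measurable_snd measurable_compose[OF measurable_fst] measurable_restrict_subset) auto
    have [measurable]: "(\<lambda>z. fst z ?new) \<in> measurable ?N' P0"
      by (rule measurable_obs_coordinates) (simp add: I')
    show ?thesis
      unfolding model'[symmetric] by (subst nn_integral_distr[OF Z]) (measurable, simp only: XZ newZ)
  qed
  have cond: "(\<integral>\<^sup>+\<omega>. F (X \<omega>) * indicator A (\<theta> j (n j + 1) \<omega>) \<partial>\<Omega>) = (\<integral>\<^sup>+\<omega>. F (X \<omega>) * ennreal (g (X \<omega>)) \<partial>\<Omega>)"
    if F: "F \<in> borel_measurable ?N" for F
  proof -
    have G: "(\<lambda>z. F z * ennreal (g z)) \<in> borel_measurable ?N" using F by measurable
    have "(\<integral>\<^sup>+\<omega>. F (X \<omega>) * indicator A (\<theta> j (n j + 1) \<omega>) \<partial>\<Omega>)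
      = (\<integral>\<^sup>+z. F (restrict (fst z) ?I, snd z) * ennreal (g (restrict (fst z) ?I, snd z)) * indicator (space P0) (fst z ?new) \<partial>?L)"
      using predictive_ratio_nn_integral[OF j n n' F A] transfer[OF F A] by (simp add: g_def p_def)
    also have "\<dots> = (\<integral>\<^sup>+\<omega>. F (X \<omega>) * ennreal (g (X \<omega>)) * indicator (space P0) (\<theta> j (n j + 1) \<omega>) \<partial>\<Omega>)"
      by (rule transfer[OF G sets.top])
    also have "\<dots> = (\<integral>\<^sup>+\<omega>. F (X \<omega>) * ennreal (g (X \<omega>)) \<partial>\<Omega>)"
      using measurable_space[OF \<theta>new] by (intro nn_integral_cong) simp
    finally show ?thesis .
  qed
  have U_pos: "AE \<omega> in \<Omega>. \<forall>k\<in>{1..d}. 0 < snd (X \<omega>) k"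
  proof (rule AE_I)
    let ?E = "{z \<in> space ?N'. \<exists>k\<in>{1..d}. snd z k \<le> 0}"
    have E: "?E \<in> sets ?N'" by measurable
    show "{\<omega> \<in> space \<Omega>. \<not> (\<forall>k\<in>{1..d}. 0 < snd (X \<omega>) k)} \<subseteq> Z -` ?E \<inter> space \<Omega>"
      using measurable_space[OF Z] by (auto simp: X_def Z_def not_less)
    show "Z -` ?E \<inter> space \<Omega> \<in> sets \<Omega>" by (rule measurable_sets[OF Z E])
    have "emeasure \<Omega> (Z -` ?E \<inter> space \<Omega>) = emeasure ?L ?E"
      unfolding model'[symmetric] by (rule emeasure_distr[OF Z E, symmetric])
    also have "\<dots> = 0" using n by (intro augmented_law_U_nonpos) (simp add: n')
    finally show "emeasure \<Omega> (Z -` ?E \<inter> space \<Omega>) = 0" .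
  qed
  \<comment> \<open>Outside positive \<open>u\<close> the quotient is not controlled, so the bounds
    hold only almost surely. They give integrability and the passage between real and nonnegative
    integrals.\<close>
  have g_bounds: "AE \<omega> in \<Omega>. 0 \<le> g (X \<omega>) \<and> g (X \<omega>) \<le> 1"
    using U_pos AE_space
  proof eventually_elim
    case (elim \<omega>)
    have x: "fst (X \<omega>) \<in> space (PiM ?I (\<lambda>_. P0))"
      using measurable_space[OF X elim(2)] by (auto simp: obs_space_def space_pair_measure)
    have u: "\<forall>k\<in>{1..d}. 0 < snd (X \<omega>) k" by (rule elim(1))
    have "0 \<le> p A (X \<omega>)" "p A (X \<omega>) \<le> p (space P0) (X \<omega>)" "0 < p (space P0) (X \<omega>)"
      unfolding p_def
      by (rule predictive_weight_bounds[OF j u]; use A x n[OF j] in simp)+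
    then show ?case by (simp add: g_def)
  qed
  have gX: "(\<lambda>\<omega>. g (X \<omega>)) \<in> borel_measurable \<Omega>" using X by measurable
  let ?f = "indicator {\<omega> \<in> space \<Omega>. \<theta> j (n j + 1) \<omega> \<in> A} :: 'w \<Rightarrow> real"
  have S: "{\<omega> \<in> space \<Omega>. \<theta> j (n j + 1) \<omega> \<in> A} \<in> sets \<Omega>"
    using measurable_sets[OF \<theta>new A] by (simp add: vimage_def Int_def conj_commute)
  have "finite_measure_subalgebra \<Omega> ?V"
  proof
    show "subalgebra \<Omega> ?V"
      unfolding subalgebra_def using X by (auto dest: subsetD[OF sets_image_in_sets[OF refl X]])
  qed
  then interpret V: sigma_finite_subalgebra \<Omega> ?V by (rule finite_measure_subalgebra_is_sigma_finite)
  have "AE \<omega> in \<Omega>. real_cond_exp \<Omega> ?V ?f \<omega> = g (X \<omega>)"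
  proof (rule V.real_cond_exp_charact)
    fix C assume "C \<in> sets ?V"
    \<comment> \<open>Events of the conditioning sigma-algebra are preimages under \<open>X\<close>,
      so the indicator of \<open>B\<close> can serve as the test function.\<close>
    then obtain B where B: "B \<in> sets ?N" "C = X -` B \<inter> space \<Omega>"
      using measurable_space[OF X] by (subst (asm) sets_vimage_algebra2) auto
    have C[measurable]: "C \<in> sets \<Omega>" unfolding B(2) by (rule measurable_sets[OF X B(1)])
    note S[measurable] gX[measurable]
    have "(\<integral>\<omega>\<in>C. ?f \<omega> \<partial>\<Omega>) = enn2real (\<integral>\<^sup>+\<omega>. ennreal (indicator C \<omega> *\<^sub>R ?f \<omega>) \<partial>\<Omega>)"
      unfolding set_lebesgue_integral_def by (intro integral_eq_nn_integral borel_measurable_scaleR borel_measurable_indicator C S) simp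
    also have "(\<integral>\<^sup>+\<omega>. ennreal (indicator C \<omega> *\<^sub>R ?f \<omega>) \<partial>\<Omega>)
      = (\<integral>\<^sup>+\<omega>. indicator B (X \<omega>) * indicator A (\<theta> j (n j + 1) \<omega>) \<partial>\<Omega>)"
      by (intro nn_integral_cong) (auto simp: indicator_def B(2))
    also have "\<dots> = (\<integral>\<^sup>+\<omega>. indicator B (X \<omega>) * ennreal (g (X \<omega>)) \<partial>\<Omega>)"
      using B(1) by (intro cond) simp
    also have "\<dots> = (\<integral>\<^sup>+\<omega>. ennreal (indicator C \<omega> *\<^sub>R g (X \<omega>)) \<partial>\<Omega>)"
      by (intro nn_integral_cong) (auto simp: indicator_def B(2))
    also have "enn2real \<dots> = (\<integral>\<omega>\<in>C. g (X \<omega>) \<partial>\<Omega>)"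
      unfolding set_lebesgue_integral_def using g_bounds
      by (intro integral_eq_nn_integral[symmetric] borel_measurable_scaleR borel_measurable_indicator C gX)
        (auto elim!: eventually_mono)
    finally show "(\<integral>\<omega>\<in>C. ?f \<omega> \<partial>\<Omega>) = (\<integral>\<omega>\<in>C. g (X \<omega>) \<partial>\<Omega>)" .
  next
    show "integrable \<Omega> ?f" using S by (simp add: less_top[symmetric])
    show "integrable \<Omega> (\<lambda>\<omega>. g (X \<omega>))"
    proof (rule \<Omega>.integrable_const_bound[OF _ gX])
      show "AE \<omega> in \<Omega>. norm (g (X \<omega>)) \<le> 1" using g_bounds by eventually_elim simp
    qed
    show "(\<lambda>\<omega>. g (X \<omega>)) \<in> borel_measurable ?V"
      by (rule measurable_compose[OF measurable_vimage_algebra1 g_meas]) (use measurable_space[OF X] in auto)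
  qed
  then show ?thesis by (simp add: g_def p_def)
qed

end

section \<open>The setting of the theorem as an instance of the atom model\<close>

lemma atom_model_jump_law:
  fixes P0 :: "('a :: {second_countable_topology, metric_space}) measure"
  assumes P0: "prob_space P0" "sets P0 = sets (restrict_space borel \<Theta>)"
    and diffuse: "\<And>x. x \<in> \<Theta> \<Longrightarrow> measure P0 {x} = 0"
    and qM: "set_pmf qM \<subseteq> {1..}"
    and h_meas: "\<And>g. 0 < g \<Longrightarrow> h g \<in> borel_measurable borel"
    and h_prob: "\<And>g. 0 < g \<Longrightarrow> prob_space (jump_law h g)"
    and H: "\<And>k. \<exists>g>0. H k = jump_law h g"
  shows "atom_model qM H P0"
proof (rule atom_model.intro)
  interpret prob_space P0 by (rule P0(1))
  show "prob_space P0" by (rule P0(1))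
  have sp: "space P0 = \<Theta>" using sets_eq_imp_space_eq[OF P0(2)] by (simp add: space_restrict_space)
  have "(\<lambda>x. x) \<in> measurable (restrict_space borel \<Theta>) borel"
    by (intro measurable_restrict_space1 measurable_ident_sets refl)
  then have id: "(\<lambda>x. x) \<in> borel_measurable P0"
    by (simp cong: measurable_cong_sets add: P0(2))
  \<comment> \<open>The diagonal is the zero set of the distance, which second countability makes
    measurable for the product sigma-algebra.\<close>
  have "{z \<in> space (P0 \<Otimes>\<^sub>M P0). dist (fst z) (snd z) = 0} \<in> sets (P0 \<Otimes>\<^sub>M P0)"
  proof -
    have [measurable]: "fst \<in> borel_measurable (P0 \<Otimes>\<^sub>M P0)" "snd \<in> borel_measurable (P0 \<Otimes>\<^sub>M P0)"
      by (rule measurable_compose[OF measurable_fst id], rule measurable_compose[OF measurable_snd id])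
    show ?thesis by measurable
  qed
  then show "{z \<in> space (P0 \<Otimes>\<^sub>M P0). fst z = snd z} \<in> sets (P0 \<Otimes>\<^sub>M P0)" by simp
  show "emeasure P0 {x} = 0" if "x \<in> space P0" for x
    using diffuse[of x] that by (simp add: sp emeasure_eq_measure)
  show "0 \<notin> set_pmf qM" using qM by auto
  fix k
  obtain g where g: "0 < g" "H k = jump_law h g" using H by blast
  show "prob_space (H k)" using h_prob g by simp
  show "sets (H k) = sets borel" by (simp add: g jump_law_def)
  have "h g \<in> borel_measurable borel" by (rule h_meas[OF g(1)])
  then show "AE s in H k. 0 < s"
    unfolding g(2) jump_law_def by (subst AE_density) (auto simp: indicator_def split: if_splits)
qed

lemma augmented_law_cong:
  assumes "\<And>k. k \<in> {1..d} \<Longrightarrow> H k = H' k"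
  shows "augmented_law d qM H P0 n = augmented_law d qM H' P0 n"
proof -
  have "atoms_law d H P0 M = atoms_law d H' P0 M" for M
    unfolding atoms_law_def using assms by (intro arg_cong2[where f = pair_measure] PiM_cong) auto
  then show ?thesis unfolding augmented_law_def by simp
qed

lemma predictive_weight_cong:
  assumes "\<And>k. k \<in> {1..d} \<Longrightarrow> H k = H' k" "j \<in> {1..d}"
  shows "predictive_weight d qM H P0 n j = predictive_weight d qM H' P0 n j"
proof -
  have "Psi d qM H = Psi d qM H'"
    unfolding Psi_def by (intro ext suminf_cong arg_cong2[where f = times] prod.cong refl) (simp add: assms(1))
  moreover have "(\<Prod>k \<in> {1..d} - {j}. kappa (H k) (u k) 0) = (\<Prod>k \<in> {1..d} - {j}. kappa (H' k) (u k) 0)" for u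
    by (intro prod.cong refl) (simp add: assms(1))
  ultimately show ?thesis
    unfolding predictive_weight_def by (intro ext) (simp add: assms(1)[OF assms(2)])
qed

theorem mainTheorem8:
  fixes d :: nat
    and \<Theta> :: "(real ^ 's) set"
    and P0 :: "(real ^ 's) measure"
    and qM :: "nat pmf"
    and h :: "real \<Rightarrow> real \<Rightarrow> real"
    and \<gamma> :: "nat \<Rightarrow> real"
    and H :: "nat \<Rightarrow> real measure"
    and n n' :: "nat \<Rightarrow> nat"
    and j :: nat
    and \<Omega> :: "'w measure"
    and \<theta> :: "nat \<Rightarrow> nat \<Rightarrow> 'w \<Rightarrow> real ^ 's"
    and U :: "nat \<Rightarrow> 'w \<Rightarrow> real"
  assumes d: "1 \<le> d"
    and P0: "prob_space P0" "sets P0 = sets (restrict_space borel \<Theta>)"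
    and diffuse: "\<And>x. x \<in> \<Theta> \<Longrightarrow> measure P0 {x} = 0"
    and qM: "set_pmf qM \<subseteq> {1..}"
    and h_meas: "\<And>g. 0 < g \<Longrightarrow> h g \<in> borel_measurable borel"
    and h_nonneg: "\<And>g s. 0 < g \<Longrightarrow> 0 < s \<Longrightarrow> 0 \<le> h g s"
    and h_prob: "\<And>g. 0 < g \<Longrightarrow> prob_space (jump_law h g)"
    and \<gamma>: "\<And>k. k \<in> {1..d} \<Longrightarrow> 0 < \<gamma> k"
    and H: "\<And>k. k \<in> {1..d} \<Longrightarrow> H k = jump_law h (\<gamma> k)"
    and n: "\<And>k. k \<in> {1..d} \<Longrightarrow> 1 \<le> n k"
    and j: "j \<in> {1..d}"
    and n': "n' = n(j := n j + 1)"
    and \<Omega>: "prob_space \<Omega>"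
    and \<theta>: "\<And>k i. (k, i) \<in> obs_index d n' \<Longrightarrow> \<theta> k i \<in> measurable \<Omega> P0"
    and U: "\<And>k. k \<in> {1..d} \<Longrightarrow> U k \<in> borel_measurable \<Omega>"
    and model: "distr \<Omega> (obs_space d P0 n')
        (\<lambda>\<omega>. (\<lambda>(k, i) \<in> obs_index d n'. \<theta> k i \<omega>, \<lambda>k \<in> {1..d}. U k \<omega>))
      = augmented_law d qM H P0 n'"
  shows "\<forall>A \<in> sets P0. AE \<omega> in \<Omega>.
    real_cond_exp \<Omega>
        (vimage_algebra (space \<Omega>)
          (\<lambda>\<omega>. (\<lambda>(k, i) \<in> obs_index d n. \<theta> k i \<omega>, \<lambda>k \<in> {1..d}. U k \<omega>)) (obs_space d P0 n))
        (indicator {\<omega> \<in> space \<Omega>. \<theta> j (n j + 1) \<omega> \<in> A}) \<omega>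
    = predictive_weight d qM H P0 n j
        (\<lambda>(k, i) \<in> obs_index d n. \<theta> k i \<omega>) (\<lambda>k \<in> {1..d}. U k \<omega>) A
      / predictive_weight d qM H P0 n j
        (\<lambda>(k, i) \<in> obs_index d n. \<theta> k i \<omega>) (\<lambda>k \<in> {1..d}. U k \<omega>) (space P0)"
proof
  fix A assume A: "A \<in> sets P0"
  \<comment> \<open>The values of \<open>H\<close> outside \<open>{1..d}\<close> are arbitrary, while product measures need every factor to
    be \<open>\<sigma>\<close>-finite.\<close>
  define H' where "H' = (\<lambda>k. if k \<in> {1..d} then H k else H j)"
  have HH': "H k = H' k" if "k \<in> {1..d}" for k using that by (simp add: H'_def)
  have "\<exists>g>0. H' k = jump_law h g" for k
    using H \<gamma> j by (cases "k \<in> {1..d}") (auto simp: H'_def)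
  then interpret atom_model d qM H' P0
    by (intro atom_model_jump_law[OF P0 diffuse qM h_meas h_prob])
  have "augmented_law d qM H P0 n' = augmented_law d qM H' P0 n'"
    by (rule augmented_law_cong[OF HH'])
  note model' = model[unfolded this]
  have pw: "predictive_weight d qM H P0 n j = predictive_weight d qM H' P0 n j"
    by (rule predictive_weight_cong[OF HH' j])
  show "AE \<omega> in \<Omega>.
    real_cond_exp \<Omega>
        (vimage_algebra (space \<Omega>)
          (\<lambda>\<omega>. (\<lambda>(k, i) \<in> obs_index d n. \<theta> k i \<omega>, \<lambda>k \<in> {1..d}. U k \<omega>)) (obs_space d P0 n))
        (indicator {\<omega> \<in> space \<Omega>. \<theta> j (n j + 1) \<omega> \<in> A}) \<omega>
    = predictive_weight d qM H P0 n j
        (\<lambda>(k, i) \<in> obs_index d n. \<theta> k i \<omega>) (\<lambda>k \<in> {1..d}. U k \<omega>) A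
      / predictive_weight d qM H P0 n j
        (\<lambda>(k, i) \<in> obs_index d n. \<theta> k i \<omega>) (\<lambda>k \<in> {1..d}. U k \<omega>) (space P0)"
    unfolding pw
    using cond_exp_predictive[OF j n n' \<Omega> \<theta> U model' A] by simp
qed

end
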